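(* Let $(R,\mathfrak m,k)$ be a commutative Noetherian local ring with $\mathfrak m\neq 0$. Then $\nu^1_2=0$ if and only if $s(R)=1$.
   Context: $\nu^1_2\colon \operatorname{Tor}_2^R(k,R/\mathfrak m^{2})\to\operatorname{Tor}_2^R(k,R/\mathfrak m)$ is the map induced by the canonical surjection $R/\mathfrak m^{2}\to R/\mathfrak m$. Let $\widehat R\cong Q/\mathfrak a$ be a minimal Cohen presentation of the $\mathfrak m$-adic completion of $R$, with $(Q,\mathfrak n,k)$ a regular local ring and $\mathfrak a\subseteq\mathfrak n^2$. Set $s(R)=\inf\{i\ge 1\mid \mathfrak a\cap\mathfrak n^{i+2}\subseteq\mathfrak n\mathfrak a\}$; this does not depend on the choice of the presentation. *)

theory Defs
  imports "HOL-Algebra.Algebra" "HOL-Library.Extended_Nat"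
begin

section \<open>Local rings\<close>

definition noetherian_local_ring :: "('a, 'r) ring_scheme \<Rightarrow> 'a set \<Rightarrow> bool" where
  "noetherian_local_ring R m \<longleftrightarrow>
     cring R \<and> noetherian_ring R \<and> maximalideal m R \<and> (\<forall>I. maximalideal I R \<longrightarrow> I = m)"

definition ideal_pow :: "('a, 'r) ring_scheme \<Rightarrow> 'a set \<Rightarrow> nat \<Rightarrow> 'a set" where
  "ideal_pow R I n = I [^]\<^bsub>ideals_set R\<^esub> n"

definition krull_dim :: "('a, 'r) ring_scheme \<Rightarrow> enat" where
  "krull_dim R = Sup {enat l | l. \<exists>p :: nat \<Rightarrow> 'a set.
     (\<forall>i\<le>l. primeideal (p i) R) \<and> (\<forall>i<l. p i \<subset> p (Suc i))}"

definition regular_local_ring :: "('a, 'r) ring_scheme \<Rightarrow> 'a set \<Rightarrow> bool" where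
  "regular_local_ring Q n \<longleftrightarrow> noetherian_local_ring Q n \<and>
     (\<exists>S. finite S \<and> S \<subseteq> carrier Q \<and> genideal Q S = n \<and> enat (card S) = krull_dim Q)"

text \<open>The inverse limit of the rings \<open>R/m\<^sup>n\<close>: families of cosets such that the image of the
  \<open>(n+1)\<close>-st one under the surjection \<open>R/m\<^sup>n\<^sup>+\<^sup>1 \<rightarrow> R/m\<^sup>n\<close> is the \<open>n\<close>-th one.\<close>

definition completion :: "('a, 'r) ring_scheme \<Rightarrow> 'a set \<Rightarrow> (nat \<Rightarrow> 'a set) ring" where
  "completion R m =
     \<lparr> carrier = {x. \<forall>n. x n \<in> carrier (R Quot ideal_pow R m n)
                       \<and> ideal_pow R m n <+>\<^bsub>R\<^esub> x (Suc n) = x n},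
       monoid.mult = (\<lambda>x y n. x n \<otimes>\<^bsub>R Quot ideal_pow R m n\<^esub> y n),
       monoid.one = (\<lambda>n. \<one>\<^bsub>R Quot ideal_pow R m n\<^esub>),
       ring.zero = (\<lambda>n. \<zero>\<^bsub>R Quot ideal_pow R m n\<^esub>),
       ring.add = (\<lambda>x y n. x n \<oplus>\<^bsub>R Quot ideal_pow R m n\<^esub> y n) \<rparr>"

definition minimal_Cohen_presentation ::
  "('a, 'r) ring_scheme \<Rightarrow> 'a set \<Rightarrow> ('q, 's) ring_scheme \<Rightarrow> 'q set \<Rightarrow> 'q set \<Rightarrow> bool" where
  "minimal_Cohen_presentation R m Q n a \<longleftrightarrow>
     regular_local_ring Q n \<and> ideal a Q \<and> a \<subseteq> ideal_pow Q n 2 \<and> completion R m \<simeq> Q Quot a"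

text \<open>The value is \<open>\<infinity>\<close> if no \<open>i\<close> qualifies.\<close>

definition s_invariant :: "('q, 's) ring_scheme \<Rightarrow> 'q set \<Rightarrow> 'q set \<Rightarrow> enat" where
  "s_invariant Q n a =
     Inf {enat i | i. 1 \<le> i \<and> a \<inter> ideal_pow Q n (i + 2) \<subseteq> ideal_prod Q n a}"


section \<open>Modules and free resolutions\<close>

text \<open>The fields \<open>mult\<close> and \<open>one\<close> of a module record play no role for the module structure.\<close>

definition quot_module :: "('a, 'r) ring_scheme \<Rightarrow> 'a set \<Rightarrow> ('a, 'a set) module" where
  "quot_module R I =
     \<lparr> carrier = carrier (R Quot I), monoid.mult = monoid.mult (R Quot I),
       monoid.one = monoid.one (R Quot I),
       ring.zero = ring.zero (R Quot I), ring.add = ring.add (R Quot I),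
       smult = (\<lambda>r C. (I +>\<^bsub>R\<^esub> r) \<otimes>\<^bsub>R Quot I\<^esub> C) \<rparr>"

definition module_hom ::
  "('a, 'r) ring_scheme \<Rightarrow> ('a, 'b, 'm) module_scheme \<Rightarrow> ('a, 'c, 'n) module_scheme \<Rightarrow> ('b \<Rightarrow> 'c) set"
  where
  "module_hom R M N = {f. f \<in> carrier M \<rightarrow> carrier N
     \<and> (\<forall>x\<in>carrier M. \<forall>y\<in>carrier M. f (x \<oplus>\<^bsub>M\<^esub> y) = f x \<oplus>\<^bsub>N\<^esub> f y)
     \<and> (\<forall>r\<in>carrier R. \<forall>x\<in>carrier M. f (r \<odot>\<^bsub>M\<^esub> x) = r \<odot>\<^bsub>N\<^esub> f x)}"

text \<open>Bases may be infinite.\<close>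

definition free_module :: "('a, 'r) ring_scheme \<Rightarrow> ('a, 'b, 'm) module_scheme \<Rightarrow> bool" where
  "free_module R M \<longleftrightarrow> module R M \<and>
     (\<exists>B \<subseteq> carrier M. \<forall>x\<in>carrier M. \<exists>!c :: 'b \<Rightarrow> 'a.
        range c \<subseteq> carrier R \<and> finite {b. c b \<noteq> \<zero>\<^bsub>R\<^esub>} \<and> {b. c b \<noteq> \<zero>\<^bsub>R\<^esub>} \<subseteq> B
        \<and> x = finsum M (\<lambda>b. c b \<odot>\<^bsub>M\<^esub> b) {b. c b \<noteq> \<zero>\<^bsub>R\<^esub>})"

text \<open>An exact sequence \<open>\<dots> \<rightarrow> F 2 \<rightarrow> F 1 \<rightarrow> F 0 \<rightarrow> N \<rightarrow> 0\<close> with free modules \<open>F i\<close>, differentials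
  \<open>d i : F (i + 1) \<rightarrow> F i\<close> (note the index shift) and augmentation \<open>e : F 0 \<rightarrow> N\<close>.\<close>

definition free_resolution ::
  "('a, 'r) ring_scheme \<Rightarrow> (nat \<Rightarrow> ('a, 'b, 'm) module_scheme) \<Rightarrow> (nat \<Rightarrow> 'b \<Rightarrow> 'b) \<Rightarrow> ('b \<Rightarrow> 'c)
    \<Rightarrow> ('a, 'c, 'n) module_scheme \<Rightarrow> bool" where
  "free_resolution R F d e N \<longleftrightarrow>
     module R N \<and> (\<forall>i. free_module R (F i))
     \<and> e \<in> module_hom R (F 0) N \<and> (\<forall>i. d i \<in> module_hom R (F (Suc i)) (F i))
     \<and> e ` carrier (F 0) = carrier N
     \<and> d 0 ` carrier (F 1) = {x \<in> carrier (F 0). e x = \<zero>\<^bsub>N\<^esub>}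
     \<and> (\<forall>i. d (Suc i) ` carrier (F (Suc (Suc i))) = {x \<in> carrier (F (Suc i)). d i x = \<zero>\<^bsub>F i\<^esub>})"


section \<open>Tensor products\<close>

text \<open>The abelian group underlying \<open>M \<otimes>\<^sub>R N\<close>: the free abelian group on pairs modulo the subgroup
  generated by the bilinearity and balancing relations.\<close>

definition tensor_relations ::
  "('a, 'r) ring_scheme \<Rightarrow> ('a, 'b, 'm) module_scheme \<Rightarrow> ('a, 'c, 'n) module_scheme
    \<Rightarrow> ('b \<times> 'c \<Rightarrow>\<^sub>0 int) set" where
  "tensor_relations R M N =
     generate (free_Abelian_group (carrier M \<times> carrier N))
      ({frag_of (x \<oplus>\<^bsub>M\<^esub> x', y) - frag_of (x, y) - frag_of (x', y) | x x' y.
          x \<in> carrier M \<and> x' \<in> carrier M \<and> y \<in> carrier N}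
     \<union> {frag_of (x, y \<oplus>\<^bsub>N\<^esub> y') - frag_of (x, y) - frag_of (x, y') | x y y'.
          x \<in> carrier M \<and> y \<in> carrier N \<and> y' \<in> carrier N}
     \<union> {frag_of (r \<odot>\<^bsub>M\<^esub> x, y) - frag_of (x, r \<odot>\<^bsub>N\<^esub> y) | r x y.
          r \<in> carrier R \<and> x \<in> carrier M \<and> y \<in> carrier N})"

definition tensor_group ::
  "('a, 'r) ring_scheme \<Rightarrow> ('a, 'b, 'm) module_scheme \<Rightarrow> ('a, 'c, 'n) module_scheme
    \<Rightarrow> ('b \<times> 'c \<Rightarrow>\<^sub>0 int) set monoid" where
  "tensor_group R M N =
     free_Abelian_group (carrier M \<times> carrier N) Mod tensor_relations R M N"

text \<open>The map \<open>f \<otimes> g\<close> into \<open>M' \<otimes>\<^sub>R N'\<close>. On a coset \<open>C\<close>, the product of the relation subgroup with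
  the image of \<open>C\<close> is the coset of the image of any representative.\<close>

definition tensor_map ::
  "('a, 'r) ring_scheme \<Rightarrow> ('a, 'd, 'm) module_scheme \<Rightarrow> ('a, 'e, 'n) module_scheme
    \<Rightarrow> ('b \<Rightarrow> 'd) \<Rightarrow> ('c \<Rightarrow> 'e) \<Rightarrow> ('b \<times> 'c \<Rightarrow>\<^sub>0 int) set \<Rightarrow> ('d \<times> 'e \<Rightarrow>\<^sub>0 int) set" where
  "tensor_map R M' N' f g C =
     tensor_relations R M' N' <#>\<^bsub>free_Abelian_group (carrier M' \<times> carrier N')\<^esub>
       (frag_extend (\<lambda>(x, y). frag_of (f x, g y)) ` C)"


section \<open>Tor\<close>

text \<open>For a free resolution \<open>(F, d)\<close> of \<open>K\<close>, the group \<open>Tor R F d N i\<close> is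
  \<open>Tor\<^sub>i\<^sup>R(K, N) = H\<^sub>i(F \<otimes>\<^sub>R N)\<close>.\<close>

definition Tor_cycles ::
  "('a, 'r) ring_scheme \<Rightarrow> (nat \<Rightarrow> ('a, 'b, 'm) module_scheme) \<Rightarrow> (nat \<Rightarrow> 'b \<Rightarrow> 'b)
    \<Rightarrow> ('a, 'c, 'n) module_scheme \<Rightarrow> nat \<Rightarrow> ('b \<times> 'c \<Rightarrow>\<^sub>0 int) set set" where
  "Tor_cycles R F d N i = (case i of
     0 \<Rightarrow> carrier (tensor_group R (F 0) N)
   | Suc j \<Rightarrow> kernel (tensor_group R (F (Suc j)) N) (tensor_group R (F j) N)
                (tensor_map R (F j) N (d j) id))"

definition Tor_boundaries ::
  "('a, 'r) ring_scheme \<Rightarrow> (nat \<Rightarrow> ('a, 'b, 'm) module_scheme) \<Rightarrow> (nat \<Rightarrow> 'b \<Rightarrow> 'b)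
    \<Rightarrow> ('a, 'c, 'n) module_scheme \<Rightarrow> nat \<Rightarrow> ('b \<times> 'c \<Rightarrow>\<^sub>0 int) set set" where
  "Tor_boundaries R F d N i =
     tensor_map R (F i) N (d i) id ` carrier (tensor_group R (F (Suc i)) N)"

definition Tor ::
  "('a, 'r) ring_scheme \<Rightarrow> (nat \<Rightarrow> ('a, 'b, 'm) module_scheme) \<Rightarrow> (nat \<Rightarrow> 'b \<Rightarrow> 'b)
    \<Rightarrow> ('a, 'c, 'n) module_scheme \<Rightarrow> nat \<Rightarrow> ('b \<times> 'c \<Rightarrow>\<^sub>0 int) set set monoid" where
  "Tor R F d N i =
     (tensor_group R (F i) N)\<lparr>carrier := Tor_cycles R F d N i\<rparr> Mod Tor_boundaries R F d N i"

text \<open>The map \<open>Tor\<^sub>i\<^sup>R(K, N) \<rightarrow> Tor\<^sub>i\<^sup>R(K, N')\<close> induced by \<open>g : N \<rightarrow> N'\<close>.\<close>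

definition Tor_map ::
  "('a, 'r) ring_scheme \<Rightarrow> (nat \<Rightarrow> ('a, 'b, 'm) module_scheme) \<Rightarrow> (nat \<Rightarrow> 'b \<Rightarrow> 'b)
    \<Rightarrow> ('a, 'e, 'n) module_scheme \<Rightarrow> ('c \<Rightarrow> 'e) \<Rightarrow> nat
    \<Rightarrow> ('b \<times> 'c \<Rightarrow>\<^sub>0 int) set set \<Rightarrow> ('b \<times> 'e \<Rightarrow>\<^sub>0 int) set set" where
  "Tor_map R F d N' g i C =
     Tor_boundaries R F d N' i <#>\<^bsub>tensor_group R (F i) N'\<^esub> (tensor_map R (F i) N' id g ` C)"

text \<open>Here \<open>(F, d)\<close> is a free resolution of \<open>R/m\<close>, and \<open>C \<mapsto> m + C\<close> is the canonical surjection
  \<open>R/m\<^sup>2 \<rightarrow> R/m\<close>.\<close>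

definition nu_1_2 ::
  "('a, 'r) ring_scheme \<Rightarrow> 'a set \<Rightarrow> (nat \<Rightarrow> ('a, 'b, 'm) module_scheme) \<Rightarrow> (nat \<Rightarrow> 'b \<Rightarrow> 'b)
    \<Rightarrow> ('b \<times> 'a set \<Rightarrow>\<^sub>0 int) set set \<Rightarrow> ('b \<times> 'a set \<Rightarrow>\<^sub>0 int) set set" where
  "nu_1_2 R m F d = Tor_map R F d (quot_module R m) (\<lambda>C. m <+>\<^bsub>R\<^esub> C) 2"

end

theory Submission
  imports Defs
begin

text \<open>Let \<open>Z\<close> be the kernel of \<open>F\<^sub>1 \<rightarrow> F\<^sub>0\<close>. Since \<open>F\<^sub>i \<otimes> R/I = F\<^sub>i/IF\<^sub>i\<close>, the map on \<open>Tor\<^sub>2\<close>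
  vanishes iff \<open>Z \<inter> m\<^sup>2F\<^sub>1 \<subseteq> mZ\<close>. Comparing \<open>F\<close> with the beginning \<open>R\<^sup>d \<rightarrow> R\<close> of a resolution given
  by generators \<open>x\<close> of \<open>m\<close>, this says that every syzygy of \<open>x\<close> with entries in \<open>m\<^sup>2\<close> is in \<open>m\<close> times the
  syzygies. Lift \<open>x\<close> to a regular system of parameters \<open>y\<close> of \<open>Q\<close>. A syzygy of \<open>x\<close> with entries in
  \<open>m\<^sup>2\<close> lifts to \<open>q\<close> with \<open>\<Sum> q\<^sub>i y\<^sub>i \<in> a \<inter> n\<^sup>3\<close>, and \<open>\<Sum> q\<^sub>i y\<^sub>i\<close> lies in \<open>na\<close> iff \<open>q\<close> is in \<open>n\<close> times the
  syzygies modulo \<open>a\<close>, up to a syzygy of \<open>y\<close> in \<open>Q\<close> with entries in \<open>n\<^sup>2\<close>; the latter is in \<open>n\<close> times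
  the Koszul syzygies because \<open>y\<close> is a regular sequence. The passage between \<open>R\<close> and \<open>Q\<close> is made modulo
  each \<open>m\<^sup>k\<close>, using \<open>R/m\<^sup>k \<cong> Q/(a + n\<^sup>k)\<close>, and concluded by Krull's intersection theorem; no
  flatness of the completion is needed. That \<open>y\<close> is regular rests on Krull's principal ideal theorem,
  which is proved with symbolic powers; localisations are replaced by saturations of ideals.\<close>

section \<open>Ideals of Noetherian rings\<close>

text \<open>\<open>R\<close> and \<open>Q\<close> both map to the completion, but in general neither
  maps to the other. Hence the relations \<open>rel k\<close>, which compare elements modulo the
  \<open>k\<close>-th powers only: an exact equation in one ring becomes an approximate one in the
  other. An approximate syzygy, whose value is merely in a power of the maximal ideal, is made exact
  by expanding that value in the generators; this costs one degree, and the factor from the maximal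
  ideal in \<open>m\<close> times syzygies pays it back.

  For the same reason \<open>x\<close> is not prescribed: arbitrary parameters of \<open>Q\<close>
  have images in the completion that need not come from \<open>R\<close>. A change modulo
  \<open>n^2\<close> brings them there.

  The degrees fit together because \<open>a \<subseteq> n^2\<close>. An element of \<open>a\<close>
  has coefficients in \<open>n\<close>, so an element of \<open>n a\<close> has coefficients in
  \<open>n^2\<close>, as has an element of \<open>a \<inter> n^3\<close>; two such expansions of one
  element differ by a syzygy of \<open>y\<close> with entries in \<open>n^2\<close>.

  The modules of \<open>F\<close> may have infinite bases, so \<open>F\<close> is compared with the
  finite complex by lifting maps and not by matrices.\<close>

lemma (in cring) ideal_criterion:
  assumes "I \<subseteq> carrier R" "\<zero> \<in> I" "\<And>x y. x \<in> I \<Longrightarrow> y \<in> I \<Longrightarrow> x \<oplus> y \<in> I"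
    and mult: "\<And>x r. x \<in> I \<Longrightarrow> r \<in> carrier R \<Longrightarrow> r \<otimes> x \<in> I"
  shows "ideal I R"
proof (rule idealI)
  show "ring R" by (rule ring_axioms)
  show "subgroup I (add_monoid R)"
  proof (rule add.subgroupI)
    fix x assume x: "x \<in> I"
    have "(\<ominus> \<one>) \<otimes> x \<in> I" using mult[OF x] by simp
    then show "\<ominus> x \<in> I" using x assms(1) by (simp add: l_minus subset_iff)
  qed (use assms in auto)
  fix x r assume "x \<in> I" "r \<in> carrier R"
  then show "r \<otimes> x \<in> I" "x \<otimes> r \<in> I"
    using mult[of x r] assms(1) m_comm[of x r] by auto
qed

text \<open>Stated with \<open>ideal I R\<close> as a premise rather than in a locale, since several
  ideals of two rings occur in one argument.\<close>

lemma ideal_simps: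
  assumes "ideal I R"
  shows ideal_carrier: "x \<in> I \<Longrightarrow> x \<in> carrier R"
    and ideal_zero: "\<zero>\<^bsub>R\<^esub> \<in> I"
    and ideal_add: "x \<in> I \<Longrightarrow> y \<in> I \<Longrightarrow> x \<oplus>\<^bsub>R\<^esub> y \<in> I"
    and ideal_uminus: "x \<in> I \<Longrightarrow> \<ominus>\<^bsub>R\<^esub> x \<in> I"
    and ideal_minus: "x \<in> I \<Longrightarrow> y \<in> I \<Longrightarrow> x \<ominus>\<^bsub>R\<^esub> y \<in> I"
    and ideal_lmult: "x \<in> I \<Longrightarrow> r \<in> carrier R \<Longrightarrow> r \<otimes>\<^bsub>R\<^esub> x \<in> I"
    and ideal_rmult: "x \<in> I \<Longrightarrow> r \<in> carrier R \<Longrightarrow> x \<otimes>\<^bsub>R\<^esub> r \<in> I"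
proof -
  interpret ideal I R by fact
  show "x \<in> I \<Longrightarrow> x \<in> carrier R" "\<zero>\<^bsub>R\<^esub> \<in> I" "x \<in> I \<Longrightarrow> y \<in> I \<Longrightarrow> x \<oplus>\<^bsub>R\<^esub> y \<in> I"
    "x \<in> I \<Longrightarrow> r \<in> carrier R \<Longrightarrow> r \<otimes>\<^bsub>R\<^esub> x \<in> I" "x \<in> I \<Longrightarrow> r \<in> carrier R \<Longrightarrow> x \<otimes>\<^bsub>R\<^esub> r \<in> I"
    "x \<in> I \<Longrightarrow> \<ominus>\<^bsub>R\<^esub> x \<in> I" "x \<in> I \<Longrightarrow> y \<in> I \<Longrightarrow> x \<ominus>\<^bsub>R\<^esub> y \<in> I"
    by (auto simp: I_l_closed I_r_closed a_minus_def)
qed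

lemma primeideal_mult_iff:
  assumes "primeideal P R" "a \<in> carrier R" "b \<in> carrier R"
  shows "a \<otimes>\<^bsub>R\<^esub> b \<in> P \<longleftrightarrow> a \<in> P \<or> b \<in> P"
  using assms primeideal.I_prime ideal_lmult ideal_rmult primeideal.axioms(1) by metis

lemma primeideal_one_notin:
  assumes "primeideal P R" shows "\<one>\<^bsub>R\<^esub> \<notin> P"
  using assms primeideal.I_notcarr ideal.one_imp_carrier primeideal.axioms(1) by metis

text \<open>The ideal \<open>I + (x)\<close> in explicit form: membership yields a coefficient of
  \<open>x\<close>, which is what the Nakayama and chain arguments work with.\<close>

definition adjoin :: "('a, 'r) ring_scheme \<Rightarrow> 'a set \<Rightarrow> 'a \<Rightarrow> 'a set" where
  "adjoin R I x = {i \<oplus>\<^bsub>R\<^esub> c \<otimes>\<^bsub>R\<^esub> x | i c. i \<in> I \<and> c \<in> carrier R}"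

context cring
begin

lemma adjoin_ideal:
  assumes I: "ideal I R" and x: "x \<in> carrier R"
  shows "ideal (adjoin R I x) R"
proof (rule ideal_criterion)
  note [simp] = ideal_carrier[OF I] ideal_zero[OF I] ideal_add[OF I] ideal_lmult[OF I]
  show "adjoin R I x \<subseteq> carrier R" using x by (auto simp: adjoin_def)
  have "\<zero> = \<zero> \<oplus> \<zero> \<otimes> x" using x by simp
  then show "\<zero> \<in> adjoin R I x" unfolding adjoin_def
    using ideal_zero[OF I] zero_closed by blast
next
  fix u v assume "u \<in> adjoin R I x" "v \<in> adjoin R I x"
  then obtain i c j d where *: "i \<in> I" "c \<in> carrier R" "u = i \<oplus> c \<otimes> x"
    "j \<in> I" "d \<in> carrier R" "v = j \<oplus> d \<otimes> x" by (auto simp: adjoin_def)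
  then have "u \<oplus> v = (i \<oplus> j) \<oplus> (c \<oplus> d) \<otimes> x"
    using x ideal_carrier[OF I] by algebra
  then show "u \<oplus> v \<in> adjoin R I x"
    using * ideal_add[OF I] unfolding adjoin_def by blast
next
  fix u r assume "u \<in> adjoin R I x" and r: "r \<in> carrier R"
  then obtain i c where *: "i \<in> I" "c \<in> carrier R" "u = i \<oplus> c \<otimes> x" by (auto simp: adjoin_def)
  then have "r \<otimes> u = r \<otimes> i \<oplus> (r \<otimes> c) \<otimes> x"
    using x r ideal_carrier[OF I] by algebra
  then show "r \<otimes> u \<in> adjoin R I x"
    using * r ideal_lmult[OF I] unfolding adjoin_def by blast
qed

lemma subset_adjoin:
  assumes I: "ideal I R" and x: "x \<in> carrier R"
  shows "I \<subseteq> adjoin R I x"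
proof
  fix i assume i: "i \<in> I"
  then have "i = i \<oplus> \<zero> \<otimes> x" using ideal_carrier[OF I] x by simp
  then show "i \<in> adjoin R I x" using i zero_closed unfolding adjoin_def by blast
qed

lemma mem_adjoin:
  assumes I: "ideal I R" and x: "x \<in> carrier R"
  shows "x \<in> adjoin R I x"
proof -
  have "x = \<zero> \<oplus> \<one> \<otimes> x" using x by simp
  then show ?thesis using ideal_zero[OF I] unfolding adjoin_def by blast
qed

lemma adjoin_minimal:
  assumes "ideal J R" "I \<subseteq> J" "x \<in> J"
  shows "adjoin R I x \<subseteq> J"
  using assms ideal_add ideal_lmult unfolding adjoin_def by (fastforce simp: subset_iff)

lemma mem_set_add: "x \<in> I <+> J \<longleftrightarrow> (\<exists>i\<in>I. \<exists>j\<in>J. x = i \<oplus> j)"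
  by (auto simp: set_add_def')

lemma set_add_left:
  assumes "ideal I R" "ideal J R" shows "I \<subseteq> I <+> J"
proof
  fix x assume x: "x \<in> I"
  then have "x = x \<oplus> \<zero>" using ideal_carrier[OF assms(1)] by simp
  then show "x \<in> I <+> J" using x ideal_zero[OF assms(2)] by (auto simp: mem_set_add)
qed

lemma set_add_right:
  assumes "ideal I R" "ideal J R" shows "J \<subseteq> I <+> J"
proof
  fix x assume x: "x \<in> J"
  then have "x = \<zero> \<oplus> x" using ideal_carrier[OF assms(2)] by simp
  then show "x \<in> I <+> J" using x ideal_zero[OF assms(1)] by (auto simp: mem_set_add)
qed

text \<open>The contraction of the localisation at \<open>P\<close> of \<open>I\<close>.\<close>

definition sat :: "'a set \<Rightarrow> 'a set \<Rightarrow> 'a set" where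
  "sat P I = {r \<in> carrier R. \<exists>s\<in>carrier R. s \<notin> P \<and> s \<otimes> r \<in> I}"

text \<open>For a prime \<open>P\<close> these are the contractions of ideals of the localisation at
  \<open>P\<close>; chains of ideals there are studied as chains of such ideals of
  \<open>R\<close>.\<close>

definition saturated :: "'a set \<Rightarrow> 'a set \<Rightarrow> bool" where
  "saturated P I \<longleftrightarrow> ideal I R \<and> (\<forall>s\<in>carrier R. \<forall>r\<in>carrier R. s \<notin> P \<longrightarrow> s \<otimes> r \<in> I \<longrightarrow> r \<in> I)"

lemma sat_mono: "I \<subseteq> J \<Longrightarrow> sat P I \<subseteq> sat P J"
  by (auto simp: sat_def)

lemma subset_sat:
  assumes "primeideal P R" "ideal I R" shows "I \<subseteq> sat P I"
proof
  fix x assume x: "x \<in> I"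
  then have "\<one> \<otimes> x \<in> I" using ideal_carrier[OF assms(2)] by simp
  then show "x \<in> sat P I"
    using x ideal_carrier[OF assms(2)] primeideal_one_notin[OF assms(1)] by (auto simp: sat_def)
qed

lemma sat_ideal:
  assumes P: "primeideal P R" and I: "ideal I R"
  shows "ideal (sat P I) R"
proof (rule ideal_criterion)
  show "sat P I \<subseteq> carrier R" by (auto simp: sat_def)
  show "\<zero> \<in> sat P I" using subset_sat[OF P I] ideal_zero[OF I] by auto
next
  fix x y assume "x \<in> sat P I" "y \<in> sat P I"
  then obtain s t where *: "x \<in> carrier R" "y \<in> carrier R" "s \<in> carrier R" "s \<notin> P" "t \<in> carrier R" "t \<notin> P"
     "s \<otimes> x \<in> I" "t \<otimes> y \<in> I" by (auto simp: sat_def)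
  then have "(s \<otimes> t) \<otimes> (x \<oplus> y) = t \<otimes> (s \<otimes> x) \<oplus> s \<otimes> (t \<otimes> y)" by algebra
  then have "(s \<otimes> t) \<otimes> (x \<oplus> y) \<in> I" using * ideal_add[OF I] ideal_lmult[OF I] by simp
  moreover have "s \<otimes> t \<in> carrier R" "s \<otimes> t \<notin> P" using * primeideal_mult_iff[OF P] by auto
  ultimately show "x \<oplus> y \<in> sat P I" using * by (auto simp: sat_def)
next
  fix x r assume "x \<in> sat P I" and r: "r \<in> carrier R"
  then obtain s where *: "x \<in> carrier R" "s \<in> carrier R" "s \<notin> P" "s \<otimes> x \<in> I" by (auto simp: sat_def)
  then have "s \<otimes> (r \<otimes> x) = r \<otimes> (s \<otimes> x)" using r by algebra
  then have "s \<otimes> (r \<otimes> x) \<in> I" using * r ideal_lmult[OF I] by simp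
  then show "r \<otimes> x \<in> sat P I" using * r by (auto simp: sat_def)
qed

lemma saturated_sat:
  assumes P: "primeideal P R" and I: "ideal I R"
  shows "saturated P (sat P I)"
  unfolding saturated_def
proof (intro conjI ballI impI sat_ideal[OF P I])
  fix s r assume "s \<in> carrier R" "s \<notin> P" "r \<in> carrier R" "s \<otimes> r \<in> sat P I"
  then obtain t where *: "s \<in> carrier R" "s \<notin> P" "r \<in> carrier R" "t \<in> carrier R" "t \<notin> P" "t \<otimes> (s \<otimes> r) \<in> I"
    by (auto simp: sat_def)
  then have "(t \<otimes> s) \<otimes> r \<in> I" by (simp add: m_assoc)
  moreover have "t \<otimes> s \<in> carrier R" "t \<otimes> s \<notin> P" using * primeideal_mult_iff[OF P] by auto
  ultimately show "r \<in> sat P I" using * by (auto simp: sat_def)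
qed

lemma sat_saturated:
  assumes "saturated P I" "J \<subseteq> I" shows "sat P J \<subseteq> I"
  using assms by (auto simp: sat_def saturated_def)

lemma saturated_prime:
  assumes "primeideal q R" "q \<subseteq> P" shows "saturated P q"
  using assms primeideal_mult_iff[OF assms(1)] primeideal.axioms(1)[OF assms(1)]
  by (auto simp: saturated_def)

end

section \<open>Noetherian induction and Nakayama's lemma at a prime\<close>

locale noetherian_cring = cring R + noetherian_ring R for R (structure)

context noetherian_cring
begin

text \<open>A nonempty chain of ideals of a Noetherian ring contains its own union, so Zorn's lemma
  applies to any nonempty family of ideals, without closure conditions.\<close>

lemma maximal_ideal_in_family:
  assumes "I0 \<in> S" "\<And>I. I \<in> S \<Longrightarrow> ideal I R"
  obtains M where "M \<in> S" "\<And>I. I \<in> S \<Longrightarrow> M \<subseteq> I \<Longrightarrow> I = M"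
proof -
  have "\<exists>M\<in>S. \<forall>I\<in>S. M \<subseteq> I \<longrightarrow> I = M"
  proof (rule subset_Zorn)
    fix C assume C: "subset.chain S C"
    show "\<exists>U\<in>S. \<forall>I\<in>C. I \<subseteq> U"
    proof (cases "C = {}")
      case False
      have "subset.chain {I. ideal I R} C"
        using C assms(2) by (auto simp: subset_chain_def)
      then have "\<Union>C \<in> C" using ideal_chain_is_trivial[OF False] by blast
      then show ?thesis using C by (auto simp: subset_chain_def)
    qed (use assms(1) in auto)
  qed
  then show ?thesis using that by blast
qed

text \<open>The hypothesis concerns strictly larger ideals: a maximal ideal among those without
  \<open>Q\<close> would satisfy it.\<close>

lemma noetherian_ideal_induct [consumes 1, case_names step]:
  assumes "ideal I R"
    and step: "\<And>I. ideal I R \<Longrightarrow> (\<And>J. ideal J R \<Longrightarrow> I \<subset> J \<Longrightarrow> Q J) \<Longrightarrow> Q I"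
  shows "Q I"
proof (rule ccontr)
  assume "\<not> Q I"
  then obtain M where "M \<in> {J. ideal J R \<and> \<not> Q J}"
      "\<And>I. I \<in> {J. ideal J R \<and> \<not> Q J} \<Longrightarrow> M \<subseteq> I \<Longrightarrow> I = M"
    using maximal_ideal_in_family[of I "{J. ideal J R \<and> \<not> Q J}"] assms(1) by blast
  then show False using step[of M] by blast
qed

text \<open>Nakayama's lemma for the localisation at \<open>P\<close>. A maximal \<open>L\<close> violating the claim would
  have \<open>M \<subseteq> sat P (adjoin R L a)\<close> for all \<open>a \<in> M - sat P L\<close>, so that \<open>P\<close> kills
  \<open>M\<close> modulo \<open>L\<close> up to multiples of \<open>a\<close> with coefficients in \<open>P\<close>.\<close>

lemma nakayama_sat:
  assumes P: "primeideal P R" and M: "ideal M R" and N: "ideal N R"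
    and sub: "M \<subseteq> sat P (N <+> ideal_prod R P M)"
  shows "M \<subseteq> sat P N"
proof -
  have idP: "ideal P R" using P by (rule primeideal.axioms)
  \<comment> \<open>Noetherian induction on \<open>L\<close> takes the place of an induction on
    generators of \<open>M\<close>; the claim is the case \<open>L = N\<close>.\<close>
  have "N \<subseteq> L \<longrightarrow> M \<subseteq> sat P L" if "ideal L R" for L
    using that
  proof (induction L rule: noetherian_ideal_induct)
    case (step L)
    show ?case
    proof (intro impI subsetI, rule ccontr)
      fix a assume NL: "N \<subseteq> L" and a: "a \<in> M" "a \<notin> sat P L"
      have aR: "a \<in> carrier R" using a M ideal_carrier by metis
      have L: "ideal L R" by fact
      have "a \<notin> L" using a subset_sat[OF P L] by auto
      then have "L \<subset> adjoin R L a" using subset_adjoin[OF L aR] mem_adjoin[OF L aR] by blast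
      then have MA: "M \<subseteq> sat P (adjoin R L a)"
        using step.IH[of "adjoin R L a"] adjoin_ideal[OF L aR] NL by auto
      \<comment> \<open>Up to a factor outside \<open>P\<close>, an element of \<open>M\<close> has
        the form \<open>l + c a\<close>. Hence an element of \<open>P M\<close> has the form
        \<open>l + p a\<close> with \<open>p\<close> in \<open>P\<close>.\<close>
      have key: "u \<in> carrier R \<and> (\<exists>s\<in>carrier R. s \<notin> P \<and> (\<exists>l\<in>L. \<exists>p\<in>P. s \<otimes> u = l \<oplus> p \<otimes> a))"
        if "u \<in> ideal_prod R P M" for u
        using that
      proof (induction rule: ideal_prod.induct)
        case (prod p m)
        then obtain s where s: "m \<in> carrier R" "s \<in> carrier R" "s \<notin> P" "s \<otimes> m \<in> adjoin R L a"
          using MA by (auto simp: sat_def)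
        then obtain l c where lc: "l \<in> L" "c \<in> carrier R" "s \<otimes> m = l \<oplus> c \<otimes> a"
          by (auto simp: adjoin_def)
        have pl: "p \<in> carrier R" "l \<in> carrier R" using prod lc ideal_carrier idP L by metis+
        have "s \<otimes> (p \<otimes> m) = p \<otimes> (s \<otimes> m)" using pl s by algebra
        also have "\<dots> = p \<otimes> l \<oplus> (p \<otimes> c) \<otimes> a" using pl s lc aR by (simp add: r_distr m_assoc)
        finally show ?case
          using pl s lc prod ideal_lmult[OF L] ideal_rmult[OF idP] by blast
      next
        case (sum u v)
        then obtain s l p t k r where *: "s \<in> carrier R" "s \<notin> P" "l\<in>L" "p\<in>P" "s \<otimes> u = l \<oplus> p \<otimes> a"
           "t \<in> carrier R" "t \<notin> P" "k\<in>L" "r\<in>P" "t \<otimes> v = k \<oplus> r \<otimes> a" by blast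
        have uv: "u \<in> carrier R" "v \<in> carrier R" using sum by auto
        have c: "l \<in> carrier R" "k \<in> carrier R" "p \<in> carrier R" "r \<in> carrier R"
          using * ideal_carrier idP L by metis+
        have "(s \<otimes> t) \<otimes> (u \<oplus> v) = t \<otimes> (s \<otimes> u) \<oplus> s \<otimes> (t \<otimes> v)"
          using uv *(1,6) by algebra
        also have "\<dots> = (t \<otimes> l \<oplus> s \<otimes> k) \<oplus> (t \<otimes> p \<oplus> s \<otimes> r) \<otimes> a"
          unfolding * using c aR *(1,6) by algebra
        finally have "(s \<otimes> t) \<otimes> (u \<oplus> v) = (t \<otimes> l \<oplus> s \<otimes> k) \<oplus> (t \<otimes> p \<oplus> s \<otimes> r) \<otimes> a" .
        moreover have "s \<otimes> t \<in> carrier R" "s \<otimes> t \<notin> P" using * primeideal_mult_iff[OF P] by auto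
        moreover have "t \<otimes> l \<oplus> s \<otimes> k \<in> L" "t \<otimes> p \<oplus> s \<otimes> r \<in> P"
          using * by (auto intro!: ideal_add[OF L] ideal_lmult[OF L] ideal_add[OF idP] ideal_lmult[OF idP])
        ultimately show ?case using sum by blast
      qed
      obtain s n u where s: "s \<in> carrier R" "s \<notin> P" "n \<in> N" "u \<in> ideal_prod R P M" "s \<otimes> a = n \<oplus> u"
        using sub a by (auto simp: sat_def mem_set_add)
      obtain t l p where t: "t \<in> carrier R" "t \<notin> P" "l\<in>L" "p\<in>P" "t \<otimes> u = l \<oplus> p \<otimes> a" and u: "u \<in> carrier R"
        using key[OF s(4)] by blast
      have c: "l \<in> carrier R" "p \<in> carrier R" "n \<in> carrier R"
        using t s ideal_carrier idP L N by metis+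
      \<comment> \<open>The multiplier \<open>t s - p\<close> lies outside \<open>P\<close>, because
        \<open>p\<close> is in \<open>P\<close> and \<open>t s\<close> is not. It is the analogue of
        the unit \<open>1 - p\<close> in Nakayama's lemma.\<close>
      have "(t \<otimes> s \<ominus> p) \<otimes> a = t \<otimes> (s \<otimes> a) \<ominus> p \<otimes> a" using c s(1) t(1) aR by algebra
      also have "\<dots> = t \<otimes> n \<oplus> t \<otimes> u \<ominus> p \<otimes> a" unfolding s using c s(1) t(1) u by algebra
      also have "\<dots> = t \<otimes> n \<oplus> l" unfolding t using c s(1) t(1) u aR by algebra
      finally have "(t \<otimes> s \<ominus> p) \<otimes> a \<in> L"
        using t s NL by (auto intro!: ideal_add[OF L] ideal_lmult[OF L])
      moreover have "t \<otimes> s \<ominus> p \<notin> P"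
      proof
        assume "t \<otimes> s \<ominus> p \<in> P"
        then have "(t \<otimes> s \<ominus> p) \<oplus> p \<in> P" using t ideal_add[OF idP] by blast
        moreover have "(t \<otimes> s \<ominus> p) \<oplus> p = t \<otimes> s" using t s c by algebra
        ultimately show False using t s primeideal_mult_iff[OF P] by auto
      qed
      ultimately have "a \<in> sat P L" using aR c t s by (auto simp: sat_def)
      then show False using a by simp
    qed
  qed
  then show ?thesis using N by blast
qed

end

section \<open>Krull's principal ideal theorem\<close>

lemma ideal_pow_0: "ideal_pow R I 0 = carrier R"
  by (simp add: ideal_pow_def nat_pow_def ideals_set_def)

lemma ideal_pow_Suc: "ideal_pow R I (Suc k) = ideal_prod R (ideal_pow R I k) I"
  by (simp add: ideal_pow_def nat_pow_def ideals_set_def)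

context cring
begin

lemma ideal_pow_ideal:
  assumes "ideal I R" shows "ideal (ideal_pow R I k) R"
  using assms by (induction k) (auto simp: ideal_pow_0 ideal_pow_Suc oneideal ideal_prod_is_ideal)

lemma ideal_pow_Suc': 
  assumes "ideal I R" shows "ideal_pow R I (Suc k) = ideal_prod R I (ideal_pow R I k)"
  using assms ideal_prod_commute[OF assms ideal_pow_ideal[OF assms]] by (simp add: ideal_pow_Suc)

lemma ideal_pow_Suc_subset:
  assumes "ideal I R" shows "ideal_pow R I (Suc k) \<subseteq> ideal_pow R I k"
  using ideal_prod_inter[OF ideal_pow_ideal[OF assms] assms] by (auto simp: ideal_pow_Suc)

lemma ideal_pow_antimono:
  assumes "ideal I R" "j \<le> k" shows "ideal_pow R I k \<subseteq> ideal_pow R I j"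
  using assms(2) by (induction k rule: dec_induct) (use ideal_pow_Suc_subset[OF assms(1)] in auto)

lemma ideal_pow_1: "ideal I R \<Longrightarrow> ideal_pow R I (Suc 0) = I"
  by (simp add: ideal_pow_Suc' ideal_pow_0 ideal_prod_one)

lemma pow_in_ideal_pow:
  assumes "ideal I R" "r \<in> I" shows "r [^] k \<in> ideal_pow R I k"
  using assms by (induction k) (auto simp: ideal_pow_0 ideal_pow_Suc intro: ideal_prod.prod)

lemma primeideal_pow:
  assumes "primeideal P R" "r \<in> carrier R" "r [^] (k::nat) \<in> P" shows "r \<in> P"
  using assms(3)
proof (induction k)
  case 0 then show ?case using primeideal_one_notin[OF assms(1)] by simp
next
  case (Suc k) then show ?case using primeideal_mult_iff[OF assms(1)] assms(2) by auto
qed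

lemma colon_ideal:
  assumes "ideal I R" "z \<in> carrier R"
  shows "ideal {c \<in> carrier R. c \<otimes> z \<in> I} R"
proof (rule ideal_criterion)
  show "\<And>c r. c \<in> {c \<in> carrier R. c \<otimes> z \<in> I} \<Longrightarrow> r \<in> carrier R \<Longrightarrow> r \<otimes> c \<in> {c \<in> carrier R. c \<otimes> z \<in> I}"
    using assms ideal_lmult[OF assms(1)] by (simp add: m_assoc)
qed (use assms ideal_zero[OF assms(1)] ideal_add[OF assms(1)] in \<open>auto simp: l_distr\<close>)

end

section \<open>Existence of primes, chains of ideals over a nilpotent prime, and the principal ideal
  theorem\<close>

context noetherian_cring
begin

text \<open>An ideal \<open>I\<close> maximal among those disjoint from \<open>T\<close> is prime:
  if \<open>a\<close> and \<open>b\<close> lie outside it, both enlarged ideals meet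
  \<open>T\<close>, and the product of the two elements found there would lie in \<open>I\<close> as
  soon as \<open>a b\<close> does.\<close>

lemma prime_maximal_avoiding:
  assumes I0: "ideal I0 R" and T: "T \<subseteq> carrier R" "\<one> \<in> T" "\<And>s t. s \<in> T \<Longrightarrow> t \<in> T \<Longrightarrow> s \<otimes> t \<in> T"
    and disj: "I0 \<inter> T = {}"
  obtains I where "primeideal I R" "I0 \<subseteq> I" "I \<inter> T = {}"
proof -
  let ?S = "{I. ideal I R \<and> I0 \<subseteq> I \<and> I \<inter> T = {}}"
  obtain I where "I \<in> ?S" and max: "\<And>J. J \<in> ?S \<Longrightarrow> I \<subseteq> J \<Longrightarrow> J = I"
    using maximal_ideal_in_family[of I0 ?S] I0 disj by blast
  then have I: "ideal I R" "I0 \<subseteq> I" "I \<inter> T = {}" by auto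
  have "primeideal I R"
  proof (rule primeidealI[OF I(1) is_cring])
    show "carrier R \<noteq> I" using I T by blast
    fix a b assume ab: "a \<in> carrier R" "b \<in> carrier R" "a \<otimes> b \<in> I"
    show "a \<in> I \<or> b \<in> I"
    proof (rule ccontr)
      assume no: "\<not> (a \<in> I \<or> b \<in> I)"
      have meets: "\<exists>i c. i \<in> I \<and> c \<in> carrier R \<and> i \<oplus> c \<otimes> e \<in> T" if e: "e \<in> carrier R" "e \<notin> I" for e
      proof -
        have "adjoin R I e \<noteq> I" using mem_adjoin[OF I(1) e(1)] e by auto
        then have "adjoin R I e \<notin> ?S" using max subset_adjoin[OF I(1) e(1)] by metis
        then have "adjoin R I e \<inter> T \<noteq> {}"
          using subset_adjoin[OF I(1) e(1)] adjoin_ideal[OF I(1) e(1)] I(2) by blast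
        then show ?thesis unfolding adjoin_def by blast
      qed
      obtain i c where ic: "i \<in> I" "c \<in> carrier R" "i \<oplus> c \<otimes> a \<in> T" using meets ab no by blast
      obtain j d where jd: "j \<in> I" "d \<in> carrier R" "j \<oplus> d \<otimes> b \<in> T" using meets ab no by blast
      have ij: "i \<in> carrier R" "j \<in> carrier R" using ic jd ideal_carrier[OF I(1)] by auto
      have "(i \<oplus> c \<otimes> a) \<otimes> (j \<oplus> d \<otimes> b) = (j \<oplus> d \<otimes> b) \<otimes> i \<oplus> ((c \<otimes> a) \<otimes> j \<oplus> (c \<otimes> d) \<otimes> (a \<otimes> b))"
        using ij ic(2) jd(2) ab(1,2) by algebra
      also have "\<dots> \<in> I"
      proof (intro ideal_add[OF I(1)])
        show "(j \<oplus> d \<otimes> b) \<otimes> i \<in> I" "(c \<otimes> a) \<otimes> j \<in> I"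
          by (rule ideal_lmult[OF I(1)]; use ic jd ij ab in simp)+
        show "(c \<otimes> d) \<otimes> (a \<otimes> b) \<in> I"
          using ic jd by (intro ideal_lmult[OF I(1) ab(3)]) simp
      qed
      finally show False using T(3)[OF ic(3) jd(3)] I by auto
    qed
  qed
  then show ?thesis using I that by blast
qed

text \<open>Take \<open>z\<close> outside \<open>L\<close> with \<open>(L : z)\<close> maximal. If
  \<open>r^k\<close> is the least power with \<open>r^k z\<close> in \<open>L\<close>, then
  \<open>r^(k-1) z\<close> has a colon ideal that contains \<open>(L : z)\<close>, hence equals it,
  and that contains \<open>r\<close>.\<close>

lemma socle_element:
  assumes P: "primeideal P R" and L: "ideal L R" "L \<noteq> carrier R"
    and pow: "\<And>r. r \<in> P \<Longrightarrow> \<exists>k::nat. r [^] k \<in> L"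
  obtains z where "z \<in> carrier R" "z \<notin> L" "\<And>r. r \<in> P \<Longrightarrow> r \<otimes> z \<in> L"
proof -
  let ?col = "\<lambda>z. {c \<in> carrier R. c \<otimes> z \<in> L}"
  let ?S = "?col ` (carrier R - L)"
  have "\<one> \<notin> L" using L ideal.one_imp_carrier by blast
  then obtain M where M: "M \<in> ?S" "\<And>I. I \<in> ?S \<Longrightarrow> M \<subseteq> I \<Longrightarrow> I = M"
    using maximal_ideal_in_family[of "?col \<one>" ?S] colon_ideal[OF L(1)] by blast
  then obtain z where z: "z \<in> carrier R" "z \<notin> L" "M = ?col z" by blast
  have "r \<otimes> z \<in> L" if r: "r \<in> P" for r
  proof -
    have rR: "r \<in> carrier R" using r ideal_carrier P primeideal.axioms(1) by metis
    obtain k0 :: nat where "r [^] k0 \<in> L" using pow[OF r] by blast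
    then have "r [^] k0 \<otimes> z \<in> L" using z ideal_rmult[OF L(1)] by blast
    then obtain k where k: "r [^] (k::nat) \<otimes> z \<in> L" "\<And>j. j < k \<Longrightarrow> r [^] j \<otimes> z \<notin> L"
      using exists_least_iff[of "\<lambda>k. r [^] (k::nat) \<otimes> z \<in> L"] by blast
    have "k \<noteq> 0" using k(1) z by (metis l_one nat_pow_0)
    then obtain j where j: "k = Suc j" using not0_implies_Suc by blast
    let ?z = "r [^] j \<otimes> z"
    have z': "?z \<in> carrier R" "?z \<notin> L" using k j rR z by auto
    have "M \<subseteq> ?col ?z"
    proof
      fix c assume "c \<in> M"
      then have c: "c \<in> carrier R" "c \<otimes> z \<in> L" using z by auto
      have "c \<otimes> ?z = r [^] j \<otimes> (c \<otimes> z)" using c z rR by (simp add: m_lcomm)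
      then show "c \<in> ?col ?z" using c rR ideal_lmult[OF L(1)] by simp
    qed
    then have "?col ?z = M" using M(2)[of "?col ?z"] z' by blast
    moreover have "r \<in> ?col ?z" using k(1) j rR z by (simp add: m_ac)
    ultimately show ?thesis using z by auto
  qed
  then show ?thesis using that z by blast
qed

text \<open>The localisation of \<open>R\<close> at \<open>P\<close> modulo \<open>K\<close> is Artinian if \<open>P\<close> is nilpotent modulo \<open>K\<close>.\<close>

lemma saturated_dcc:
  assumes P: "primeideal P R" and K: "saturated P K"
    and pow: "\<And>r. r \<in> P \<Longrightarrow> \<exists>k::nat. r [^] k \<in> K"
    and J: "\<And>k::nat. saturated P (J k)" "\<And>k. K \<subseteq> J k" "\<And>k. J (Suc k) \<subseteq> J k"
  shows "\<exists>N. \<forall>k\<ge>N. J k = J N"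
proof -
  have idP: "ideal P R" using P by (rule primeideal.axioms)
  have "saturated P K \<longrightarrow> (\<forall>r\<in>P. \<exists>k::nat. r [^] k \<in> K) \<longrightarrow>
     (\<forall>J. (\<forall>k::nat. saturated P (J k) \<and> K \<subseteq> J k \<and> J (Suc k) \<subseteq> J k) \<longrightarrow> (\<exists>N. \<forall>k\<ge>N. J k = J N))"
    if "ideal K R" for K
    using that
  proof (induction K rule: noetherian_ideal_induct)
    case (step K)
    show ?case
    proof (intro impI allI)
      fix J assume K: "saturated P K" and pow: "\<forall>r\<in>P. \<exists>k::nat. r [^] k \<in> K"
        and "\<forall>k::nat. saturated P (J k) \<and> K \<subseteq> J k \<and> J (Suc k) \<subseteq> J k"
      then have Js: "\<And>k. saturated P (J k)" and KJ: "\<And>k. K \<subseteq> J k" and dec: "\<And>k. J (Suc k) \<subseteq> J k"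
        by auto
      have Jid: "ideal (J k) R" for k using Js by (simp add: saturated_def)
      have anti: "J k \<subseteq> J j" if "j \<le> k" for j k
        using that by (induction k rule: dec_induct) (use dec in auto)
      \<comment> \<open>If the intersection exceeds \<open>K\<close>, the induction hypothesis
        applies to it in place of \<open>K\<close>. The essential case is that it equals
        \<open>K\<close>.\<close>
      consider "K \<subset> (\<Inter>k. J k)" | "K = carrier R" | "(\<Inter>k. J k) = K" "K \<noteq> carrier R"
        using KJ by blast
      then show "\<exists>N. \<forall>k\<ge>N. J k = J N"
      proof cases
        case 1
        have D: "saturated P (\<Inter>k. J k)"
          unfolding saturated_def
        proof (intro conjI ballI impI INT_I)
          show "ideal (\<Inter>k. J k) R" by (rule i_Intersect) (use Jid in auto)
        next
          fix s r k assume "s \<in> carrier R" "r \<in> carrier R" "s \<notin> P" "s \<otimes> r \<in> (\<Inter>k. J k)"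
          then show "r \<in> J k" using Js[of k] unfolding saturated_def by blast
        qed
        have "\<forall>r\<in>P. \<exists>k::nat. r [^] k \<in> (\<Inter>k. J k)" using 1 pow by (meson psubsetD)
        moreover have "\<forall>k. saturated P (J k) \<and> (\<Inter>k. J k) \<subseteq> J k \<and> J (Suc k) \<subseteq> J k"
          using Js dec by auto
        moreover have "ideal (\<Inter>k. J k) R" using D by (simp add: saturated_def)
        ultimately show ?thesis using step.IH[OF _ 1] D by meson
      next
        case 2
        then have "J k = carrier R" for k using KJ[of k] ideal_carrier[OF Jid] by auto
        then show ?thesis by simp
      next
        case 3
        obtain z where z: "z \<in> carrier R" "z \<notin> K" "\<And>r. r \<in> P \<Longrightarrow> r \<otimes> z \<in> K"
          using socle_element[OF P step.hyps 3(2)] pow by blast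
        \<comment> \<open>Adjoining the socle element \<open>z\<close> enlarges \<open>K\<close>, so
          by induction the chain with \<open>z\<close> adjoined becomes stationary. It remains to
          remove \<open>z\<close> again.\<close>
        let ?K = "sat P (adjoin R K z)" and ?J = "\<lambda>k. sat P (adjoin R (J k) z)"
        have adK: "ideal (adjoin R K z) R" and adJ: "ideal (adjoin R (J k) z) R" for k
          using adjoin_ideal z Jid step.hyps by auto
        have "K \<subset> ?K"
          using subset_sat[OF P adK] subset_adjoin[OF step.hyps z(1)] mem_adjoin[OF step.hyps z(1)] z by blast
        have sK: "saturated P ?K" by (rule saturated_sat[OF P adK])
        have sJ: "saturated P (?J k) \<and> ?K \<subseteq> ?J k \<and> ?J (Suc k) \<subseteq> ?J k" for k
          using KJ[of k] dec[of k]
          by (intro conjI saturated_sat[OF P adJ] sat_mono) (auto simp: adjoin_def)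
        have "\<exists>N. \<forall>k\<ge>N. ?J k = ?J N"
        proof -
          have "\<forall>r\<in>P. \<exists>k::nat. r [^] k \<in> ?K" using pow \<open>K \<subset> ?K\<close> by (meson psubsetD)
          then show ?thesis
            using step.IH[OF sat_ideal[OF P adK] \<open>K \<subset> ?K\<close>] sK sJ by (elim impE allE[of _ ?J]) auto
        qed
        then obtain N1 where N1: "\<And>k. k \<ge> N1 \<Longrightarrow> ?J k = ?J N1" by blast
        obtain N2 where N2: "z \<notin> J N2" using z(2) 3 by auto
        let ?N = "max N1 N2"
        have "J k = J ?N" if k: "k \<ge> ?N" for k
        proof
          show "J k \<subseteq> J ?N" using anti k by blast
          show "J ?N \<subseteq> J k"
          proof
            fix w assume w: "w \<in> J ?N"
            have wR: "w \<in> carrier R" using w ideal_carrier[OF Jid] by blast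
            have "?J ?N = ?J k" using N1[of k] N1[of ?N] k by simp
            moreover have "w \<in> ?J ?N"
              using w subset_sat[OF P adJ] subset_adjoin[OF Jid z(1)] by blast
            ultimately obtain s j c where s: "s \<in> carrier R" "s \<notin> P" and jc: "j \<in> J k" "c \<in> carrier R"
              and sw: "s \<otimes> w = j \<oplus> c \<otimes> z"
              by (auto simp: sat_def adjoin_def)
            have jN: "j \<in> J ?N" "j \<in> carrier R" using jc anti[OF k] ideal_carrier[OF Jid] by auto
            \<comment> \<open>If \<open>c\<close> lies in \<open>P\<close>, then \<open>c z\<close>
              is in \<open>K\<close>. Otherwise \<open>c\<close> is invertible at \<open>P\<close>
              and \<open>z\<close> would lie in \<open>J ?N\<close>, against the choice of
              \<open>N2\<close>.\<close>
            have "s \<otimes> w \<in> J k"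
            proof (cases "c \<in> P")
              case True
              then have "c \<otimes> z \<in> J k" using z(3) KJ by blast
              then show ?thesis using sw jc ideal_add[OF Jid] by simp
            next
              case False
              have "c \<otimes> z = s \<otimes> w \<ominus> j" unfolding sw using jc jN z by algebra
              then have "c \<otimes> z \<in> J ?N" using w s jN ideal_minus[OF Jid] ideal_lmult[OF Jid] by simp
              then have "z \<in> J ?N" using Js[of ?N] False jc z unfolding saturated_def by blast
              then have "z \<in> J N2" using anti[of N2 ?N] by auto
              then show ?thesis using N2 by simp
            qed
            then show "w \<in> J k" using Js[of k] s wR unfolding saturated_def by blast
          qed
        qed
        then show ?thesis by blast
      qed
    qed
  qed
  note * = this[of K, rule_format]
  have "ideal K R" using K by (simp add: saturated_def)
  from *[OF this K pow] J show ?thesis by simp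
qed

text \<open>Otherwise \<open>P\<close> would be minimal over \<open>q0 + (x)\<close>; then the symbolic powers of \<open>q\<close> stabilise
  modulo \<open>x\<close>, hence by Nakayama they stabilise, and \<open>q = q0\<close> follows by Nakayama at \<open>q\<close>.\<close>

theorem principal_ideal_theorem:
  assumes q0: "primeideal q0 R" and q: "primeideal q R" and P: "primeideal P R"
    and lt: "q0 \<subset> q" "q \<subset> P" and x: "x \<in> P" "x \<notin> q"
  shows "\<exists>q'. primeideal q' R \<and> q0 \<subset> q' \<and> q' \<subset> P \<and> x \<in> q'"
proof (rule ccontr)
  assume none: "\<not> ?thesis"
  have id: "ideal q0 R" "ideal q R" "ideal P R" using q0 q P by (auto intro: primeideal.axioms)
  have xR: "x \<in> carrier R" using x ideal_carrier[OF id(3)] by blast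
  let ?Q0 = "adjoin R q0 x"
  have adq0: "ideal ?Q0 R" using adjoin_ideal id xR by blast
  \<comment> \<open>A prime that contains \<open>q0 + (x)\<close> and avoids all
    \<open>s r^k\<close> with \<open>s\<close> outside \<open>P\<close> lies in \<open>P\<close> and
    misses \<open>r\<close>; it would be one of the excluded primes between \<open>q0\<close> and
    \<open>P\<close>.\<close>
  have nil: "\<exists>k::nat. r [^] k \<in> sat P ?Q0" if r: "r \<in> P" for r
  proof (rule ccontr)
    assume no: "\<nexists>k::nat. r [^] k \<in> sat P ?Q0"
    have rR: "r \<in> carrier R" using r ideal_carrier[OF id(3)] by blast
    let ?T = "{s \<otimes> r [^] (k::nat) | s k. s \<in> carrier R \<and> s \<notin> P}"
    obtain I where I: "primeideal I R" "?Q0 \<subseteq> I" "I \<inter> ?T = {}"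
    proof (rule prime_maximal_avoiding[OF adq0, of ?T])
      show "?T \<subseteq> carrier R" using rR by auto
      have "\<one> = \<one> \<otimes> r [^] (0::nat)" by simp
      then show "\<one> \<in> ?T" using primeideal_one_notin[OF P] one_closed by blast
      show "?Q0 \<inter> ?T = {}" using no rR by (auto simp: sat_def)
      fix u v assume "u \<in> ?T" "v \<in> ?T"
      then obtain s t and j k :: nat where *: "u = s \<otimes> r [^] j" "v = t \<otimes> r [^] k"
          "s \<in> carrier R" "s \<notin> P" "t \<in> carrier R" "t \<notin> P" by blast
      have "u \<otimes> v = (s \<otimes> t) \<otimes> r [^] (j + k)" using * rR by (simp add: nat_pow_mult[symmetric] m_ac)
      moreover have "s \<otimes> t \<in> carrier R" "s \<otimes> t \<notin> P" using * primeideal_mult_iff[OF P] by auto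
      ultimately show "u \<otimes> v \<in> ?T" by blast
    qed
    have idI: "ideal I R" using I by (auto intro: primeideal.axioms)
    have "I \<subseteq> P"
    proof
      fix u assume u: "u \<in> I"
      show "u \<in> P"
      proof (rule ccontr)
        assume "u \<notin> P"
        moreover have "u = u \<otimes> r [^] (0::nat)" "u \<in> carrier R" using u ideal_carrier[OF idI] by auto
        ultimately have "u \<in> ?T" by blast
        then show False using u I by blast
      qed
    qed
    moreover have "r \<notin> I"
    proof
      assume "r \<in> I"
      moreover have "r = \<one> \<otimes> r [^] (1::nat)" using rR by simp
      then have "r \<in> ?T" using primeideal_one_notin[OF P] one_closed by blast
      ultimately show False using I by blast
    qed
    moreover have "q0 \<subseteq> I" "x \<in> I" using I subset_adjoin[OF id(1) xR] mem_adjoin[OF id(1) xR] by auto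
    moreover have "q0 \<noteq> I" using \<open>x \<in> I\<close> x lt by blast
    ultimately show False using none I r by blast
  qed
  \<comment> \<open>The symbolic powers of \<open>q\<close> modulo \<open>q0\<close>. Being
    saturated at \<open>q\<close>, they are also saturated at the larger prime \<open>P\<close>, so
    Nakayama's lemma can be used at both primes.\<close>
  define sp where "sp k = sat q (ideal_pow R q k <+> q0)" for k
  have pq: "ideal (ideal_pow R q k) R" for k by (rule ideal_pow_ideal[OF id(2)])
  have pqi: "ideal (ideal_pow R q k <+> q0) R" for k using add_ideals[OF pq id(1)] .
  have spid: "ideal (sp k) R" for k unfolding sp_def by (rule sat_ideal[OF q pqi])
  have spsq: "saturated q (sp k)" for k unfolding sp_def by (rule saturated_sat[OF q pqi])
  have spsP: "saturated P (sp k)" for k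
    using spsq[of k] lt unfolding saturated_def by blast
  have spdec: "sp (Suc k) \<subseteq> sp k" for k
    unfolding sp_def using ideal_pow_Suc_subset[OF id(2), of k]
    by (intro sat_mono) (auto simp: set_add_def')
  have q0sp: "q0 \<subseteq> sp k" for k
    unfolding sp_def using subset_sat[OF q pqi] set_add_right[OF pq id(1)] by blast
  let ?J = "\<lambda>k. sat P (adjoin R (sp k) x)"
  have adJ: "ideal (adjoin R (sp k) x) R" for k using adjoin_ideal[OF spid xR] .
  have "\<exists>N. \<forall>k\<ge>N. ?J k = ?J N"
  proof (rule saturated_dcc[OF P saturated_sat[OF P adq0] nil])
    fix k show "saturated P (?J k)" by (rule saturated_sat[OF P adJ])
    show "sat P ?Q0 \<subseteq> ?J k" "?J (Suc k) \<subseteq> ?J k"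
      using q0sp[of k] spdec[of k] by (intro sat_mono; auto simp: adjoin_def)+
  qed
  then obtain N where N: "?J N = ?J (Suc N)" by (metis lessI less_imp_le)
  \<comment> \<open>In \<open>s r = t + c x\<close> the coefficient \<open>c\<close> is again in
    \<open>sp N\<close>, because \<open>sp N\<close> is saturated at \<open>q\<close> and
    \<open>x\<close> is not in \<open>q\<close>; and \<open>x\<close> is in
    \<open>P\<close>.\<close>
  have "sp N \<subseteq> sat P (sp (Suc N) <+> ideal_prod R P (sp N))"
  proof
    fix r assume r: "r \<in> sp N"
    have rR: "r \<in> carrier R" using r ideal_carrier[OF spid] by blast
    have "r \<in> ?J (Suc N)" using r subset_sat[OF P adJ] subset_adjoin[OF spid xR] N by blast
    then obtain s t c where s: "s \<in> carrier R" "s \<notin> P" and tc: "t \<in> sp (Suc N)" "c \<in> carrier R"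
      and sr: "s \<otimes> r = t \<oplus> c \<otimes> x" by (auto simp: sat_def adjoin_def)
    have tN: "t \<in> sp N" "t \<in> carrier R" using tc spdec ideal_carrier[OF spid] by auto
    have "x \<otimes> c = s \<otimes> r \<ominus> t" unfolding sr using tc(2) tN xR by algebra
    then have "x \<otimes> c \<in> sp N" using r tN s ideal_minus[OF spid] ideal_lmult[OF spid] by simp
    then have "c \<in> sp N" using spsq[of N] x xR tc unfolding saturated_def by blast
    then have "x \<otimes> c \<in> ideal_prod R P (sp N)" using x by (intro ideal_prod.prod)
    moreover have "s \<otimes> r = t \<oplus> x \<otimes> c" using sr xR tc by (simp add: m_comm)
    ultimately show "r \<in> sat P (sp (Suc N) <+> ideal_prod R P (sp N))"
      using s rR tc by (auto simp: sat_def mem_set_add)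
  qed
  then have "sp N \<subseteq> sat P (sp (Suc N))" by (rule nakayama_sat[OF P spid spid])
  then have spN: "sp N \<subseteq> sp (Suc N)" using sat_saturated[OF spsP] by blast
  \<comment> \<open>The second use of Nakayama's lemma, now at \<open>q\<close>: the
    \<open>N\<close>-th power of \<open>q\<close> lies in \<open>q0\<close>, and therefore so does
    \<open>q\<close>, as \<open>q0\<close> is prime.\<close>
  have "ideal_pow R q N \<subseteq> sat q (q0 <+> ideal_prod R q (ideal_pow R q N))"
  proof -
    have "ideal_pow R q N \<subseteq> sp N"
      unfolding sp_def using subset_sat[OF q pqi] set_add_left[OF pq id(1)] by blast
    also have "\<dots> \<subseteq> sp (Suc N)" by (rule spN)
    also have "\<dots> = sat q (q0 <+> ideal_prod R q (ideal_pow R q N))"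
      unfolding sp_def ideal_pow_Suc'[OF id(2)]
      using set_add_comm pq[of "Suc N"] id ideal_carrier unfolding ideal_pow_Suc'[OF id(2)]
      by (metis subsetI)
    finally show ?thesis .
  qed
  then have "ideal_pow R q N \<subseteq> sat q q0" by (rule nakayama_sat[OF q pq id(1)])
  also have "\<dots> \<subseteq> q0" using sat_saturated[OF saturated_prime[OF q0]] lt by blast
  finally have "q \<subseteq> q0"
    using pow_in_ideal_pow[OF id(2)] primeideal_pow[OF q0] ideal_carrier[OF id(2)] by blast
  then show False using lt by blast
qed

end

section \<open>Chains of primes through a given element\<close>

inductive prime_chain :: "('a, 'r) ring_scheme \<Rightarrow> nat \<Rightarrow> 'a set \<Rightarrow> 'a set \<Rightarrow> bool" for R where
  refl: "primeideal p R \<Longrightarrow> prime_chain R 0 p p"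
| step: "prime_chain R k p q \<Longrightarrow> q \<subset> P \<Longrightarrow> primeideal P R \<Longrightarrow> prime_chain R (Suc k) p P"

inductive_cases prime_chain_SucE: "prime_chain R (Suc k) p P"

lemma prime_chain_prime:
  "prime_chain R k p P \<Longrightarrow> primeideal p R \<and> primeideal P R \<and> p \<subseteq> P \<and> (k > 0 \<longrightarrow> p \<subset> P)"
  by (induction rule: prime_chain.induct) auto

lemma prime_chain_prepend:
  assumes "prime_chain R k q P" "p \<subset> q" "primeideal p R"
  shows "prime_chain R (Suc k) p P"
  using assms by (induction rule: prime_chain.induct) (auto intro: prime_chain.intros)

text \<open>If the prime below the top misses \<open>x\<close>, the principal ideal theorem
  exchanges it for one that contains \<open>x\<close>. Induction carries \<open>x\<close> down the
  chain, so that only one link is lost. Chains are built at their upper end because the exchange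
  happens there.\<close>

lemma (in noetherian_cring) prime_chain_through:
  assumes "prime_chain R (Suc k) p P" "x \<in> P"
  shows "\<exists>q. p \<subseteq> q \<and> x \<in> q \<and> prime_chain R k q P"
  using assms
proof (induction k arbitrary: P)
  case 0
  then show ?case using prime_chain_prime[OF 0(1)] prime_chain.refl by blast
next
  case (Suc k)
  from Suc.prems(1) obtain q' where q': "prime_chain R (Suc k) p q'" "q' \<subset> P" "primeideal P R"
    by (rule prime_chain_SucE)
  show ?case
  proof (cases "x \<in> q'")
    case True
    then show ?thesis using Suc.IH[OF q'(1)] q' prime_chain.step by blast
  next
    case False
    from q'(1) obtain q'' where q'': "prime_chain R k p q''" "q'' \<subset> q'" "primeideal q' R"
      by (rule prime_chain_SucE)
    have "primeideal q'' R" using prime_chain_prime[OF q''(1)] by simp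
    then obtain r where r: "primeideal r R" "q'' \<subset> r" "r \<subset> P" "x \<in> r"
      using principal_ideal_theorem[OF _ q''(3) q'(3) q''(2) q'(2) Suc.prems(2) False] by auto
    have "prime_chain R (Suc k) p r" using q'' r by (blast intro: prime_chain.step)
    from Suc.IH[OF this r(4)] obtain q where "p \<subseteq> q" "x \<in> q" "prime_chain R k q r" by blast
    then show ?thesis using prime_chain.step[OF _ r(3) q'(3)] by blast
  qed
qed

section \<open>Linear combinations\<close>

text \<open>Recursion on the number of terms instead of \<open>finsum\<close>: proofs go by
  induction on \<open>k\<close>, and coefficients may be extended arbitrarily beyond
  \<open>k\<close>.\<close>

primrec dot :: "('a, 'r) ring_scheme \<Rightarrow> nat \<Rightarrow> (nat \<Rightarrow> 'a) \<Rightarrow> (nat \<Rightarrow> 'a) \<Rightarrow> 'a" where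
  "dot R 0 c g = \<zero>\<^bsub>R\<^esub>"
| "dot R (Suc k) c g = dot R k c g \<oplus>\<^bsub>R\<^esub> c k \<otimes>\<^bsub>R\<^esub> g k"

definition lincombs :: "('a, 'r) ring_scheme \<Rightarrow> nat \<Rightarrow> (nat \<Rightarrow> 'a) \<Rightarrow> 'a set" where
  "lincombs R k g = {dot R k c g | c. \<forall>i<k. c i \<in> carrier R}"

lemma dot_cong: "(\<And>i. i < k \<Longrightarrow> c i = c' i) \<Longrightarrow> (\<And>i. i < k \<Longrightarrow> g i = g' i) \<Longrightarrow> dot R k c g = dot R k c' g'"
  by (induction k) auto

context cring
begin

lemma dot_closed [simp]:
  "(\<And>i. i < k \<Longrightarrow> c i \<in> carrier R) \<Longrightarrow> (\<And>i. i < k \<Longrightarrow> g i \<in> carrier R) \<Longrightarrow> dot R k c g \<in> carrier R"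
  by (induction k) auto

lemma dot_add:
  assumes "\<And>i. i < k \<Longrightarrow> c i \<in> carrier R" "\<And>i. i < k \<Longrightarrow> c' i \<in> carrier R" "\<And>i. i < k \<Longrightarrow> g i \<in> carrier R"
  shows "dot R k (\<lambda>i. c i \<oplus> c' i) g = dot R k c g \<oplus> dot R k c' g"
  using assms
proof (induction k)
  case (Suc k)
  have *: "dot R k c g \<in> carrier R" "dot R k c' g \<in> carrier R" "c k \<in> carrier R" "c' k \<in> carrier R" "g k \<in> carrier R"
    using Suc.prems by auto
  have "dot R k (\<lambda>i. c i \<oplus> c' i) g = dot R k c g \<oplus> dot R k c' g" using Suc by simp
  then show ?case using * by (simp add: l_distr a_ac)
qed simp

lemma dot_smult:
  assumes "r \<in> carrier R" "\<And>i. i < k \<Longrightarrow> c i \<in> carrier R" "\<And>i. i < k \<Longrightarrow> g i \<in> carrier R"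
  shows "dot R k (\<lambda>i. r \<otimes> c i) g = r \<otimes> dot R k c g"
  using assms by (induction k) (auto simp: r_distr m_assoc)

lemma dot_uminus:
  assumes "\<And>i. i < k \<Longrightarrow> c i \<in> carrier R" "\<And>i. i < k \<Longrightarrow> g i \<in> carrier R"
  shows "dot R k (\<lambda>i. \<ominus> c i) g = \<ominus> dot R k c g"
  using assms by (induction k) (auto simp: l_minus minus_add)

lemma dot_diff:
  assumes "\<And>i. i < k \<Longrightarrow> c i \<in> carrier R" "\<And>i. i < k \<Longrightarrow> c' i \<in> carrier R" "\<And>i. i < k \<Longrightarrow> g i \<in> carrier R"
  shows "dot R k (\<lambda>i. c i \<ominus> c' i) g = dot R k c g \<ominus> dot R k c' g"
  using assms by (simp add: a_minus_def dot_add dot_uminus)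

lemma dot_zero:
  assumes "\<And>i. i < k \<Longrightarrow> c i = \<zero>" "\<And>i. i < k \<Longrightarrow> g i \<in> carrier R"
  shows "dot R k c g = \<zero>"
  using assms by (induction k) auto

lemma dot_truncate:
  assumes "k \<le> n" "\<And>i. i < k \<Longrightarrow> c i \<in> carrier R" "\<And>i. i \<ge> k \<Longrightarrow> i < n \<Longrightarrow> c i = \<zero>"
    "\<And>i. i < n \<Longrightarrow> g i \<in> carrier R"
  shows "dot R n c g = dot R k c g"
  using assms by (induction n rule: dec_induct) auto

lemma dot_split:
  assumes "j < k" "\<And>i. i < k \<Longrightarrow> c i \<in> carrier R" "\<And>i. i < k \<Longrightarrow> g i \<in> carrier R"
  shows "dot R k c g = dot R k (\<lambda>i. if i = j then \<zero> else c i) g \<oplus> c j \<otimes> g j"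
  using assms
proof (induction k)
  case (Suc k)
  show ?case
  proof (cases "j = k")
    case True
    have "dot R k (\<lambda>i. if i = k then \<zero> else c i) g = dot R k c g" by (rule dot_cong) auto
    then show ?thesis using True Suc.prems by simp
  next
    case False
    then have "dot R k c g = dot R k (\<lambda>i. if i = j then \<zero> else c i) g \<oplus> c j \<otimes> g j" using Suc by auto
    moreover have "dot R k (\<lambda>i. if i = j then \<zero> else c i) g \<in> carrier R" using Suc.prems by auto
    moreover have "c j \<in> carrier R" "c k \<in> carrier R" "g j \<in> carrier R" "g k \<in> carrier R" using Suc.prems by auto
    ultimately show ?thesis using False by (simp add: a_ac)
  qed
qed simp

lemma dot_unit:
  assumes "j < k" "r \<in> carrier R" "\<And>i. i < k \<Longrightarrow> g i \<in> carrier R"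
  shows "dot R k (\<lambda>i. if i = j then r else \<zero>) g = r \<otimes> g j"
proof -
  have "dot R k (\<lambda>i. if i = j then \<zero> else if i = j then r else \<zero>) g = \<zero>"
    using assms by (intro dot_zero) auto
  then show ?thesis using assms dot_split[of j k "\<lambda>i. if i = j then r else \<zero>" g] by auto
qed

lemma dot_mem_ideal:
  assumes "ideal I R" "\<And>i. i < k \<Longrightarrow> c i \<otimes> g i \<in> I"
  shows "dot R k c g \<in> I"
  using assms(2) by (induction k) (auto intro: ideal_zero[OF assms(1)] ideal_add[OF assms(1)])

lemma lincombs_ideal:
  assumes "\<And>i. i < k \<Longrightarrow> g i \<in> carrier R"
  shows "ideal (lincombs R k g) R"
proof (rule ideal_criterion)
  show "lincombs R k g \<subseteq> carrier R" using assms by (auto simp: lincombs_def)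
  have "\<zero> = dot R k (\<lambda>_. \<zero>) g" using dot_zero assms by metis
  then show "\<zero> \<in> lincombs R k g" using zero_closed unfolding lincombs_def by blast
next
  fix u v assume "u \<in> lincombs R k g" "v \<in> lincombs R k g"
  then obtain c c' where "u = dot R k c g" "v = dot R k c' g" "\<forall>i<k. c i \<in> carrier R" "\<forall>i<k. c' i \<in> carrier R"
    by (auto simp: lincombs_def)
  then show "u \<oplus> v \<in> lincombs R k g"
    using dot_add[of k c c' g] assms unfolding lincombs_def
    by (intro CollectI exI[of _ "\<lambda>i. c i \<oplus> c' i"]) auto
next
  fix u r assume "u \<in> lincombs R k g" "r \<in> carrier R"
  then obtain c where "u = dot R k c g" "\<forall>i<k. c i \<in> carrier R"
    by (auto simp: lincombs_def)
  then show "r \<otimes> u \<in> lincombs R k g"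
    using dot_smult[of r k c g] assms \<open>r \<in> carrier R\<close> unfolding lincombs_def
    by (intro CollectI exI[of _ "\<lambda>i. r \<otimes> c i"]) auto
qed

lemma mem_lincombs:
  assumes "\<And>i. i < k \<Longrightarrow> g i \<in> carrier R" "j < k"
  shows "g j \<in> lincombs R k g"
proof -
  have "g j = dot R k (\<lambda>i. if i = j then \<one> else \<zero>) g" using dot_unit[of j k \<one> g] assms by simp
  then show ?thesis
    unfolding lincombs_def by (intro CollectI exI[of _ "\<lambda>i. if i = j then \<one> else \<zero>"]) auto
qed

lemma lincombs_minimal:
  assumes "ideal I R" "\<And>i. i < k \<Longrightarrow> g i \<in> I"
  shows "lincombs R k g \<subseteq> I"
  using assms ideal_lmult[OF assms(1)] unfolding lincombs_def by (auto intro: dot_mem_ideal)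

lemma lincombs_0: "lincombs R 0 g = {\<zero>}"
  by (auto simp: lincombs_def)

lemma lincombs_Suc: "lincombs R (Suc k) g = adjoin R (lincombs R k g) (g k)"
proof
  show "lincombs R (Suc k) g \<subseteq> adjoin R (lincombs R k g) (g k)"
  proof
    fix u assume "u \<in> lincombs R (Suc k) g"
    then obtain c where c: "\<forall>i<Suc k. c i \<in> carrier R" "u = dot R k c g \<oplus> c k \<otimes> g k"
      by (auto simp: lincombs_def)
    moreover have "dot R k c g \<in> lincombs R k g" using c unfolding lincombs_def by auto
    ultimately show "u \<in> adjoin R (lincombs R k g) (g k)" unfolding adjoin_def by blast
  qed
  show "adjoin R (lincombs R k g) (g k) \<subseteq> lincombs R (Suc k) g"
  proof
    fix u assume "u \<in> adjoin R (lincombs R k g) (g k)"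
    then obtain c r where c: "\<forall>i<k. c i \<in> carrier R" "r \<in> carrier R" "u = dot R k c g \<oplus> r \<otimes> g k"
      by (auto simp: lincombs_def adjoin_def)
    define c' where "c' = (\<lambda>i. if i = k then r else c i)"
    have "dot R k c' g = dot R k c g" by (rule dot_cong) (auto simp: c'_def)
    then have "u = dot R (Suc k) c' g" using c by (simp add: c'_def)
    moreover have "\<forall>i<Suc k. c' i \<in> carrier R" using c by (auto simp: c'_def less_Suc_eq)
    ultimately show "u \<in> lincombs R (Suc k) g"
      unfolding lincombs_def by blast
  qed
qed

lemma genideal_lincombs:
  assumes "\<And>i. i < k \<Longrightarrow> g i \<in> carrier R"
  shows "Idl (g ` {..<k}) = lincombs R k g"
proof
  show "Idl (g ` {..<k}) \<subseteq> lincombs R k g"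
    using assms by (intro genideal_minimal lincombs_ideal) (auto intro: mem_lincombs)
  have sub: "g ` {..<k} \<subseteq> carrier R" using assms by auto
  show "lincombs R k g \<subseteq> Idl (g ` {..<k})"
    using genideal_self[OF sub] by (intro lincombs_minimal genideal_ideal[OF sub]) auto
qed

lemma ideal_prod_lincombs:
  assumes "ideal J R" "\<And>i. i < k \<Longrightarrow> g i \<in> carrier R" "v \<in> ideal_prod R J (lincombs R k g)"
  obtains c where "\<And>i. i < k \<Longrightarrow> c i \<in> J" "v = dot R k c g"
proof -
  have "\<exists>c. (\<forall>i<k. c i \<in> J) \<and> v = dot R k c g"
    using assms(3)
  proof (induction rule: ideal_prod.induct)
    case (prod j u)
    then obtain c where "\<forall>i<k. c i \<in> carrier R" "u = dot R k c g" by (auto simp: lincombs_def)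
    then show ?case
      using prod assms(2) ideal_carrier[OF assms(1)] ideal_rmult[OF assms(1)]
      by (intro exI[of _ "\<lambda>i. j \<otimes> c i"]) (auto simp: dot_smult)
  next
    case (sum u v)
    then obtain c c' where "\<forall>i<k. c i \<in> J" "u = dot R k c g" "\<forall>i<k. c' i \<in> J" "v = dot R k c' g" by blast
    then show ?case
      using assms(2) ideal_carrier[OF assms(1)] ideal_add[OF assms(1)]
      by (intro exI[of _ "\<lambda>i. c i \<oplus> c' i"]) (auto simp: dot_add)
  qed
  then show ?thesis using that by blast
qed

lemma dot_mem_ideal_prod:
  assumes "ideal I R" "ideal J R" "\<And>i. i < k \<Longrightarrow> c i \<in> I" "\<And>i. i < k \<Longrightarrow> g i \<in> J"
  shows "dot R k c g \<in> ideal_prod R I J"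
  using assms by (intro dot_mem_ideal ideal_prod_is_ideal ideal_prod.prod) auto

end

text \<open>Vectors are functions that vanish from \<open>k\<close> on. Equality of vectors is then
  equality of functions, and \<open>vec R k\<close> sits inside \<open>vec R (Suc k)\<close> without
  a change of type.\<close>

definition vec :: "('a, 'r) ring_scheme \<Rightarrow> nat \<Rightarrow> ('a, nat \<Rightarrow> 'a) module" where
  "vec R k = \<lparr> carrier = {f. (\<forall>i<k. f i \<in> carrier R) \<and> (\<forall>i\<ge>k. f i = \<zero>\<^bsub>R\<^esub>)},
     monoid.mult = (\<lambda>_ _ _. \<zero>\<^bsub>R\<^esub>), monoid.one = (\<lambda>_. \<zero>\<^bsub>R\<^esub>),
     ring.zero = (\<lambda>_. \<zero>\<^bsub>R\<^esub>), ring.add = (\<lambda>f g i. f i \<oplus>\<^bsub>R\<^esub> g i), smult = (\<lambda>r f i. r \<otimes>\<^bsub>R\<^esub> f i) \<rparr>"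

lemma vec_simps [simp]:
  "carrier (vec R k) = {f. (\<forall>i<k. f i \<in> carrier R) \<and> (\<forall>i\<ge>k. f i = \<zero>\<^bsub>R\<^esub>)}"
  "\<zero>\<^bsub>vec R k\<^esub> = (\<lambda>_. \<zero>\<^bsub>R\<^esub>)"
  "f \<oplus>\<^bsub>vec R k\<^esub> g = (\<lambda>i. f i \<oplus>\<^bsub>R\<^esub> g i)"
  "r \<odot>\<^bsub>vec R k\<^esub> f = (\<lambda>i. r \<otimes>\<^bsub>R\<^esub> f i)"
  by (auto simp: vec_def)

lemma (in cring) vec_carrier: "f \<in> carrier (vec R k) \<Longrightarrow> f i \<in> carrier R"
  by (cases "i < k") auto

lemma (in cring) vec_module: "module R (vec R k)"
proof (rule moduleI[OF is_cring])
  show "abelian_group (vec R k)"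
  proof (rule abelian_groupI)
    fix x y z assume "x \<in> carrier (vec R k)" "y \<in> carrier (vec R k)" "z \<in> carrier (vec R k)"
    note c = this[THEN vec_carrier]
    show "x \<oplus>\<^bsub>vec R k\<^esub> y \<oplus>\<^bsub>vec R k\<^esub> z = x \<oplus>\<^bsub>vec R k\<^esub> (y \<oplus>\<^bsub>vec R k\<^esub> z)"
      using c by (simp add: a_assoc)
  next
    fix x y assume "x \<in> carrier (vec R k)" "y \<in> carrier (vec R k)"
    note c = this[THEN vec_carrier]
    show "x \<oplus>\<^bsub>vec R k\<^esub> y = y \<oplus>\<^bsub>vec R k\<^esub> x" using c by (simp add: a_comm)
  next
    fix x assume x: "x \<in> carrier (vec R k)"
    note c = this[THEN vec_carrier]
    show "\<zero>\<^bsub>vec R k\<^esub> \<oplus>\<^bsub>vec R k\<^esub> x = x" using c by simp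
    show "\<exists>y\<in>carrier (vec R k). y \<oplus>\<^bsub>vec R k\<^esub> x = \<zero>\<^bsub>vec R k\<^esub>"
      using x c by (intro bexI[of _ "\<lambda>i. \<ominus> x i"]) (auto simp: l_neg)
  qed auto
next
  fix a b x assume "a \<in> carrier R" "b \<in> carrier R" and x: "x \<in> carrier (vec R k)"
  then show "(a \<oplus> b) \<odot>\<^bsub>vec R k\<^esub> x = a \<odot>\<^bsub>vec R k\<^esub> x \<oplus>\<^bsub>vec R k\<^esub> b \<odot>\<^bsub>vec R k\<^esub> x"
    "(a \<otimes> b) \<odot>\<^bsub>vec R k\<^esub> x = a \<odot>\<^bsub>vec R k\<^esub> (b \<odot>\<^bsub>vec R k\<^esub> x)"
    using x[THEN vec_carrier] by (simp_all add: l_distr m_assoc)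
next
  fix a x y assume "a \<in> carrier R" and x: "x \<in> carrier (vec R k)" "y \<in> carrier (vec R k)"
  then show "a \<odot>\<^bsub>vec R k\<^esub> (x \<oplus>\<^bsub>vec R k\<^esub> y) = a \<odot>\<^bsub>vec R k\<^esub> x \<oplus>\<^bsub>vec R k\<^esub> a \<odot>\<^bsub>vec R k\<^esub> y"
    using x[THEN vec_carrier] by (simp add: r_distr)
next
  fix x assume x: "x \<in> carrier (vec R k)"
  then show "\<one> \<odot>\<^bsub>vec R k\<^esub> x = x" using x[THEN vec_carrier] by simp
qed auto

text \<open>The product \<open>I W\<close>, for \<open>W\<close> any set of vectors. Adding one
  product \<open>r w\<close> at a time gives an induction rule with one generator per step, as the
  transfer between the two rings requires.\<close>

inductive_set ideal_smult ::
  "('a, 'r) ring_scheme \<Rightarrow> ('a, 'b, 'm) module_scheme \<Rightarrow> 'a set \<Rightarrow> 'b set \<Rightarrow> 'b set"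
  for R M I W where
  zero: "\<zero>\<^bsub>M\<^esub> \<in> ideal_smult R M I W"
| step: "r \<in> I \<Longrightarrow> w \<in> W \<Longrightarrow> v \<in> ideal_smult R M I W \<Longrightarrow> (r \<odot>\<^bsub>M\<^esub> w) \<oplus>\<^bsub>M\<^esub> v \<in> ideal_smult R M I W"

lemma ideal_smult_mono:
  assumes "I \<subseteq> J" "V \<subseteq> W" shows "ideal_smult R M I V \<subseteq> ideal_smult R M J W"
proof
  fix v assume "v \<in> ideal_smult R M I V"
  then show "v \<in> ideal_smult R M J W"
    by induction (use assms in \<open>auto intro: ideal_smult.intros\<close>)
qed

context module
begin

lemma ideal_smult_carrier:
  assumes "I \<subseteq> carrier R" "W \<subseteq> carrier M" "v \<in> ideal_smult R M I W"
  shows "v \<in> carrier M"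
  using assms(3) by induction (use assms in auto)

lemma ideal_smult_add:
  assumes "I \<subseteq> carrier R" "W \<subseteq> carrier M" "u \<in> ideal_smult R M I W" "v \<in> ideal_smult R M I W"
  shows "u \<oplus>\<^bsub>M\<^esub> v \<in> ideal_smult R M I W"
  using assms(3)
proof induction
  case zero then show ?case using assms ideal_smult_carrier by simp
next
  case (step r w u)
  have "u \<in> carrier M" "v \<in> carrier M" using step assms ideal_smult_carrier by blast+
  moreover have "r \<odot>\<^bsub>M\<^esub> w \<in> carrier M" using step assms by blast
  ultimately have "r \<odot>\<^bsub>M\<^esub> w \<oplus>\<^bsub>M\<^esub> u \<oplus>\<^bsub>M\<^esub> v = r \<odot>\<^bsub>M\<^esub> w \<oplus>\<^bsub>M\<^esub> (u \<oplus>\<^bsub>M\<^esub> v)" by (simp add: M.a_assoc)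
  then show ?case using step ideal_smult.step by metis
qed

lemma ideal_smult_mem:
  assumes "r \<in> I" "w \<in> W" "I \<subseteq> carrier R" "W \<subseteq> carrier M"
  shows "r \<odot>\<^bsub>M\<^esub> w \<in> ideal_smult R M I W"
proof -
  have "r \<odot>\<^bsub>M\<^esub> w = r \<odot>\<^bsub>M\<^esub> w \<oplus>\<^bsub>M\<^esub> \<zero>\<^bsub>M\<^esub>"
    using assms smult_closed[of r w] by (simp add: subset_iff)
  then show ?thesis using ideal_smult.step[OF assms(1,2) ideal_smult.zero] by metis
qed

lemma ideal_smult_smult:
  assumes I: "ideal I R" and "W \<subseteq> carrier M" "u \<in> ideal_smult R M I W" "s \<in> carrier R"
  shows "s \<odot>\<^bsub>M\<^esub> u \<in> ideal_smult R M I W"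
  using assms(3)
proof induction
  case zero then show ?case using assms ideal_smult.zero by simp
next
  case (step r w u)
  have IR: "I \<subseteq> carrier R" using ideal_carrier[OF I] by blast
  have c: "u \<in> carrier M" "w \<in> carrier M" "r \<in> carrier R" using step assms IR ideal_smult_carrier by blast+
  then have "s \<odot>\<^bsub>M\<^esub> (r \<odot>\<^bsub>M\<^esub> w \<oplus>\<^bsub>M\<^esub> u) = (s \<otimes> r) \<odot>\<^bsub>M\<^esub> w \<oplus>\<^bsub>M\<^esub> s \<odot>\<^bsub>M\<^esub> u"
    using assms by (simp add: smult_r_distr smult_assoc1)
  then show ?case using step assms ideal_smult.step ideal_lmult[OF I] by metis
qed

lemma ideal_smult_submodule:
  assumes I: "ideal I R" and W: "W \<subseteq> carrier M"
  shows "submodule (ideal_smult R M I W) R M"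
proof (rule submoduleI)
  have IR: "I \<subseteq> carrier R" using ideal_carrier[OF I] by blast
  show "ideal_smult R M I W \<subseteq> carrier M" using ideal_smult_carrier[OF IR W] by blast
  show "\<zero>\<^bsub>M\<^esub> \<in> ideal_smult R M I W" by (rule ideal_smult.zero)
  show "\<And>a b. a \<in> ideal_smult R M I W \<Longrightarrow> b \<in> ideal_smult R M I W \<Longrightarrow> a \<oplus>\<^bsub>M\<^esub> b \<in> ideal_smult R M I W"
    using ideal_smult_add[OF IR W] by blast
  show sm: "\<And>a x. a \<in> carrier R \<Longrightarrow> x \<in> ideal_smult R M I W \<Longrightarrow> a \<odot>\<^bsub>M\<^esub> x \<in> ideal_smult R M I W"
    using ideal_smult_smult[OF I W] by blast
  fix a assume "a \<in> ideal_smult R M I W"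
  then show "\<ominus>\<^bsub>M\<^esub> a \<in> ideal_smult R M I W"
    using sm[of "\<ominus> \<one>" a] ideal_smult_carrier[OF IR W] by (simp add: smult_l_minus)
qed

lemma submodule_simps:
  assumes "submodule H R M"
  shows submodule_carrier: "x \<in> H \<Longrightarrow> x \<in> carrier M"
    and submodule_zero: "\<zero>\<^bsub>M\<^esub> \<in> H"
    and submodule_add: "x \<in> H \<Longrightarrow> y \<in> H \<Longrightarrow> x \<oplus>\<^bsub>M\<^esub> y \<in> H"
    and submodule_minus: "x \<in> H \<Longrightarrow> y \<in> H \<Longrightarrow> x \<ominus>\<^bsub>M\<^esub> y \<in> H"
    and submodule_smult: "x \<in> H \<Longrightarrow> r \<in> carrier R \<Longrightarrow> r \<odot>\<^bsub>M\<^esub> x \<in> H"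
  using submoduleE[OF assms] submodule.axioms(1)[OF assms] subgroup.one_closed[of H "add_monoid M"]
  by (auto simp: a_minus_def)

end

section \<open>Regular local rings\<close>

locale noetherian_local = noetherian_cring R for R (structure) +
  fixes m
  assumes maximal: "maximalideal m R" and unique: "maximalideal I R \<Longrightarrow> I = m"
begin

lemma m_ideal: "ideal m R"
  using maximal by (rule maximalideal.axioms)

lemma m_prime: "primeideal m R"
  using maximal by (rule maximalideal_prime)

lemma proper_subset_m:
  assumes "ideal I R" "I \<noteq> carrier R" shows "I \<subseteq> m"
proof -
  let ?S = "{J. ideal J R \<and> I \<subseteq> J \<and> \<one> \<notin> J}"
  have "I \<in> ?S" using assms ideal.one_imp_carrier by blast
  then obtain M where "M \<in> ?S" and max: "\<And>J. J \<in> ?S \<Longrightarrow> M \<subseteq> J \<Longrightarrow> J = M"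
    using maximal_ideal_in_family[of I ?S] by blast
  then have M: "ideal M R" "I \<subseteq> M" "\<one> \<notin> M" by auto
  have "maximalideal M R"
  proof (rule maximalidealI[OF M(1)])
    show "carrier R \<noteq> M" using M by blast
    fix J assume "ideal J R" "M \<subseteq> J" "J \<subseteq> carrier R"
    then show "J = M \<or> J = carrier R"
      using max[of J] M(2) ideal.one_imp_carrier[of J R] by blast
  qed
  then show ?thesis using unique M by blast
qed

lemma unit_outside_m:
  assumes "s \<in> carrier R" "s \<notin> m" obtains t where "t \<in> carrier R" "t \<otimes> s = \<one>"
proof -
  have "PIdl s = carrier R"
    using proper_subset_m[OF cgenideal_ideal[OF assms(1)]] cgenideal_self[OF assms(1)] assms by blast
  then have "\<one> \<in> PIdl s" by simp
  then show ?thesis using that unfolding cgenideal_def by auto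
qed

text \<open>The case \<open>P = m\<close> of \<open>nakayama_sat\<close>: elements outside
  \<open>m\<close> are units, so saturation at \<open>m\<close> changes nothing.\<close>

lemma nakayama:
  assumes M: "ideal M R" and N: "ideal N R" and sub: "M \<subseteq> N <+> ideal_prod R m M"
  shows "M \<subseteq> N"
proof -
  have id: "ideal (N <+> ideal_prod R m M) R"
    using M N m_ideal by (intro add_ideals ideal_prod_is_ideal)
  have "M \<subseteq> sat m N"
    using nakayama_sat[OF m_prime M N] subset_sat[OF m_prime id] sub by blast
  moreover have "sat m N \<subseteq> N"
  proof
    fix r assume "r \<in> sat m N"
    then obtain s where s: "r \<in> carrier R" "s \<in> carrier R" "s \<notin> m" "s \<otimes> r \<in> N" by (auto simp: sat_def)
    obtain t where t: "t \<in> carrier R" "t \<otimes> s = \<one>" using unit_outside_m s by blast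
    have "r = t \<otimes> (s \<otimes> r)" using s t by (simp add: m_assoc[symmetric])
    then show "r \<in> N" using s t ideal_lmult[OF N] by metis
  qed
  ultimately show ?thesis by blast
qed

text \<open>Says that \<open>R/I\<close> has dimension at least \<open>k\<close>. Chains may be
  taken to end in \<open>m\<close>, which contains every prime; a predicate avoids suprema of chain
  lengths.\<close>

definition dim_ge :: "'a set \<Rightarrow> nat \<Rightarrow> bool" where
  "dim_ge I k \<longleftrightarrow> (\<exists>p. I \<subseteq> p \<and> prime_chain R k p m)"

lemma prime_subset_m: "primeideal p R \<Longrightarrow> p \<subseteq> m"
  using proper_subset_m primeideal.axioms(1) primeideal.I_notcarr by metis

lemma dim_ge_adjoin:
  assumes "dim_ge I (Suc k)" "x \<in> m" "ideal I R"
  shows "dim_ge (adjoin R I x) k"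
proof -
  obtain p where p: "I \<subseteq> p" "prime_chain R (Suc k) p m" using assms by (auto simp: dim_ge_def)
  obtain q where q: "p \<subseteq> q" "x \<in> q" "prime_chain R k q m"
    using prime_chain_through[OF p(2) assms(2)] by blast
  have "ideal q R" using prime_chain_prime[OF q(3)] primeideal.axioms(1) by blast
  then have "adjoin R I x \<subseteq> q" using p q by (intro adjoin_minimal) auto
  then show ?thesis using q by (auto simp: dim_ge_def)
qed

text \<open>Each element of \<open>Y\<close> that is adjoined to \<open>J\<close> lowers the
  dimension by at most one, and once \<open>m \<subseteq> J\<close> no strict chain is left above
  \<open>J\<close>.\<close>

lemma dim_ge_bound:
  assumes "finite Y" "Y \<subseteq> m" "ideal J R" "dim_ge J k" "m \<subseteq> Idl (J \<union> Y)"
  shows "k \<le> card Y"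
  using assms
proof (induction Y arbitrary: J k)
  case empty
  then have "m \<subseteq> J" using genideal_minimal[of J J] by auto
  obtain p where p: "J \<subseteq> p" "prime_chain R k p m" using empty by (auto simp: dim_ge_def)
  have "\<not> k > 0" using prime_chain_prime[OF p(2)] p(1) \<open>m \<subseteq> J\<close> by blast
  then show ?case by simp
next
  case (insert y Y)
  show ?case
  proof (cases k)
    case (Suc l)
    have y: "y \<in> m" "y \<in> carrier R" using insert.prems ideal_carrier[OF m_ideal] by auto
    have J: "ideal J R" by fact
    have ad: "ideal (adjoin R J y) R" by (rule adjoin_ideal[OF J y(2)])
    have sub: "adjoin R J y \<union> Y \<subseteq> carrier R"
      using ideal_carrier[OF ad] ideal_carrier[OF m_ideal] insert.prems by auto
    have "Idl (J \<union> insert y Y) \<subseteq> Idl (adjoin R J y \<union> Y)"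
      using genideal_self[OF sub] subset_adjoin[OF J y(2)] mem_adjoin[OF J y(2)]
      by (intro genideal_minimal genideal_ideal[OF sub]) auto
    then have "l \<le> card Y"
      using insert.prems dim_ge_adjoin[OF _ y(1) J] Suc ad by (intro insert.IH[of "adjoin R J y"]) auto
    then show ?thesis using Suc insert.hyps by simp
  qed simp
qed

end

section \<open>Regular systems of parameters and their syzygies\<close>

locale regular_system = noetherian_local +
  fixes d :: nat and x :: "nat \<Rightarrow> 'a"
  assumes x_carrier: "\<And>i. i < d \<Longrightarrow> x i \<in> carrier R"
    and m_gen: "m = lincombs R d x"
    and dim: "dim_ge {\<zero>} d"
begin

lemma x_in_m: "i < d \<Longrightarrow> x i \<in> m"
  unfolding m_gen using x_carrier by (intro mem_lincombs)

lemma lincombs_x_ideal: "i \<le> d \<Longrightarrow> ideal (lincombs R i x) R"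
  using x_carrier by (intro lincombs_ideal) auto

lemma dim_lincombs:
  assumes "i \<le> d" shows "dim_ge (lincombs R i x) (d - i)"
  using assms
proof (induction i)
  case 0 then show ?case using dim by (simp add: lincombs_0)
next
  case (Suc i)
  then have "dim_ge (lincombs R i x) (Suc (d - Suc i))" by (simp add: Suc_diff_Suc)
  then show ?case unfolding lincombs_Suc using Suc.prems x_in_m lincombs_x_ideal[of i] by (intro dim_ge_adjoin) auto
qed

text \<open>The parameters from \<open>x i\<close> on generate \<open>m\<close> modulo
  \<open>J\<close>, which bounds the dimension from above. With \<open>dim_lincombs\<close>,
  \<open>R\<close> modulo the first \<open>i\<close> parameters has dimension exactly
  \<open>d - i\<close>.\<close>

lemma dim_bound:
  assumes "ideal J R" "lincombs R i x \<subseteq> J" "dim_ge J k" "i \<le> d"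
  shows "k \<le> d - i"
proof -
  let ?Y = "x ` {i..<d}"
  have sub: "J \<union> ?Y \<subseteq> carrier R" using x_carrier ideal_carrier[OF assms(1)] by auto
  have "x j \<in> Idl (J \<union> ?Y)" if "j < d" for j
  proof (cases "j < i")
    case True
    then have "x j \<in> lincombs R i x" using x_carrier assms(4) by (intro mem_lincombs) auto
    then show ?thesis using assms(2) genideal_self[OF sub] by auto
  qed (use that genideal_self[OF sub] in auto)
  then have "m \<subseteq> Idl (J \<union> ?Y)"
    unfolding m_gen by (intro lincombs_minimal genideal_ideal[OF sub])
  then have "k \<le> card ?Y" using x_in_m assms by (intro dim_ge_bound) auto
  also have "\<dots> \<le> card {i..<d}" by (rule card_image_le) simp
  finally show ?thesis by simp
qed

lemma x_notin_lincombs: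
  assumes "i < d" shows "x i \<notin> lincombs R i x"
proof
  assume "x i \<in> lincombs R i x"
  then have "lincombs R (Suc i) x \<subseteq> lincombs R i x"
    unfolding lincombs_Suc using lincombs_x_ideal[of i] assms by (intro adjoin_minimal) auto
  then have "d - i \<le> d - Suc i"
    using dim_bound[OF lincombs_x_ideal[of i], of "Suc i" "d - i"] dim_lincombs[of i] assms by simp
  then show False using assms by simp
qed

text \<open>Descending induction from \<open>m\<close>. Let \<open>p\<close> be the bottom of a
  chain of length \<open>d - i\<close> above the ideal \<open>P\<close> of the first
  \<open>i\<close> parameters. Counting dimensions, \<open>x i\<close> is not in \<open>p\<close>,
  and the bottom of a chain one link shorter above \<open>p + (x i)\<close> is the prime ideal of
  the first \<open>i + 1\<close> parameters. Hence \<open>p \<subseteq> P + (x i)\<close>, so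
  \<open>p \<subseteq> P + m p\<close>, and Nakayama's lemma gives \<open>p = P\<close>.\<close>

lemma lincombs_prime:
  assumes "i \<le> d" shows "primeideal (lincombs R i x) R"
  using assms
proof (induction rule: inc_induct)
  case base then show ?case using m_prime m_gen by simp
next
  case (step i)
  let ?P = "lincombs R i x"
  have P: "ideal ?P R" using lincombs_x_ideal step by simp
  have xi: "x i \<in> carrier R" "x i \<in> m" using step x_carrier x_in_m by auto
  obtain p where p: "?P \<subseteq> p" "prime_chain R (d - i) p m"
    using dim_lincombs[of i] step by (auto simp: dim_ge_def)
  have pp: "primeideal p R" using prime_chain_prime[OF p(2)] by blast
  have idp: "ideal p R" using pp by (rule primeideal.axioms)
  have dp: "dim_ge p (d - i)" using p by (auto simp: dim_ge_def)
  have "x i \<notin> p"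
  proof
    assume "x i \<in> p"
    then have "lincombs R (Suc i) x \<subseteq> p" unfolding lincombs_Suc using p idp by (intro adjoin_minimal)
    then have "d - i \<le> d - Suc i" using dim_bound[OF idp] dp step by simp
    then show False using step by simp
  qed
  have "dim_ge p (Suc (d - Suc i))" using dp step by (simp add: Suc_diff_Suc)
  then have "dim_ge (adjoin R p (x i)) (d - Suc i)" by (rule dim_ge_adjoin[OF _ xi(2) idp])
  then obtain q where q: "adjoin R p (x i) \<subseteq> q" "prime_chain R (d - Suc i) q m" by (auto simp: dim_ge_def)
  have sub: "lincombs R (Suc i) x \<subseteq> q" unfolding lincombs_Suc using q p by (auto simp: adjoin_def)
  have "q = lincombs R (Suc i) x"
  proof (rule ccontr)
    assume "q \<noteq> lincombs R (Suc i) x"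
    then have "prime_chain R (Suc (d - Suc i)) (lincombs R (Suc i) x) m"
      using prime_chain_prepend[OF q(2)] sub step by blast
    then have "dim_ge (lincombs R (Suc i) x) (Suc (d - Suc i))" by (auto simp: dim_ge_def)
    then have "Suc (d - Suc i) \<le> d - Suc i" using dim_bound[OF lincombs_x_ideal, of "Suc i"] step by auto
    then show False by simp
  qed
  then have pq: "p \<subseteq> adjoin R ?P (x i)"
    using q subset_adjoin[OF idp xi(1)] by (simp add: lincombs_Suc)
  have "p \<subseteq> ?P <+> ideal_prod R m p"
  proof
    fix z assume z: "z \<in> p"
    then obtain w c where w: "w \<in> ?P" "c \<in> carrier R" "z = w \<oplus> c \<otimes> x i" using pq by (auto simp: adjoin_def)
    have wR: "w \<in> p" "w \<in> carrier R" using w p ideal_carrier[OF idp] by auto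
    have "c \<otimes> x i = z \<ominus> w" unfolding w(3) using w(2) wR xi by algebra
    then have "c \<otimes> x i \<in> p" using ideal_minus[OF idp z wR(1)] by simp
    then have "c \<in> p" using primeideal_mult_iff[OF pp w(2) xi(1)] \<open>x i \<notin> p\<close> by blast
    then have "x i \<otimes> c \<in> ideal_prod R m p" using xi by (intro ideal_prod.prod)
    then show "z \<in> ?P <+> ideal_prod R m p" using w xi by (auto simp: mem_set_add m_comm)
  qed
  then have "p \<subseteq> ?P" by (rule nakayama[OF idp P])
  then have "p = ?P" using p by blast
  then show ?case using pp by simp
qed

text \<open>If \<open>c j\<close> were a unit, \<open>x j\<close> would be a combination of the
  other parameters modulo \<open>m^2\<close>. By Nakayama's lemma these would generate
  \<open>m\<close>, and they are too few for the dimension.\<close>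

lemma independent_mod_m2:
  assumes c: "\<And>i. i < d \<Longrightarrow> c i \<in> carrier R" and "dot R d c x \<in> ideal_prod R m m" and j: "j < d"
  shows "c j \<in> m"
proof (rule ccontr)
  assume "c j \<notin> m"
  then obtain t where t: "t \<in> carrier R" "t \<otimes> c j = \<one>" using unit_outside_m c j by blast
  let ?Y = "x ` ({..<d} - {j})"
  have Y: "?Y \<subseteq> carrier R" using x_carrier by auto
  let ?N = "Idl ?Y"
  have N: "ideal ?N R" by (rule genideal_ideal[OF Y])
  have mm: "ideal (ideal_prod R m m) R" using m_ideal by (intro ideal_prod_is_ideal)
  let ?M = "?N <+>\<^bsub>R\<^esub> ideal_prod R m m"
  have M: "ideal ?M R" by (rule add_ideals[OF N mm])
  have xN: "x i \<in> ?N" if "i < d" "i \<noteq> j" for i using that genideal_self[OF Y] by auto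
  have xj: "x j \<in> carrier R" "c j \<in> carrier R" using x_carrier c j by auto
  have "dot R d (\<lambda>i. if i = j then \<zero> else c i) x \<in> ?N"
    using c x_carrier xN j ideal_zero[OF N] by (intro dot_mem_ideal[OF N]) (auto intro: ideal_lmult[OF N])
  then have v: "dot R d (\<lambda>i. if i = j then \<zero> else c i) x \<in> ?M" "dot R d (\<lambda>i. if i = j then \<zero> else c i) x \<in> carrier R"
    using set_add_left[OF N mm] ideal_carrier[OF N] by auto
  have u: "dot R d c x \<in> ?M" using assms(2) set_add_right[OF N mm] by auto
  define v where "v = dot R d (\<lambda>i. if i = j then \<zero> else c i) x"
  have "dot R d c x = v \<oplus> c j \<otimes> x j" unfolding v_def using dot_split[OF j c x_carrier] by simp
  then have "c j \<otimes> x j = dot R d c x \<ominus> v" using v(2)[folded v_def] xj by algebra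
  then have "t \<otimes> (c j \<otimes> x j) \<in> ?M" using u v(1)[folded v_def] t ideal_minus[OF M] ideal_lmult[OF M] by simp
  moreover have "t \<otimes> (c j \<otimes> x j) = x j" using t xj by (simp add: m_assoc[symmetric])
  ultimately have "x i \<in> ?M" if "i < d" for i
    using that xN set_add_left[OF N mm] by (cases "i = j") auto
  then have "lincombs R d x \<subseteq> ?M" by (intro lincombs_minimal[OF M])
  then have "m \<subseteq> ?N" unfolding m_gen[symmetric] by (rule nakayama[OF m_ideal N])
  then have "m \<subseteq> Idl ({\<zero>} \<union> ?Y)" using subset_Idl_subset[of "{\<zero>} \<union> ?Y" ?Y] Y by auto
  then have "d \<le> card ?Y" using dim x_in_m zeroideal by (intro dim_ge_bound) auto
  also have "\<dots> \<le> card ({..<d} - {j})" by (rule card_image_le) simp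
  also have "\<dots> < d" using j by simp
  finally show False by simp
qed

text \<open>Syzygies of \<open>x\<close> modulo \<open>I\<close>, that is, lifts of syzygies of the
  images of \<open>x\<close> in \<open>R/I\<close>.\<close>

definition syzygies :: "'a set \<Rightarrow> (nat \<Rightarrow> 'a) set" where
  "syzygies I = {z \<in> carrier (vec R d). dot R d z x \<in> I}"

text \<open>Since the ideals \<open>lincombs R i x\<close> are prime, the syzygies of \<open>x\<close> are generated by the
  Koszul relations; the coefficients can be taken in \<open>m\<close> because \<open>x\<close> is independent
  modulo \<open>m\<^sup>2\<close>.\<close>

lemma koszul:
  assumes "q \<in> carrier (vec R d)" "\<And>i. i < d \<Longrightarrow> q i \<in> ideal_prod R m m"
    "\<And>i. i \<ge> k \<Longrightarrow> q i = \<zero>" "k \<le> d" "dot R d q x = \<zero>"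
  shows "q \<in> ideal_smult R (vec R d) m (syzygies {\<zero>})"
  using assms
proof (induction k arbitrary: q)
  case 0
  then have "q = \<zero>\<^bsub>vec R d\<^esub>" by auto
  then show ?case by (metis ideal_smult.zero)
next
  case (Suc k)
  interpret V: module R "vec R d" by (rule vec_module)
  have mm: "ideal (ideal_prod R m m) R" using m_ideal by (intro ideal_prod_is_ideal)
  have mR: "m \<subseteq> carrier R" using ideal_carrier[OF m_ideal] by blast
  have k: "k < d" using Suc.prems by simp
  have qR: "q i \<in> carrier R" for i using Suc.prems(1) vec_carrier by blast
  have xk: "x k \<in> carrier R" using x_carrier k by simp
  have dk: "dot R k q x \<in> carrier R" using qR x_carrier k by auto
  have "dot R d q x = dot R (Suc k) q x"
    using Suc.prems qR x_carrier by (intro dot_truncate) auto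
  then have eq: "dot R k q x \<oplus> q k \<otimes> x k = \<zero>" using Suc.prems by simp
  then have "q k \<otimes> x k = \<ominus> dot R k q x"
    using qR xk dk by (metis m_closed minus_equality a_comm)
  moreover have "dot R k q x \<in> lincombs R k x" using qR by (auto simp: lincombs_def)
  ultimately have "q k \<otimes> x k \<in> lincombs R k x"
    using ideal_uminus[OF lincombs_x_ideal[of k]] k by simp
  \<comment> \<open>Regularity of the sequence: \<open>x k\<close> is no zero divisor modulo the
    prime ideal of the earlier parameters.\<close>
  then have "q k \<in> lincombs R k x"
    using primeideal_mult_iff[OF lincombs_prime[of k] qR[of k] xk] x_notin_lincombs[OF k] k by simp
  then obtain c0 where c0: "\<forall>i<k. c0 i \<in> carrier R" "q k = dot R k c0 x" by (auto simp: lincombs_def)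
  define c where "c = (\<lambda>i. if i < k then c0 i else \<zero>)"
  have cR: "c i \<in> carrier R" for i using c0 by (simp add: c_def)
  have qk: "q k = dot R k c x" unfolding c0 by (rule dot_cong) (auto simp: c_def)
  have "dot R d c x = q k" unfolding qk using k cR x_carrier c0(1) by (intro dot_truncate) (auto simp: c_def)
  then have "dot R d c x \<in> ideal_prod R m m" using Suc.prems k by simp
  then have cm: "i < k \<Longrightarrow> c i \<in> m" for i using independent_mod_m2[of c i, OF cR] k by simp
  \<comment> \<open>Subtracting the Koszul relations with coefficients \<open>c\<close> removes the
    entry at \<open>k\<close> and leaves a syzygy supported below \<open>k\<close>, with entries
    still in \<open>m^2\<close>.\<close>
  define q' where "q' = (\<lambda>i. if i < k then q i \<oplus> c i \<otimes> x k else \<zero>)"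
  have q'm: "q' i \<in> ideal_prod R m m" if "i < d" for i
  proof (cases "i < k")
    case True
    then have "q i \<oplus> c i \<otimes> x k \<in> ideal_prod R m m"
      using Suc.prems(2)[OF that] cm x_in_m[OF k] by (intro ideal_add[OF mm] ideal_prod.prod)
    then show ?thesis using True by (simp add: q'_def)
  next
    case False
    then show ?thesis using ideal_zero[OF mm] by (simp add: q'_def)
  qed
  have q'V: "q' \<in> carrier (vec R d)" using qR cR xk k by (auto simp: q'_def)
  have "dot R d q' x = dot R k q' x"
  proof (rule dot_truncate)
    show "\<And>i. q' i \<in> carrier R" by (rule vec_carrier[OF q'V])
  qed (use x_carrier k in \<open>auto simp: q'_def\<close>)
  also have "\<dots> = dot R k (\<lambda>i. q i \<oplus> x k \<otimes> c i) x"
    using cR xk by (intro dot_cong) (auto simp: q'_def m_comm)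
  also have "\<dots> = dot R k q x \<oplus> x k \<otimes> dot R k c x"
    using qR cR xk x_carrier k by (simp add: dot_add dot_smult)
  also have "\<dots> = \<zero>" unfolding qk[symmetric] using eq qR xk by (simp add: m_comm)
  finally have q'0: "dot R d q' x = \<zero>" .
  have IH: "q' \<in> ideal_smult R (vec R d) m (syzygies {\<zero>})"
    using q'V q'm q'0 k by (intro Suc.IH) (auto simp: q'_def)
  \<comment> \<open>\<open>w j\<close> is the sum over \<open>i < j\<close> of \<open>c i\<close>
    times the Koszul relation between \<open>x i\<close> and \<open>x k\<close>; the last one,
    \<open>w k\<close>, equals \<open>q - q'\<close>.\<close>
  define w where "w j = (\<lambda>i. if i < j then \<ominus> (c i \<otimes> x k) else if i = k then dot R j c x else \<zero>)" for j
  have "w j \<in> ideal_smult R (vec R d) m (syzygies {\<zero>})" if "j \<le> k" for j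
    using that
  proof (induction j)
    case 0
    have "w 0 = \<zero>\<^bsub>vec R d\<^esub>" by (auto simp: w_def)
    then show ?case by (metis ideal_smult.zero)
  next
    case (Suc j)
    define K where "K = (\<lambda>i. (if i = k then x j else \<zero>) \<ominus> (if i = j then x k else \<zero>))"
    have xj: "x j \<in> carrier R" using x_carrier k Suc by simp
    have KV: "K \<in> carrier (vec R d)" using xj xk k Suc by (auto simp: K_def)
    have "dot R d K x = \<zero>"
      unfolding K_def using xj xk k Suc x_carrier
      by (subst dot_diff) (auto simp: dot_unit m_comm[of "x j"] r_neg a_minus_def)
    then have K: "K \<in> syzygies {\<zero>}" using KV by (simp add: syzygies_def)
    have dj: "dot R j c x \<in> carrier R" using cR x_carrier k Suc by auto
    have "w (Suc j) = c j \<odot>\<^bsub>vec R d\<^esub> K \<oplus>\<^bsub>vec R d\<^esub> w j"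
      using Suc.prems cR xj xk dj
      by (auto simp: w_def K_def fun_eq_iff a_minus_def r_minus a_comm less_Suc_eq)
    then show ?case using Suc cm K by (auto intro!: ideal_smult.step simp del: vec_simps)
  qed
  then have wk: "w k \<in> ideal_smult R (vec R d) m (syzygies {\<zero>})" by simp
  have "q = w k \<oplus>\<^bsub>vec R d\<^esub> q'"
  proof
    fix i
    have "q i = \<ominus> (c i \<otimes> x k) \<oplus> (q i \<oplus> c i \<otimes> x k)" using qR[of i] cR[of i] xk by algebra
    then show "q i = (w k \<oplus>\<^bsub>vec R d\<^esub> q') i"
      using qR[of i] Suc.prems(3)[of i] qk by (auto simp: w_def q'_def)
  qed
  moreover have "syzygies {\<zero>} \<subseteq> carrier (vec R d)" unfolding syzygies_def by blast
  ultimately show ?case using V.ideal_smult_add[OF mR _ wk IH] by simp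
qed

text \<open>An element \<open>b\<close> of \<open>a \<subseteq> m^2\<close> has coefficients in
  \<open>m\<close>, and these form a syzygy modulo \<open>a\<close>. Multiplication by
  \<open>r\<close> in \<open>m\<close> puts the entries into \<open>m^2\<close>.\<close>

lemma lift_product:
  assumes a: "ideal a R" "a \<subseteq> ideal_prod R m m" and u: "u \<in> ideal_prod R m a"
  shows "\<exists>w\<in>ideal_smult R (vec R d) m (syzygies a).
           (\<forall>i<d. w i \<in> ideal_prod R m m) \<and> dot R d w x = u"
  using u
proof (induction rule: ideal_prod.induct)
  case (prod r b)
  interpret V: module R "vec R d" by (rule vec_module)
  have mR: "m \<subseteq> carrier R" using ideal_carrier[OF m_ideal] by blast
  have "b \<in> ideal_prod R m (lincombs R d x)" using prod a m_gen by auto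
  then obtain c0 where c0: "\<And>i. i < d \<Longrightarrow> c0 i \<in> m" "b = dot R d c0 x"
    using ideal_prod_lincombs[of m d x b, OF m_ideal x_carrier] by blast
  define c where "c = (\<lambda>i. if i < d then c0 i else \<zero>)"
  have c: "\<And>i. i < d \<Longrightarrow> c i \<in> m" "b = dot R d c x" "c \<in> carrier (vec R d)"
    using c0 mR by (auto simp: c_def cong: dot_cong)
  have "c \<in> syzygies a" using c prod by (auto simp: syzygies_def)
  then have "r \<odot>\<^bsub>vec R d\<^esub> c \<in> ideal_smult R (vec R d) m (syzygies a)"
    using prod mR by (intro V.ideal_smult_mem) (auto simp: syzygies_def)
  moreover have "\<forall>i<d. (r \<odot>\<^bsub>vec R d\<^esub> c) i \<in> ideal_prod R m m" using c prod by (auto intro: ideal_prod.prod)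
  moreover have "dot R d (r \<odot>\<^bsub>vec R d\<^esub> c) x = r \<otimes> b"
    using prod c mR x_carrier by (auto simp: dot_smult)
  ultimately show ?case by blast
next
  case (sum u v)
  interpret V: module R "vec R d" by (rule vec_module)
  have mm: "ideal (ideal_prod R m m) R" using m_ideal by (intro ideal_prod_is_ideal)
  have mR: "m \<subseteq> carrier R" using ideal_carrier[OF m_ideal] by blast
  have sV: "syzygies a \<subseteq> carrier (vec R d)" unfolding syzygies_def by blast
  from sum obtain w w' where w: "w\<in>ideal_smult R (vec R d) m (syzygies a)" "\<forall>i<d. w i \<in> ideal_prod R m m" "dot R d w x = u"
     "w'\<in>ideal_smult R (vec R d) m (syzygies a)" "\<forall>i<d. w' i \<in> ideal_prod R m m" "dot R d w' x = v" by blast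
  have "w \<oplus>\<^bsub>vec R d\<^esub> w' \<in> ideal_smult R (vec R d) m (syzygies a)"
    using w by (intro V.ideal_smult_add[OF mR sV])
  moreover have "\<forall>i<d. (w \<oplus>\<^bsub>vec R d\<^esub> w') i \<in> ideal_prod R m m" using w by (auto intro: ideal_add[OF mm])
  moreover have "dot R d (w \<oplus>\<^bsub>vec R d\<^esub> w') x = u \<oplus> v"
    using w x_carrier ideal_carrier[OF mm] by (simp add: dot_add)
  ultimately show ?case by blast
qed

text \<open>\<open>q\<close> and the lift \<open>w\<close> of its value differ by a genuine syzygy
  with entries in \<open>m^2\<close>, to which \<open>koszul\<close> applies.\<close>

lemma quadratic_syzygies:
  assumes a: "ideal a R" "a \<subseteq> ideal_prod R m m"
    and q: "q \<in> carrier (vec R d)" "\<And>i. i < d \<Longrightarrow> q i \<in> ideal_prod R m m" "dot R d q x \<in> ideal_prod R m a"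
  shows "q \<in> ideal_smult R (vec R d) m (syzygies a)"
proof -
  interpret V: module R "vec R d" by (rule vec_module)
  have mm: "ideal (ideal_prod R m m) R" using m_ideal by (intro ideal_prod_is_ideal)
  have mR: "m \<subseteq> carrier R" using ideal_carrier[OF m_ideal] by blast
  have sV: "syzygies a \<subseteq> carrier (vec R d)" unfolding syzygies_def by blast
  obtain w where w: "w\<in>ideal_smult R (vec R d) m (syzygies a)" "\<And>i. i<d \<Longrightarrow> w i \<in> ideal_prod R m m" "dot R d w x = dot R d q x"
    using lift_product[OF a q(3)] by blast
  have wV: "w \<in> carrier (vec R d)" using V.ideal_smult_carrier[OF mR sV w(1)] .
  define v where "v = (\<lambda>i. q i \<ominus> w i)"
  have qw: "q i \<in> carrier R" "w i \<in> carrier R" for i using vec_carrier[OF q(1)] vec_carrier[OF wV] by auto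
  have vV: "v \<in> carrier (vec R d)" using q(1) wV by (auto simp: v_def a_minus_def)
  have "dot R d v x = dot R d q x \<ominus> dot R d w x"
    unfolding v_def using qw x_carrier by (intro dot_diff)
  then have "dot R d v x = \<zero>"
    using qw x_carrier w(3) by (simp add: r_neg a_minus_def)
  then have "v \<in> ideal_smult R (vec R d) m (syzygies {\<zero>})"
    using vV q(2) w(2) ideal_minus[OF mm] by (intro koszul[where k=d]) (auto simp: v_def)
  moreover have "syzygies {\<zero>} \<subseteq> syzygies a" unfolding syzygies_def using ideal_zero[OF a(1)] by auto
  ultimately have v: "v \<in> ideal_smult R (vec R d) m (syzygies a)"
    using ideal_smult_mono[of m m] by blast
  have "q = v \<oplus>\<^bsub>vec R d\<^esub> w"
  proof
    fix i show "q i = (v \<oplus>\<^bsub>vec R d\<^esub> w) i" using qw[of i] unfolding v_def by (simp, algebra)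
  qed
  then show ?thesis using V.ideal_smult_add[OF mR sV v w(1)] by simp
qed

end

section \<open>Krull's intersection theorem\<close>

context noetherian_cring
begin

lemma ideal_acc:
  assumes "\<And>i::nat. ideal (A i) R" "\<And>i. A i \<subseteq> A (Suc i)"
  shows "\<exists>N. \<forall>i\<ge>N. A i = A N"
proof -
  obtain M where M: "M \<in> range A" "\<And>I. I \<in> range A \<Longrightarrow> M \<subseteq> I \<Longrightarrow> I = M"
    using maximal_ideal_in_family[of "A 0" "range A"] assms(1) by blast
  then obtain N where N: "M = A N" by blast
  have mono: "A N \<subseteq> A i" if "i \<ge> N" for i
    using that by (induction i rule: dec_induct) (use assms(2) in auto)
  have "A i = A N" if "i \<ge> N" for i using M(2)[of "A i"] mono[OF that] N by simp
  then show ?thesis by blast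
qed

text \<open>Among the ideals inside \<open>J\<close> with a power in \<open>I\<close>, a maximal one
  \<open>T\<close> absorbs every \<open>r\<close> in \<open>J\<close>: if \<open>T^a\<close> and
  \<open>r^b\<close> lie in \<open>I\<close>, then so does \<open>(T + (r))^(a+b)\<close>.\<close>

lemma nil_ideal_nilpotent:
  assumes I: "ideal I R" and J: "ideal J R" and pow: "\<And>r. r \<in> J \<Longrightarrow> \<exists>k::nat. r [^] k \<in> I"
  shows "\<exists>N. ideal_pow R J N \<subseteq> I"
proof -
  let ?S = "{T. ideal T R \<and> T \<subseteq> J \<and> (\<exists>N. ideal_pow R T N \<subseteq> I)}"
  have "ideal_pow R {\<zero>} (Suc 0) \<subseteq> I" using ideal_pow_1[OF zeroideal] ideal_zero[OF I] by auto
  then have "{\<zero>} \<in> ?S" using zeroideal ideal_zero[OF J] by auto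
  then obtain T where "T \<in> ?S" and max: "\<And>U. U \<in> ?S \<Longrightarrow> T \<subseteq> U \<Longrightarrow> U = T"
    using maximal_ideal_in_family[of "{\<zero>}" ?S] by blast
  then obtain a where T: "ideal T R" "T \<subseteq> J" "ideal_pow R T a \<subseteq> I" by blast
  have "J \<subseteq> T"
  proof
    fix r assume r: "r \<in> J"
    have rR: "r \<in> carrier R" using r ideal_carrier[OF J] by blast
    obtain b :: nat where b: "r [^] b \<in> I" using pow r by blast
    let ?U = "adjoin R T r"
    have U: "ideal ?U R" by (rule adjoin_ideal[OF T(1) rR])
    have Tp: "ideal (ideal_pow R T i) R" for i by (rule ideal_pow_ideal[OF T(1)])
    have Up: "ideal (ideal_pow R ?U i) R" for i by (rule ideal_pow_ideal[OF U])
    have ad: "ideal (adjoin R (ideal_pow R T i) (r [^] (j::nat))) R" for i j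
      using adjoin_ideal[OF Tp] rR by simp
    \<comment> \<open>Of \<open>i + j\<close> factors from \<open>T + (r)\<close>, either
      \<open>i\<close> contribute an element of \<open>T\<close> or \<open>j\<close> contribute a
      multiple of \<open>r\<close>. The induction splits off one factor \<open>t + c r\<close>,
      lowering \<open>i\<close> for the part \<open>t\<close> and \<open>j\<close> for the part
      \<open>c r\<close>.\<close>
    have "ideal_pow R ?U (i + j) \<subseteq> adjoin R (ideal_pow R T i) (r [^] (j::nat))" for i j
    proof (induction n \<equiv> "i + j" arbitrary: i j)
      case 0
      then show ?case using rR ideal_carrier[OF Tp] subset_adjoin[OF Tp, of "r [^] j" i]
        by (simp add: ideal_pow_0)
    next
      case (Suc n)
      show ?case
      proof (cases "i = 0 \<or> j = 0")
        case True
        then have "\<one> \<in> adjoin R (ideal_pow R T i) (r [^] j)"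
          using subset_adjoin[OF Tp, of "r [^] j" i] mem_adjoin[OF Tp, of "r [^] j" i] rR
          by (auto simp: ideal_pow_0)
        then have "adjoin R (ideal_pow R T i) (r [^] j) = carrier R"
          using ad ideal.one_imp_carrier by blast
        then show ?thesis using ideal_carrier[OF Up] by blast
      next
        case False
        then obtain i' j' where ij: "i = Suc i'" "j = Suc j'" by (metis not0_implies_Suc)
        then have n: "n = i' + j" "n = i + j'" using Suc by auto
        have "ideal_pow R ?U (i + j) = ideal_prod R ?U (ideal_pow R ?U n)"
          using Suc(2) ideal_pow_Suc'[OF U] by metis
        moreover have "ideal_prod R ?U (ideal_pow R ?U n) \<subseteq> adjoin R (ideal_pow R T i) (r [^] j)"
        proof
          fix u assume "u \<in> ideal_prod R ?U (ideal_pow R ?U n)"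
          then show "u \<in> adjoin R (ideal_pow R T i) (r [^] j)"
          proof induction
            case (prod v w)
            then obtain t c where tc: "t \<in> T" "c \<in> carrier R" "v = t \<oplus> c \<otimes> r" by (auto simp: adjoin_def)
            have tR: "t \<in> carrier R" using tc ideal_carrier[OF T(1)] by blast
            have wR: "w \<in> carrier R" using prod ideal_carrier[OF Up] by blast
            have "w \<in> adjoin R (ideal_pow R T i') (r [^] j)" using Suc(1)[OF n(1)] prod n by auto
            then obtain e f where ef: "e \<in> ideal_pow R T i'" "f \<in> carrier R" "w = e \<oplus> f \<otimes> r [^] j"
              by (auto simp: adjoin_def)
            have eR: "e \<in> carrier R" using ef ideal_carrier[OF Tp] by blast
            have "t \<otimes> w = t \<otimes> e \<oplus> (t \<otimes> f) \<otimes> r [^] j"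
              unfolding ef(3) using tR eR ef(2) rR by (simp add: r_distr m_assoc)
            moreover have "t \<otimes> e \<in> ideal_pow R T i" unfolding ij ideal_pow_Suc'[OF T(1)]
              using tc ef by (intro ideal_prod.prod)
            ultimately have 1: "t \<otimes> w \<in> adjoin R (ideal_pow R T i) (r [^] j)"
              using tR ef by (auto simp: adjoin_def)
            have "w \<in> adjoin R (ideal_pow R T i) (r [^] j')" using Suc(1)[OF n(2)] prod n by auto
            then obtain e f where ef: "e \<in> ideal_pow R T i" "f \<in> carrier R" "w = e \<oplus> f \<otimes> r [^] j'"
              by (auto simp: adjoin_def)
            have eR: "e \<in> carrier R" using ef ideal_carrier[OF Tp] by blast
            have "(c \<otimes> r) \<otimes> w = (c \<otimes> r) \<otimes> e \<oplus> (c \<otimes> f) \<otimes> r [^] j"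
              unfolding ef(3) ij using tc eR ef(2) rR by (simp add: r_distr m_ac)
            moreover have "(c \<otimes> r) \<otimes> e \<in> ideal_pow R T i" using ef rR tc by (intro ideal_lmult[OF Tp]) auto
            ultimately have 2: "(c \<otimes> r) \<otimes> w \<in> adjoin R (ideal_pow R T i) (r [^] j)"
              using tc ef by (auto simp: adjoin_def)
            have "v \<otimes> w = t \<otimes> w \<oplus> (c \<otimes> r) \<otimes> w" unfolding tc(3) using tR wR rR tc by (simp add: l_distr)
            then show ?case using ideal_add[OF ad 1 2] by simp
          next
            case (sum u v)
            then show ?case using ideal_add[OF ad] by blast
          qed
        qed
        ultimately show ?thesis by simp
      qed
    qed
    then have "ideal_pow R ?U (a + b) \<subseteq> adjoin R (ideal_pow R T a) (r [^] b)" .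
    also have "\<dots> \<subseteq> I" by (rule adjoin_minimal[OF I T(3) b])
    finally have "?U \<in> ?S" using U adjoin_minimal[OF J T(2) r] by blast
    then have "?U = T" using max subset_adjoin[OF T(1) rR] by blast
    then show "r \<in> T" using mem_adjoin[OF T(1) rR] by simp
  qed
  then have "T = J" using T by blast
  then show ?thesis using T by blast
qed

end

section \<open>The ascending chain condition for submodules, and the intersection theorem\<close>

definition submodule_acc :: "('a, 'r) ring_scheme \<Rightarrow> ('a, 'b, 'm) module_scheme \<Rightarrow> bool" where
  "submodule_acc R M \<longleftrightarrow> (\<forall>f :: nat \<Rightarrow> 'b set.
     (\<forall>i. submodule (f i) R M) \<and> (\<forall>i. f i \<subseteq> f (Suc i)) \<longrightarrow> (\<exists>N. \<forall>i\<ge>N. f i = f N))"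

lemma (in module) maximal_submodule_in_family:
  assumes acc: "submodule_acc R M" and "W \<in> S" "\<And>W. W \<in> S \<Longrightarrow> submodule W R M"
  obtains L where "L \<in> S" "W \<subseteq> L" "\<And>L'. L' \<in> S \<Longrightarrow> L \<subseteq> L' \<Longrightarrow> L' = L"
proof (rule ccontr)
  assume no: "\<not> thesis"
  have "\<exists>f. \<forall>i::nat. (f i \<in> S \<and> W \<subseteq> f i) \<and> f i \<subset> f (Suc i)"
  proof (rule dependent_nat_choice)
    show "\<exists>L. L \<in> S \<and> W \<subseteq> L" using assms by blast
    fix L and i :: nat assume "L \<in> S \<and> W \<subseteq> L"
    then show "\<exists>L'. (L' \<in> S \<and> W \<subseteq> L') \<and> L \<subset> L'"
      using no that by blast
  qed
  then obtain f :: "nat \<Rightarrow> _ set" where "\<forall>i. (f i \<in> S \<and> W \<subseteq> f i) \<and> f i \<subset> f (Suc i)" ..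
  then have f: "\<And>i. f i \<in> S" "\<And>i. f i \<subset> f (Suc i)" by simp_all
  have "\<forall>i. submodule (f i) R M" "\<forall>i. f i \<subseteq> f (Suc i)" using f assms(3) by auto
  then have "\<exists>N. \<forall>i\<ge>N. f i = f N" using acc unfolding submodule_acc_def by simp
  then obtain N where "\<forall>i\<ge>N. f i = f N" by blast
  then have "f (Suc N) = f N" by (meson le_SucI le_refl)
  then show False using f(2)[of N] by blast
qed

text \<open>Induction on the rank. The last coordinates form a chain of ideals \<open>A\<close>, the
  vectors with last coordinate zero a chain \<open>B\<close> of submodules of \<open>R^k\<close>;
  where both are stationary, so is the given chain.\<close>

lemma (in noetherian_cring) vec_submodule_acc: "submodule_acc R (vec R k)"
proof (induction k)
  case 0
  interpret V: module R "vec R 0" by (rule vec_module)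
  have W: "W = {\<lambda>_. \<zero>}" if "submodule W R (vec R 0)" for W
    using V.submodule_carrier[OF that] V.submodule_zero[OF that] by auto
  show ?case unfolding submodule_acc_def
  proof (intro allI impI, elim conjE)
    fix f assume f: "\<forall>i::nat. submodule (f i) R (vec R 0)"
    have "f i = {\<lambda>_. \<zero>}" for i using W f by blast
    then show "\<exists>N. \<forall>i\<ge>N. f i = f N" by simp
  qed
next
  case (Suc k)
  interpret V: module R "vec R (Suc k)" by (rule vec_module)
  interpret V0: module R "vec R k" by (rule vec_module)
  show ?case unfolding submodule_acc_def
  proof (intro allI impI, elim conjE)
    fix f assume f: "\<forall>i::nat. submodule (f i) R (vec R (Suc k))" and inc: "\<forall>i. f i \<subseteq> f (Suc i)"
    then have sm: "submodule (f i) R (vec R (Suc k))" for i by blast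
    note fc = V.submodule_carrier[OF sm] and fz = V.submodule_zero[OF sm]
      and fa = V.submodule_add[OF sm] and fs = V.submodule_smult[OF sm] and fm = V.submodule_minus[OF sm]
    have mono: "f i \<subseteq> f j" if "i \<le> j" for i j
      using that by (induction j rule: dec_induct) (use inc in auto)
    have vc: "v j \<in> carrier R" if "v \<in> f i" for v i j using vec_carrier fc that by blast
    define A where "A i = (\<lambda>v. v k) ` f i" for i
    define B where "B i = {v \<in> f i. v k = \<zero>}" for i
    have "ideal (A i) R" for i
    proof (rule ideal_criterion)
      show "A i \<subseteq> carrier R" using vc by (auto simp: A_def)
      show "\<zero> \<in> A i" unfolding A_def by (rule image_eqI[OF _ fz[of i]]) simp
    next
      fix u v assume "u \<in> A i" "v \<in> A i"
      then obtain u' v' where "u' \<in> f i" "u = u' k" "v' \<in> f i" "v = v' k" by (auto simp: A_def)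
      then show "u \<oplus> v \<in> A i" unfolding A_def by (intro image_eqI[OF _ fa[of u' i v']]) auto
    next
      fix u r assume r: "u \<in> A i" "r \<in> carrier R"
      then obtain u' where "u' \<in> f i" "u = u' k" by (auto simp: A_def)
      then show "r \<otimes> u \<in> A i" unfolding A_def using r by (intro image_eqI[OF _ fs[of u' i r]]) auto
    qed
    moreover have "A i \<subseteq> A (Suc i)" for i using inc by (auto simp: A_def)
    ultimately have "\<exists>N. \<forall>i\<ge>N. A i = A N" by (rule ideal_acc)
    then obtain N1 where N1: "\<And>i. i \<ge> N1 \<Longrightarrow> A i = A N1" by blast
    have "submodule (B i) R (vec R k)" for i
    proof (rule V0.submoduleI)
      show "B i \<subseteq> carrier (vec R k)" using fc[of _ i] by (auto simp: B_def le_Suc_eq) (metis le_eq_less_or_eq Suc_leI)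
      show "\<zero>\<^bsub>vec R k\<^esub> \<in> B i" using fz[of i] by (auto simp: B_def)
      show "\<And>u v. u \<in> B i \<Longrightarrow> v \<in> B i \<Longrightarrow> u \<oplus>\<^bsub>vec R k\<^esub> v \<in> B i" using fa[of _ i] by (auto simp: B_def)
      show sB: "\<And>r v. r \<in> carrier R \<Longrightarrow> v \<in> B i \<Longrightarrow> r \<odot>\<^bsub>vec R k\<^esub> v \<in> B i" using fs[of _ i] by (auto simp: B_def)
      fix v assume v: "v \<in> B i"
      then have "v \<in> carrier (vec R k)" using \<open>B i \<subseteq> carrier (vec R k)\<close> by blast
      then have "\<ominus>\<^bsub>vec R k\<^esub> v = (\<ominus> \<one>) \<odot>\<^bsub>vec R k\<^esub> v" by (simp only: V0.smult_l_minus V0.smult_one one_closed)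
      then show "\<ominus>\<^bsub>vec R k\<^esub> v \<in> B i" using sB[of "\<ominus> \<one>" v] v by simp
    qed
    moreover have "B i \<subseteq> B (Suc i)" for i using inc by (auto simp: B_def)
    ultimately have "\<exists>N. \<forall>i\<ge>N. B i = B N" using Suc.IH unfolding submodule_acc_def by simp
    then obtain N2 where N2: "\<And>i. i \<ge> N2 \<Longrightarrow> B i = B N2" by blast
    let ?N = "max N1 N2"
    have "f i \<subseteq> f ?N" if i: "i \<ge> ?N" for i
    proof
      fix v assume v: "v \<in> f i"
      have "A i = A ?N" using N1[of i] N1[of ?N] i by simp
      moreover have "v k \<in> A i" using v by (auto simp: A_def)
      ultimately obtain u where u: "u \<in> f ?N" "u k = v k" by (auto simp: A_def)
      have ui: "u \<in> f i" using u mono[OF i] by blast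
      have uv: "u j \<in> carrier R" "v j \<in> carrier R" for j using vc u v by blast+
      let ?w = "v \<oplus>\<^bsub>vec R (Suc k)\<^esub> (\<ominus> \<one>) \<odot>\<^bsub>vec R (Suc k)\<^esub> u"
      have "?w \<in> f i" using fa[OF v fs[OF ui]] by simp
      moreover have "?w k = \<zero>" using u uv by (simp add: l_minus r_neg)
      ultimately have "?w \<in> B i" by (simp add: B_def)
      then have "?w \<in> f ?N" using N2[of i] N2[of ?N] i by (auto simp: B_def)
      then have "u \<oplus>\<^bsub>vec R (Suc k)\<^esub> ?w \<in> f ?N" using fa u by blast
      moreover have "u \<oplus>\<^bsub>vec R (Suc k)\<^esub> ?w = v"
      proof
        fix j show "(u \<oplus>\<^bsub>vec R (Suc k)\<^esub> ?w) j = v j" using uv[of j] by (simp add: l_minus) algebra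
      qed
      ultimately show "v \<in> f ?N" by simp
    qed
    then show "\<exists>N. \<forall>i\<ge>N. f i = f N" using mono by blast
  qed
qed

text \<open>If \<open>r \<notin> W\<close>, let \<open>L \<supseteq> W\<close> be maximal among the submodules not containing \<open>r\<close>. Then
  \<open>y r \<in> L\<close> for \<open>y \<in> m\<close>, and from this some power of \<open>y\<close> maps \<open>M\<close> into \<open>L\<close>; hence so does
  some power of \<open>m\<close>.\<close>

theorem (in noetherian_local) krull_intersection:
  fixes M (structure)
  assumes M: "module R M" and acc: "submodule_acc R M" and W: "submodule W R M"
    and r: "r \<in> carrier M"
    and approx: "\<And>N. \<exists>w\<in>W. r \<ominus>\<^bsub>M\<^esub> w \<in> ideal_smult R M (ideal_pow R m N) (carrier M)"
  shows "r \<in> W"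
proof (rule ccontr)
  assume rW: "r \<notin> W"
  interpret M: module R M by (rule M)
  let ?S = "{L. submodule L R M \<and> r \<notin> L}"
  have "W \<in> ?S" using W rW by blast
  then obtain L where "L \<in> ?S" "W \<subseteq> L" and max: "\<And>L'. L' \<in> ?S \<Longrightarrow> L \<subseteq> L' \<Longrightarrow> L' = L"
    using M.maximal_submodule_in_family[OF acc, of W ?S] by blast
  then have L: "submodule L R M" "r \<notin> L" "W \<subseteq> L" by auto
  note Ls = M.submodule_simps[OF L(1)]
  \<comment> \<open>Maximality of \<open>L\<close> in usable form: the sum of \<open>L\<close> with
    a submodule not contained in it contains \<open>r\<close>.\<close>
  have ext: "\<exists>l\<in>L. \<exists>u\<in>U. r = l \<oplus>\<^bsub>M\<^esub> u" if U: "submodule U R M" "\<not> U \<subseteq> L" for U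
  proof -
    note Us = M.submodule_simps[OF U(1)]
    let ?L = "{l \<oplus>\<^bsub>M\<^esub> u | l u. l \<in> L \<and> u \<in> U}"
    have sub: "?L \<subseteq> carrier M" using Ls(1) Us(1) by auto
    have sm: "c \<odot>\<^bsub>M\<^esub> v \<in> ?L" if "c \<in> carrier R" "v \<in> ?L" for c v
    proof -
      obtain l u where "l \<in> L" "u \<in> U" "v = l \<oplus>\<^bsub>M\<^esub> u" using \<open>v \<in> ?L\<close> by blast
      then have "c \<odot>\<^bsub>M\<^esub> v = c \<odot>\<^bsub>M\<^esub> l \<oplus>\<^bsub>M\<^esub> c \<odot>\<^bsub>M\<^esub> u" using Ls(1) Us(1) that M.smult_r_distr by simp
      then show ?thesis using \<open>l \<in> L\<close> \<open>u \<in> U\<close> Ls(5) Us(5) that by blast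
    qed
    have "submodule ?L R M"
    proof (rule M.submoduleI[OF sub])
      have "\<zero>\<^bsub>M\<^esub> = \<zero>\<^bsub>M\<^esub> \<oplus>\<^bsub>M\<^esub> \<zero>\<^bsub>M\<^esub>" by simp
      then show "\<zero>\<^bsub>M\<^esub> \<in> ?L" using Ls(2) Us(2) by blast
      fix v assume v: "v \<in> ?L"
      then have "(\<ominus> \<one>) \<odot>\<^bsub>M\<^esub> v = \<ominus>\<^bsub>M\<^esub> v" using sub by (simp add: M.smult_l_minus subset_iff)
      then show "\<ominus>\<^bsub>M\<^esub> v \<in> ?L" using sm[of "\<ominus> \<one>" v] v by simp
    next
      fix v v' assume "v \<in> ?L" "v' \<in> ?L"
      then obtain l u l' u' where *: "l \<in> L" "u \<in> U" "v = l \<oplus>\<^bsub>M\<^esub> u" "l' \<in> L" "u' \<in> U" "v' = l' \<oplus>\<^bsub>M\<^esub> u'" by blast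
      then have "v \<oplus>\<^bsub>M\<^esub> v' = (l \<oplus>\<^bsub>M\<^esub> l') \<oplus>\<^bsub>M\<^esub> (u \<oplus>\<^bsub>M\<^esub> u')" using Ls(1) Us(1) by (simp add: M.a_ac)
      then show "v \<oplus>\<^bsub>M\<^esub> v' \<in> ?L" using * Ls(3) Us(3) by blast
    qed (rule sm)
    moreover have LL: "L \<subseteq> ?L"
    proof
      fix l assume "l \<in> L"
      then have "l = l \<oplus>\<^bsub>M\<^esub> \<zero>\<^bsub>M\<^esub>" using Ls(1) by simp
      then show "l \<in> ?L" using \<open>l \<in> L\<close> Us(2) by blast
    qed
    moreover have "?L \<noteq> L"
    proof
      assume "?L = L"
      moreover obtain u where u: "u \<in> U" "u \<notin> L" using U(2) by blast
      moreover have "u = \<zero>\<^bsub>M\<^esub> \<oplus>\<^bsub>M\<^esub> u" using u Us(1) by simp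
      ultimately show False using Ls(2) by blast
    qed
    ultimately have "r \<in> ?L" using max[of ?L] by blast
    then show ?thesis by blast
  qed
  have multiples: "submodule {c \<odot>\<^bsub>M\<^esub> (y \<odot>\<^bsub>M\<^esub> v) | v. v \<in> V} R M"
    if "c \<in> carrier R" "y \<in> carrier R" "submodule V R M" for c y V
  proof -
    note Vs = M.submodule_simps[OF that(3)]
    let ?V = "{c \<odot>\<^bsub>M\<^esub> (y \<odot>\<^bsub>M\<^esub> v) | v. v \<in> V}"
    have sub: "?V \<subseteq> carrier M" using that Vs(1) by auto
    have sm: "e \<odot>\<^bsub>M\<^esub> v \<in> ?V" if "e \<in> carrier R" "v \<in> ?V" for e v
    proof -
      obtain u where u: "u \<in> V" "v = c \<odot>\<^bsub>M\<^esub> (y \<odot>\<^bsub>M\<^esub> u)" using \<open>v \<in> ?V\<close> by blast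
      have "e \<odot>\<^bsub>M\<^esub> v = c \<odot>\<^bsub>M\<^esub> (y \<odot>\<^bsub>M\<^esub> (e \<odot>\<^bsub>M\<^esub> u))"
        using u that \<open>c \<in> carrier R\<close> \<open>y \<in> carrier R\<close> Vs(1)[of u]
        by (simp add: M.smult_assoc1[symmetric] m_ac)
      then show ?thesis using u Vs(5) that by blast
    qed
    show ?thesis
    proof (rule M.submoduleI[OF sub])
      have "\<zero>\<^bsub>M\<^esub> = c \<odot>\<^bsub>M\<^esub> (y \<odot>\<^bsub>M\<^esub> \<zero>\<^bsub>M\<^esub>)" using that by simp
      then show "\<zero>\<^bsub>M\<^esub> \<in> ?V" using Vs(2) by blast
      fix v assume v: "v \<in> ?V"
      then have "(\<ominus> \<one>) \<odot>\<^bsub>M\<^esub> v = \<ominus>\<^bsub>M\<^esub> v" using sub by (simp add: M.smult_l_minus subset_iff)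
      then show "\<ominus>\<^bsub>M\<^esub> v \<in> ?V" using sm[of "\<ominus> \<one>" v] v by simp
    next
      fix u v assume "u \<in> ?V" "v \<in> ?V"
      then obtain u' v' where *: "u' \<in> V" "v' \<in> V" "u = c \<odot>\<^bsub>M\<^esub> (y \<odot>\<^bsub>M\<^esub> u')" "v = c \<odot>\<^bsub>M\<^esub> (y \<odot>\<^bsub>M\<^esub> v')" by blast
      then have "u \<oplus>\<^bsub>M\<^esub> v = c \<odot>\<^bsub>M\<^esub> (y \<odot>\<^bsub>M\<^esub> (u' \<oplus>\<^bsub>M\<^esub> v'))"
        using Vs(1) that by (simp add: M.smult_r_distr)
      then show "u \<oplus>\<^bsub>M\<^esub> v \<in> ?V" using * Vs(3) by blast
    qed (rule sm)
  qed
  have mR: "m \<subseteq> carrier R" using ideal_carrier[OF m_ideal] by blast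
  have carrM: "submodule (carrier M) R M" by (rule M.submoduleI) auto
  \<comment> \<open>Otherwise \<open>r = l + c y r\<close> with \<open>l\<close> in
    \<open>L\<close>, and \<open>1 - c y\<close> is a unit because \<open>y\<close> is in
    \<open>m\<close>.\<close>
  have mr: "y \<odot>\<^bsub>M\<^esub> r \<in> L" if y: "y \<in> m" for y
  proof (rule ccontr)
    assume no: "y \<odot>\<^bsub>M\<^esub> r \<notin> L"
    have yR: "y \<in> carrier R" using y mR by blast
    let ?U = "{c \<odot>\<^bsub>M\<^esub> (y \<odot>\<^bsub>M\<^esub> r) | c. c \<in> carrier R}"
    have "submodule ?U R M"
    proof (rule M.submoduleI)
      show "?U \<subseteq> carrier M" using yR r by auto
      have "\<zero>\<^bsub>M\<^esub> = \<zero> \<odot>\<^bsub>M\<^esub> (y \<odot>\<^bsub>M\<^esub> r)" using yR r by simp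
      then show "\<zero>\<^bsub>M\<^esub> \<in> ?U" by blast
      fix u assume "u \<in> ?U"
      then obtain c where c: "c \<in> carrier R" "u = c \<odot>\<^bsub>M\<^esub> (y \<odot>\<^bsub>M\<^esub> r)" by blast
      then have "\<ominus>\<^bsub>M\<^esub> u = (\<ominus> c) \<odot>\<^bsub>M\<^esub> (y \<odot>\<^bsub>M\<^esub> r)" using yR r by (simp add: M.smult_l_minus)
      then show "\<ominus>\<^bsub>M\<^esub> u \<in> ?U" using c by blast
    next
      fix u v assume "u \<in> ?U" "v \<in> ?U"
      then obtain c e where c: "c \<in> carrier R" "u = c \<odot>\<^bsub>M\<^esub> (y \<odot>\<^bsub>M\<^esub> r)" "e \<in> carrier R" "v = e \<odot>\<^bsub>M\<^esub> (y \<odot>\<^bsub>M\<^esub> r)" by blast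
      then have "u \<oplus>\<^bsub>M\<^esub> v = (c \<oplus> e) \<odot>\<^bsub>M\<^esub> (y \<odot>\<^bsub>M\<^esub> r)" using yR r by (simp add: M.smult_l_distr)
      then show "u \<oplus>\<^bsub>M\<^esub> v \<in> ?U" using c by blast
    next
      fix e u assume e: "e \<in> carrier R" and "u \<in> ?U"
      then obtain c where c: "c \<in> carrier R" "u = c \<odot>\<^bsub>M\<^esub> (y \<odot>\<^bsub>M\<^esub> r)" by blast
      then have "e \<odot>\<^bsub>M\<^esub> u = (e \<otimes> c) \<odot>\<^bsub>M\<^esub> (y \<odot>\<^bsub>M\<^esub> r)" using yR r e by (simp add: M.smult_assoc1)
      then show "e \<odot>\<^bsub>M\<^esub> u \<in> ?U" using c e by blast
    qed
    moreover have "y \<odot>\<^bsub>M\<^esub> r = \<one> \<odot>\<^bsub>M\<^esub> (y \<odot>\<^bsub>M\<^esub> r)" using yR r by simp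
    then have "\<not> ?U \<subseteq> L" using no by blast
    ultimately obtain l c where lc: "l \<in> L" "c \<in> carrier R" "r = l \<oplus>\<^bsub>M\<^esub> c \<odot>\<^bsub>M\<^esub> (y \<odot>\<^bsub>M\<^esub> r)"
      using ext[of ?U] by blast
    let ?s = "\<one> \<ominus> c \<otimes> y"
    have "?s \<notin> m"
    proof
      assume "?s \<in> m"
      then have "?s \<oplus> c \<otimes> y \<in> m" using y lc ideal_add[OF m_ideal] ideal_lmult[OF m_ideal] by blast
      moreover have "?s \<oplus> c \<otimes> y = \<one>" using lc(2) yR by algebra
      ultimately show False using primeideal_one_notin[OF m_prime] by simp
    qed
    then obtain t where t: "t \<in> carrier R" "t \<otimes> ?s = \<one>" using unit_outside_m[of ?s] lc yR by auto
    define v where "v = c \<odot>\<^bsub>M\<^esub> (y \<odot>\<^bsub>M\<^esub> r)"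
    have vM: "v \<in> carrier M" using lc yR r by (simp add: v_def)
    have lM: "l \<in> carrier M" using lc Ls(1) by blast
    have rl: "r = l \<oplus>\<^bsub>M\<^esub> v" using lc(3) by (simp add: v_def)
    have "?s \<odot>\<^bsub>M\<^esub> r = r \<ominus>\<^bsub>M\<^esub> v"
      using lc yR r by (simp add: a_minus_def M.smult_l_distr M.smult_l_minus M.smult_assoc1 v_def)
    also have "\<dots> = l" using rl lM vM r by (metis M.add.inv_solve_right a_minus_def)
    finally have "t \<odot>\<^bsub>M\<^esub> (?s \<odot>\<^bsub>M\<^esub> r) \<in> L" using lc(1) Ls(5) t by simp
    moreover have "t \<odot>\<^bsub>M\<^esub> (?s \<odot>\<^bsub>M\<^esub> r) = r"
      using t r lc yR by (simp add: M.smult_assoc1[symmetric])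
    ultimately show False using L by simp
  qed
  have pow: "\<exists>k::nat. \<forall>v\<in>carrier M. (y [^] k) \<odot>\<^bsub>M\<^esub> v \<in> L" if y: "y \<in> m" for y
  proof -
    have yR: "y \<in> carrier R" using y mR by blast
    \<comment> \<open>The vectors killed by \<open>y^j\<close> modulo \<open>L\<close>. Where this
      chain is stationary, \<open>r = l + y^j v\<close> is impossible: \<open>y r\<close> in
      \<open>L\<close> gives \<open>y^(j+1) v\<close> in \<open>L\<close>, hence
      \<open>y^j v\<close> in \<open>L\<close>, and \<open>r\<close> would be in
      \<open>L\<close>.\<close>
    define E where "E j = {v \<in> carrier M. (y [^] (j::nat)) \<odot>\<^bsub>M\<^esub> v \<in> L}" for j
    have "submodule (E j) R M" for j
    proof (rule M.submoduleI)
      show "E j \<subseteq> carrier M" by (auto simp: E_def)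
      show "\<zero>\<^bsub>M\<^esub> \<in> E j" using Ls(2) yR by (simp add: E_def)
    next
      fix u v assume "u \<in> E j" "v \<in> E j"
      then show "u \<oplus>\<^bsub>M\<^esub> v \<in> E j" using Ls(3) yR by (simp add: E_def M.smult_r_distr)
    next
      fix c u assume c: "c \<in> carrier R" "u \<in> E j"
      then have "(y [^] j) \<odot>\<^bsub>M\<^esub> (c \<odot>\<^bsub>M\<^esub> u) = c \<odot>\<^bsub>M\<^esub> ((y [^] j) \<odot>\<^bsub>M\<^esub> u)"
        using yR by (simp add: E_def M.smult_assoc1[symmetric] m_comm)
      then show "c \<odot>\<^bsub>M\<^esub> u \<in> E j" using c Ls(5) by (simp add: E_def)
    next
      fix u assume "u \<in> E j"
      moreover from this have "(y [^] j) \<odot>\<^bsub>M\<^esub> (\<ominus>\<^bsub>M\<^esub> u) = (\<ominus> \<one>) \<odot>\<^bsub>M\<^esub> ((y [^] j) \<odot>\<^bsub>M\<^esub> u)"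
        using yR by (simp add: E_def M.smult_l_minus M.smult_r_minus)
      ultimately show "\<ominus>\<^bsub>M\<^esub> u \<in> E j" using Ls(5) by (simp add: E_def)
    qed
    moreover have Esuc: "E j \<subseteq> E (Suc j)" for j
    proof
      fix v assume v: "v \<in> E j"
      then have "(y [^] Suc j) \<odot>\<^bsub>M\<^esub> v = y \<odot>\<^bsub>M\<^esub> ((y [^] j) \<odot>\<^bsub>M\<^esub> v)"
        using yR by (simp add: E_def M.smult_assoc1[symmetric] m_comm)
      then show "v \<in> E (Suc j)" using v Ls(5) yR by (simp add: E_def)
    qed
    ultimately have "\<exists>N. \<forall>i\<ge>N. E i = E N"
      using acc unfolding submodule_acc_def by simp
    then obtain j where "\<forall>i\<ge>j. E i = E j" by blast
    then have j: "E (Suc j) = E j" by (meson le_SucI le_refl)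
    have "carrier M \<subseteq> E j"
    proof (rule ccontr)
      assume "\<not> carrier M \<subseteq> E j"
      let ?U = "{(y [^] j) \<odot>\<^bsub>M\<^esub> (\<one> \<odot>\<^bsub>M\<^esub> v) | v. v \<in> carrier M}"
      have "submodule ?U R M" using yR carrM by (intro multiples) auto
      moreover have "\<not> ?U \<subseteq> L" using \<open>\<not> carrier M \<subseteq> E j\<close> unfolding E_def by force
      ultimately have "\<exists>l\<in>L. \<exists>u\<in>?U. r = l \<oplus>\<^bsub>M\<^esub> u" by (rule ext)
      then obtain l v where v: "v \<in> carrier M" "l \<in> L" "r = l \<oplus>\<^bsub>M\<^esub> (y [^] j) \<odot>\<^bsub>M\<^esub> v" by force
      have lM: "l \<in> carrier M" using v Ls(1) by blast
      have "y \<odot>\<^bsub>M\<^esub> r = y \<odot>\<^bsub>M\<^esub> l \<oplus>\<^bsub>M\<^esub> (y [^] Suc j) \<odot>\<^bsub>M\<^esub> v"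
        unfolding v(3) using v(1) lM yR by (simp add: M.smult_r_distr M.smult_assoc1[symmetric] m_comm)
      then have "(y [^] Suc j) \<odot>\<^bsub>M\<^esub> v = y \<odot>\<^bsub>M\<^esub> r \<ominus>\<^bsub>M\<^esub> y \<odot>\<^bsub>M\<^esub> l"
        using v(1) lM yR r by (metis M.add.inv_solve_right' M.a_comm M.smult_closed a_minus_def nat_pow_closed M.minus_closed)
      then have "v \<in> E (Suc j)" using v(1) mr[OF y] Ls(4) Ls(5)[OF v(2) yR] by (simp add: E_def)
      then have "v \<in> E j" using j by blast
      then have "(y [^] j) \<odot>\<^bsub>M\<^esub> v \<in> L" by (simp add: E_def)
      then show False using v Ls(3) L by blast
    qed
    then show ?thesis by (auto simp: E_def)
  qed
  \<comment> \<open>The annihilator of \<open>M/L\<close>. It contains a power of each element of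
    \<open>m\<close>, hence a power of \<open>m\<close>; an approximation of that order puts
    \<open>r - w\<close>, and then \<open>r\<close>, into \<open>L\<close>.\<close>
  let ?I = "{c \<in> carrier R. \<forall>v\<in>carrier M. c \<odot>\<^bsub>M\<^esub> v \<in> L}"
  have "ideal ?I R"
  proof (rule ideal_criterion)
    show "\<zero> \<in> ?I" using Ls(2) by simp
    fix c e assume "c \<in> ?I" "e \<in> ?I"
    then show "c \<oplus> e \<in> ?I" using Ls(3) by (simp add: M.smult_l_distr)
  next
    fix c e assume "c \<in> ?I" "e \<in> carrier R"
    then show "e \<otimes> c \<in> ?I" using Ls(5) by (simp add: M.smult_assoc1)
  qed auto
  moreover have "\<exists>k::nat. y [^] k \<in> ?I" if "y \<in> m" for y
    using pow[OF that] that mR by (simp add: subset_iff)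
  ultimately obtain N where N: "ideal_pow R m N \<subseteq> ?I"
    using nil_ideal_nilpotent[of ?I m] m_ideal by blast
  obtain w where w: "w \<in> W" "r \<ominus>\<^bsub>M\<^esub> w \<in> ideal_smult R M (ideal_pow R m N) (carrier M)" using approx by blast
  have "v \<in> L" if "v \<in> ideal_smult R M (ideal_pow R m N) (carrier M)" for v
    using that by induction (use N Ls in auto)
  then have "r \<ominus>\<^bsub>M\<^esub> w \<oplus>\<^bsub>M\<^esub> w \<in> L" using w L Ls(3) by blast
  moreover have wM: "w \<in> carrier M" using w L Ls(1) by blast
  have "r \<ominus>\<^bsub>M\<^esub> w \<oplus>\<^bsub>M\<^esub> w = r" using r wM by (simp add: a_minus_def M.a_assoc M.l_neg)
  ultimately show False using L by simp
qed

lemma (in cring) vec_mem_ideal_smult: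
  assumes J: "ideal J R" and v: "v \<in> carrier (vec R k)" "\<And>i. i < k \<Longrightarrow> v i \<in> J"
  shows "v \<in> ideal_smult R (vec R k) J (carrier (vec R k))"
proof -
  have vR: "v i \<in> carrier R" for i using vec_carrier[OF v(1)] .
  have "(\<lambda>i. if i < j then v i else \<zero>) \<in> ideal_smult R (vec R k) J (carrier (vec R k))" if "j \<le> k" for j
    using that
  proof (induction j)
    case 0
    then show ?case using ideal_smult.zero[of "vec R k" R] by simp
  next
    case (Suc j)
    let ?e = "\<lambda>i. if i = j then \<one> else \<zero>"
    have "?e \<in> carrier (vec R k)" using Suc by auto
    then have "v j \<odot>\<^bsub>vec R k\<^esub> ?e \<oplus>\<^bsub>vec R k\<^esub> (\<lambda>i. if i < j then v i else \<zero>)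
      \<in> ideal_smult R (vec R k) J (carrier (vec R k))"
      using Suc v(2) by (intro ideal_smult.step) auto
    moreover have "v j \<odot>\<^bsub>vec R k\<^esub> ?e \<oplus>\<^bsub>vec R k\<^esub> (\<lambda>i. if i < j then v i else \<zero>) = (\<lambda>i. if i < Suc j then v i else \<zero>)"
      using vR by (auto simp: fun_eq_iff less_Suc_eq)
    ultimately show ?case by simp
  qed
  from this[of k] have "(\<lambda>i. if i < k then v i else \<zero>) \<in> ideal_smult R (vec R k) J (carrier (vec R k))" by simp
  moreover have "(\<lambda>i. if i < k then v i else \<zero>) = v" using v(1) by (auto simp: fun_eq_iff)
  ultimately show ?thesis by simp
qed

lemma (in cring) vec_minus:
  assumes "f \<in> carrier (vec R k)" "g \<in> carrier (vec R k)"
  shows "f \<ominus>\<^bsub>vec R k\<^esub> g = (\<lambda>i. f i \<ominus> g i)"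
proof -
  interpret V: module R "vec R k" by (rule vec_module)
  have "\<ominus>\<^bsub>vec R k\<^esub> g = (\<ominus> \<one>) \<odot>\<^bsub>vec R k\<^esub> g" using assms by (simp only: V.smult_l_minus V.smult_one one_closed)
  then show ?thesis using vec_carrier[OF assms(2)] by (simp add: a_minus_def l_minus)
qed

lemma (in noetherian_local) krull_intersection_vec:
  assumes W: "submodule W R (vec R k)" and r: "r \<in> carrier (vec R k)"
    and approx: "\<And>N. \<exists>w\<in>W. \<forall>i<k. r i \<ominus> w i \<in> ideal_pow R m N"
  shows "r \<in> W"
proof (rule krull_intersection[OF vec_module vec_submodule_acc W r])
  interpret V: module R "vec R k" by (rule vec_module)
  fix N
  obtain w where w: "w \<in> W" "\<forall>i<k. r i \<ominus> w i \<in> ideal_pow R m N" using approx by blast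
  have wV: "w \<in> carrier (vec R k)" using V.submodule_carrier[OF W] w by blast
  have "r \<ominus>\<^bsub>vec R k\<^esub> w \<in> carrier (vec R k)" using r wV V.minus_closed by blast
  then show "\<exists>w\<in>W. r \<ominus>\<^bsub>vec R k\<^esub> w \<in> ideal_smult R (vec R k) (ideal_pow R m N) (carrier (vec R k))"
    using w vec_minus[OF r wV] by (intro bexI[of _ w] vec_mem_ideal_smult ideal_pow_ideal[OF m_ideal]) auto
qed

text \<open>The case \<open>k = 1\<close>, with \<open>I\<close> regarded as a submodule of
  \<open>R^1\<close>.\<close>

lemma (in noetherian_local) krull_intersection_ideal:
  assumes I: "ideal I R" and r: "r \<in> carrier R"
    and approx: "\<And>N. r \<in> I <+>\<^bsub>R\<^esub> ideal_pow R m N"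
  shows "r \<in> I"
proof -
  interpret V: module R "vec R 1" by (rule vec_module)
  let ?v = "\<lambda>c i. if i = (0::nat) then c else \<zero>"
  let ?W = "{v \<in> carrier (vec R 1). v 0 \<in> I}"
  have "submodule ?W R (vec R 1)"
  proof (rule V.submoduleI)
    fix v assume v: "v \<in> ?W"
    then have "\<ominus>\<^bsub>vec R 1\<^esub> v = (\<ominus> \<one>) \<odot>\<^bsub>vec R 1\<^esub> v"
      by (simp only: V.smult_l_minus V.smult_one one_closed mem_Collect_eq)
    then show "\<ominus>\<^bsub>vec R 1\<^esub> v \<in> ?W" using v ideal_uminus[OF I] ideal_carrier[OF I] by (auto simp: l_minus)
  qed (use ideal_zero[OF I] ideal_add[OF I] ideal_lmult[OF I] in auto)
  then have "?v r \<in> ?W"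
  proof (rule krull_intersection_vec)
    show "?v r \<in> carrier (vec R 1)" using r by auto
    fix N
    obtain c e where c: "c \<in> I" "e \<in> ideal_pow R m N" "r = c \<oplus> e" using approx[of N] by (auto simp: mem_set_add)
    have "c \<in> carrier R" "e \<in> carrier R" using c ideal_carrier[OF I] ideal_carrier[OF ideal_pow_ideal[OF m_ideal]] by auto
    then have "r \<ominus> c = e" unfolding c(3) by algebra
    then show "\<exists>w\<in>?W. \<forall>i<1. ?v r i \<ominus> w i \<in> ideal_pow R m N"
      using c ideal_carrier[OF I] by (intro bexI[of _ "?v c"]) auto
  qed
  then show ?thesis by simp
qed

section \<open>Comparison of a local ring with a regular presentation\<close>

lemma (in cring) ideal_pow_2: "ideal I R \<Longrightarrow> ideal_pow R I 2 = ideal_prod R I I"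
  by (simp add: numeral_2_eq_2 ideal_pow_Suc[of R I "Suc 0"] ideal_pow_1)

text \<open>With \<open>Z\<close> the module of syzygies of \<open>x\<close> this is
  \<open>Z \<inter> m^2 R^d \<subseteq> m Z\<close>, the vanishing criterion with the complex
  \<open>R^d \<rightarrow> R\<close> in place of \<open>F\<close>.\<close>

definition quadratic_syzygies_split :: "('a, 'r) ring_scheme \<Rightarrow> 'a set \<Rightarrow> nat \<Rightarrow> (nat \<Rightarrow> 'a) \<Rightarrow> bool" where
  "quadratic_syzygies_split R m d x \<longleftrightarrow>
     (\<forall>r\<in>carrier (vec R d). (\<forall>i<d. r i \<in> ideal_pow R m 2) \<and> dot R d r x = \<zero>\<^bsub>R\<^esub> \<longrightarrow>
        r \<in> ideal_smult R (vec R d) m {z \<in> carrier (vec R d). dot R d z x = \<zero>\<^bsub>R\<^esub>})"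

text \<open>\<open>rel k r q\<close> says that \<open>r\<close> and \<open>q\<close> have the same image under the isomorphism
  \<open>R/m\<^sup>k \<cong> Q/(a + n\<^sup>k)\<close>.\<close>

locale comparison = R?: noetherian_local R m + Q: regular_system Q n d y
  for R (structure) and m and Q :: "('q, 's) ring_scheme" and n d y +
  fixes a :: "'q set" and x :: "nat \<Rightarrow> 'a" and rel :: "nat \<Rightarrow> 'a \<Rightarrow> 'q \<Rightarrow> bool"
  assumes a_ideal: "ideal a Q" and a_sub: "a \<subseteq> ideal_pow Q n 2"
    and rel_carrier: "rel k r q \<Longrightarrow> r \<in> carrier R \<and> q \<in> carrier Q"
    and rel_left: "r \<in> carrier R \<Longrightarrow> \<exists>q. rel k r q"
    and rel_right: "q \<in> carrier Q \<Longrightarrow> \<exists>r. rel k r q"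
    and rel_add: "rel k r q \<Longrightarrow> rel k r' q' \<Longrightarrow> rel k (r \<oplus> r') (q \<oplus>\<^bsub>Q\<^esub> q')"
    and rel_mult: "rel k r q \<Longrightarrow> rel k r' q' \<Longrightarrow> rel k (r \<otimes> r') (q \<otimes>\<^bsub>Q\<^esub> q')"
    and rel_uminus: "rel k r q \<Longrightarrow> rel k (\<ominus> r) (\<ominus>\<^bsub>Q\<^esub> q)"
    and rel_shift: "rel k r q \<Longrightarrow> s \<in> ideal_pow R m k \<Longrightarrow> rel k (r \<oplus> s) q"
    and rel_antimono: "rel k r q \<Longrightarrow> j \<le> k \<Longrightarrow> rel j r q"
    and rel_zero_iff: "rel k r q \<Longrightarrow> r \<in> ideal_pow R m k \<longleftrightarrow> q \<in> a <+>\<^bsub>Q\<^esub> ideal_pow Q n k"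
    and rel_x: "i < d \<Longrightarrow> rel k (x i) (y i)"
begin

lemmas mpow = ideal_pow_ideal[OF m_ideal]
lemmas npow = Q.ideal_pow_ideal[OF Q.m_ideal]

lemma mpow_1: "ideal_pow R m (Suc 0) = m"
  by (rule ideal_pow_1[OF m_ideal])

lemma npow_1: "ideal_pow Q n (Suc 0) = n"
  by (rule Q.ideal_pow_1[OF Q.m_ideal])

lemma npow_2: "ideal_pow Q n 2 = ideal_prod Q n n"
  by (rule Q.ideal_pow_2[OF Q.m_ideal])

lemma rel_minus: "rel k r q \<Longrightarrow> rel k r' q' \<Longrightarrow> rel k (r \<ominus> r') (q \<ominus>\<^bsub>Q\<^esub> q')"
  unfolding a_minus_def using rel_add rel_uminus by blast

lemma rel_zero: "rel k \<zero> \<zero>\<^bsub>Q\<^esub>"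
proof -
  obtain q where q: "rel k \<zero> q" using rel_left by blast
  then have "q \<in> carrier Q" using rel_carrier by blast
  then show ?thesis using rel_minus[OF q q] by (simp add: a_minus_def Q.r_neg r_neg)
qed

text \<open>An element of \<open>R\<close> related to \<open>e\<close> in \<open>n^k\<close> lies in
  \<open>m^k\<close>, so a change on the side of \<open>Q\<close> can be moved to \<open>R\<close>,
  where \<open>rel_shift\<close> absorbs it.\<close>

lemma rel_shift_right:
  assumes "rel k r q" "e \<in> ideal_pow Q n k"
  shows "rel k r (q \<ominus>\<^bsub>Q\<^esub> e)"
proof -
  have e: "e \<in> carrier Q" using ideal_carrier[OF npow assms(2)] .
  obtain s where s: "rel k s e" using rel_right e by blast
  have "s \<in> ideal_pow R m k"
    using rel_zero_iff[OF s] Q.set_add_right[OF a_ideal npow] assms by blast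
  moreover have "rel k (r \<ominus> s) (q \<ominus>\<^bsub>Q\<^esub> e)" using assms s by (intro rel_minus)
  ultimately have "rel k (r \<ominus> s \<oplus> s) (q \<ominus>\<^bsub>Q\<^esub> e)" by (rule rel_shift[rotated])
  moreover have "r \<ominus> s \<oplus> s = r"
    using assms s rel_carrier by (simp add: a_minus_def a_assoc l_neg)
  ultimately show ?thesis by simp
qed

lemma rel_dot:
  assumes "\<And>i. i < j \<Longrightarrow> rel k (c i) (e i)" "j \<le> d"
  shows "rel k (dot R j c x) (dot Q j e y)"
  using assms
proof (induction j)
  case (Suc j)
  have "rel k (c j \<otimes> x j) (e j \<otimes>\<^bsub>Q\<^esub> y j)" using Suc.prems by (intro rel_mult rel_x) auto
  then show ?case using Suc by (simp add: rel_add)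
qed (simp add: rel_zero)

text \<open>The relations in \<open>a\<close> are invisible up to degree 2, since
  \<open>a \<subseteq> n^2\<close>. Therefore membership in \<open>m\<close> and \<open>m^2\<close>
  can be tested in \<open>Q\<close> exactly, while higher powers correspond only up to
  \<open>a\<close>.\<close>

lemma a_plus_npow:
  assumes "k \<le> 2" shows "a <+>\<^bsub>Q\<^esub> ideal_pow Q n k = ideal_pow Q n k"
proof
  have "a \<subseteq> ideal_pow Q n k" using a_sub Q.ideal_pow_antimono[OF Q.m_ideal assms] by blast
  then show "a <+>\<^bsub>Q\<^esub> ideal_pow Q n k \<subseteq> ideal_pow Q n k"
    by (auto simp: Q.mem_set_add intro!: ideal_add[OF npow])
  show "ideal_pow Q n k \<subseteq> a <+>\<^bsub>Q\<^esub> ideal_pow Q n k" by (rule Q.set_add_right[OF a_ideal npow])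
qed

lemma rel_low_pow_iff:
  assumes "rel k r q" "j \<le> k" "j \<le> 2"
  shows "r \<in> ideal_pow R m j \<longleftrightarrow> q \<in> ideal_pow Q n j"
  using rel_zero_iff[OF rel_antimono[OF assms(1,2)]] a_plus_npow[OF assms(3)] by simp

lemma rel_m_iff:
  assumes "rel k r q" "1 \<le> k" shows "r \<in> m \<longleftrightarrow> q \<in> n"
  using rel_low_pow_iff[OF assms(1), of 1] assms(2) mpow_1 npow_1 by simp

lemma x_carrier: "i < d \<Longrightarrow> x i \<in> carrier R"
  using rel_x rel_carrier by blast

lemma x_in_m: "i < d \<Longrightarrow> x i \<in> m"
  using rel_m_iff[OF rel_x[of i 1]] Q.x_in_m by simp

text \<open>Expanding a partner of \<open>r\<close> in the parameters \<open>y\<close>, at precision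
  2, shows that \<open>x\<close> generates \<open>m\<close> modulo \<open>m^2\<close>; Nakayama's
  lemma does the rest.\<close>

lemma m_gen: "m = lincombs R d x"
proof
  have L: "ideal (lincombs R d x) R" using x_carrier by (rule lincombs_ideal)
  show "lincombs R d x \<subseteq> m" using x_in_m by (rule lincombs_minimal[OF m_ideal])
  have "m \<subseteq> lincombs R d x <+> ideal_prod R m m"
  proof
    fix r assume r: "r \<in> m"
    then have rR: "r \<in> carrier R" using ideal_carrier[OF m_ideal] by blast
    then obtain q where q: "rel 2 r q" using rel_left by blast
    then have "q \<in> n" using rel_m_iff r by auto
    then obtain e where e: "\<forall>i<d. e i \<in> carrier Q" "q = dot Q d e y" unfolding Q.m_gen by (auto simp: lincombs_def)
    have "\<forall>i. \<exists>c. i < d \<longrightarrow> rel 2 c (e i)" using e rel_right by blast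
    then obtain c where c: "\<And>i. i < d \<Longrightarrow> rel 2 (c i) (e i)" by metis
    have cR: "\<And>i. i < d \<Longrightarrow> c i \<in> carrier R" using c rel_carrier by blast
    have dR: "dot R d c x \<in> carrier R" using cR x_carrier by simp
    have "rel 2 (r \<ominus> dot R d c x) (q \<ominus>\<^bsub>Q\<^esub> q)" using rel_minus[OF q rel_dot[of d 2 c e]] c e by simp
    moreover have "q \<ominus>\<^bsub>Q\<^esub> q = \<zero>\<^bsub>Q\<^esub>" using q rel_carrier by (simp add: a_minus_def Q.r_neg)
    ultimately have "r \<ominus> dot R d c x \<in> ideal_pow R m 2"
      using rel_low_pow_iff[of 2 _ _ 2] ideal_zero[OF npow] by simp
    then have "r \<ominus> dot R d c x \<in> ideal_prod R m m" using ideal_pow_2[OF m_ideal] by simp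
    moreover have "dot R d c x \<in> lincombs R d x" using cR by (auto simp: lincombs_def)
    moreover have "r = dot R d c x \<oplus> (r \<ominus> dot R d c x)" using rR dR by algebra
    ultimately show "r \<in> lincombs R d x <+> ideal_prod R m m" by (auto simp: mem_set_add)
  qed
  then show "m \<subseteq> lincombs R d x" by (rule nakayama[OF m_ideal L])
qed

abbreviation syz where "syz \<equiv> {z \<in> carrier (vec R d). dot R d z x = \<zero>}"

text \<open>This turns approximate syzygies into exact ones: a value in \<open>m^(k+1)\<close> is
  cancelled by changing the entries by elements of \<open>m^k\<close>.\<close>

lemma mpow_Suc_dot:
  assumes "r \<in> ideal_pow R m (Suc k)"
  obtains c where "c \<in> carrier (vec R d)" "\<And>i. c i \<in> ideal_pow R m k" "r = dot R d c x"
proof -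
  have "r \<in> ideal_prod R (ideal_pow R m k) (lincombs R d x)"
    using assms m_gen by (simp add: ideal_pow_Suc)
  then obtain c where c: "\<And>i. i < d \<Longrightarrow> c i \<in> ideal_pow R m k" "r = dot R d c x"
    using ideal_prod_lincombs[of "ideal_pow R m k" d x r, OF mpow x_carrier] by blast
  show ?thesis
  proof (rule that[of "\<lambda>i. if i < d then c i else \<zero>"])
    show "r = dot R d (\<lambda>i. if i < d then c i else \<zero>) x" unfolding c(2) by (rule dot_cong) auto
  qed (use c ideal_zero[OF mpow] ideal_carrier[OF mpow] in auto)
qed

lemma npow_Suc_dot:
  assumes "q \<in> ideal_pow Q n (Suc k)"
  obtains c where "c \<in> carrier (vec Q d)" "\<And>i. c i \<in> ideal_pow Q n k" "q = dot Q d c y"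
proof -
  have "q \<in> ideal_prod Q (ideal_pow Q n k) (lincombs Q d y)"
    using assms Q.m_gen by (simp add: ideal_pow_Suc)
  then obtain c where c: "\<And>i. i < d \<Longrightarrow> c i \<in> ideal_pow Q n k" "q = dot Q d c y"
    using Q.ideal_prod_lincombs[of "ideal_pow Q n k" d y q, OF npow Q.x_carrier] by blast
  show ?thesis
  proof (rule that[of "\<lambda>i. if i < d then c i else \<zero>\<^bsub>Q\<^esub>"])
    show "q = dot Q d (\<lambda>i. if i < d then c i else \<zero>\<^bsub>Q\<^esub>) y" unfolding c(2) by (rule dot_cong) auto
  qed (use c ideal_zero[OF npow] ideal_carrier[OF npow] in auto)
qed

section \<open>Transfer of syzygies between the two rings\<close>

abbreviation msyz where "msyz \<equiv> ideal_smult R (vec R d) m syz"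

lemma msyz_submodule: "submodule msyz R (vec R d)"
proof -
  interpret V: module R "vec R d" by (rule vec_module)
  show ?thesis by (rule V.ideal_smult_submodule[OF m_ideal]) blast
qed

text \<open>One product \<open>\<nu> z\<close> at a time. A partner \<open>t\<close> of
  \<open>z\<close> has its value in \<open>m^k\<close>; subtracting \<open>\<mu>\<close> with
  entries in \<open>m^(k-1)\<close> makes it an exact syzygy \<open>u\<close>. The factor
  \<open>s\<close> in \<open>m\<close> brings the error \<open>s \<mu>\<close> back to degree
  \<open>k\<close>, so no precision is lost, however many products are added.\<close>

lemma transfer_to_R:
  assumes v: "v \<in> ideal_smult Q (vec Q d) n (Q.syzygies a)" and k: "1 \<le> k"
    and r: "r \<in> carrier (vec R d)" "\<And>i. i < d \<Longrightarrow> rel k (r i) (v i)"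
  shows "\<exists>w\<in>msyz. \<forall>i<d. r i \<ominus> w i \<in> ideal_pow R m k"
  using v r
proof (induction arbitrary: r)
  case zero
  have "r i \<ominus> \<zero> \<in> ideal_pow R m k" if "i < d" for i
    using rel_zero_iff[of k "r i" "\<zero>\<^bsub>Q\<^esub>"] zero that Q.set_add_right[OF a_ideal npow, of k] ideal_zero[OF npow, of k]
    by (auto simp: a_minus_def)
  then show ?case by (intro bexI[of _ "\<zero>\<^bsub>vec R d\<^esub>"]) (simp, rule ideal_smult.zero)
next
  case (step \<nu> z v)
  interpret V: module R "vec R d" by (rule vec_module)
  note W = V.submodule_simps[OF msyz_submodule]
  have \<nu>: "\<nu> \<in> carrier Q" using step ideal_carrier[OF Q.m_ideal] by blast
  have z: "z \<in> carrier (vec Q d)" "dot Q d z y \<in> a" using step by (auto simp: Q.syzygies_def)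
  obtain s where s: "rel k s \<nu>" using rel_right \<nu> by blast
  have sm: "s \<in> m" "s \<in> carrier R" using rel_m_iff[OF s k] step rel_carrier[OF s] by auto
  have "\<forall>i. \<exists>t. i < d \<longrightarrow> rel k t (z i)" using rel_right z by auto
  then obtain t0 where t0: "\<And>i. i < d \<Longrightarrow> rel k (t0 i) (z i)" by metis
  define t where "t = (\<lambda>i. if i < d then t0 i else \<zero>)"
  have t: "\<And>i. i < d \<Longrightarrow> rel k (t i) (z i)" "t \<in> carrier (vec R d)" using t0 rel_carrier by (auto simp: t_def)
  have "rel k (dot R d t x) (dot Q d z y)" using t by (intro rel_dot) auto
  then have "dot R d t x \<in> ideal_pow R m k"
    using rel_zero_iff z Q.set_add_left[OF a_ideal npow] by blast
  moreover obtain k' where k': "k = Suc k'" using k by (metis One_nat_def Suc_le_D)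
  ultimately obtain \<mu> where \<mu>: "\<mu> \<in> carrier (vec R d)" "\<And>i. \<mu> i \<in> ideal_pow R m k'" "dot R d t x = dot R d \<mu> x"
    using mpow_Suc_dot by metis
  have tR: "t i \<in> carrier R" "\<mu> i \<in> carrier R" "r i \<in> carrier R" for i
    using vec_carrier t(2) \<mu>(1) step.prems(1) by blast+
  define u where "u = (\<lambda>i. t i \<ominus> \<mu> i)"
  have uR: "u i \<in> carrier R" for i using tR by (simp add: u_def)
  have uV: "u \<in> carrier (vec R d)" using t(2) \<mu>(1) by (auto simp: u_def a_minus_def)
  have "dot R d u x = dot R d t x \<ominus> dot R d \<mu> x"
    unfolding u_def using tR x_carrier by (intro dot_diff)
  then have "dot R d u x = \<zero>"
    using \<mu>(3) tR x_carrier by (simp add: a_minus_def r_neg)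
  with uV have u: "u \<in> syz" by simp
  define r' where "r' = (\<lambda>i. r i \<ominus> s \<otimes> u i)"
  have r': "r' \<in> carrier (vec R d)"
    using step.prems(1) uR sm u by (auto simp: r'_def a_minus_def)
  have r'v: "rel k (r' i) (v i)" if i: "i < d" for i
  proof -
    have *: "rel k (r i \<ominus> s \<otimes> t i) ((\<nu> \<odot>\<^bsub>vec Q d\<^esub> z \<oplus>\<^bsub>vec Q d\<^esub> v) i \<ominus>\<^bsub>Q\<^esub> \<nu> \<otimes>\<^bsub>Q\<^esub> z i)"
      using rel_minus[OF step.prems(2)[OF i] rel_mult[OF s t(1)[OF i]]] .
    have zi: "z i \<in> carrier Q" using z i by auto
    have "Q.syzygies a \<subseteq> carrier (vec Q d)" by (auto simp: Q.syzygies_def)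
    then have "v \<in> carrier (vec Q d)"
      using module.ideal_smult_carrier[OF Q.vec_module _ _ step.hyps(3)] ideal_carrier[OF Q.m_ideal] by blast
    then have vi: "v i \<in> carrier Q" using i by auto
    have "\<nu> \<otimes>\<^bsub>Q\<^esub> z i \<oplus>\<^bsub>Q\<^esub> v i \<ominus>\<^bsub>Q\<^esub> \<nu> \<otimes>\<^bsub>Q\<^esub> z i = v i"
      using zi vi \<nu> by (simp add: a_minus_def Q.a_ac Q.r_neg Q.r_neg2)
    then have "rel k (r i \<ominus> s \<otimes> t i) (v i)" using * by simp
    moreover have "s \<otimes> \<mu> i \<in> ideal_pow R m k"
      unfolding k' ideal_pow_Suc'[OF m_ideal] using sm \<mu> by (intro ideal_prod.prod)
    ultimately have "rel k (r i \<ominus> s \<otimes> t i \<oplus> s \<otimes> \<mu> i) (v i)" by (rule rel_shift)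
    moreover have "r i \<ominus> s \<otimes> t i \<oplus> s \<otimes> \<mu> i = r' i"
      unfolding r'_def u_def using tR[of i] sm(2) by algebra
    ultimately show ?thesis by simp
  qed
  obtain w where w: "w \<in> msyz" "\<forall>i<d. r' i \<ominus> w i \<in> ideal_pow R m k" using step.IH[OF r' r'v] by blast
  have wR: "w i \<in> carrier R" for i using vec_carrier W(1) w by blast
  have "s \<odot>\<^bsub>vec R d\<^esub> u \<oplus>\<^bsub>vec R d\<^esub> w \<in> msyz" using sm u w by (intro ideal_smult.step)
  moreover have "r i \<ominus> (s \<odot>\<^bsub>vec R d\<^esub> u \<oplus>\<^bsub>vec R d\<^esub> w) i = r' i \<ominus> w i" for i
    unfolding r'_def vec_simps using tR[of i] sm(2) uR[of i] wR[of i] by algebra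
  ultimately show ?case using w by (intro bexI[of _ "s \<odot>\<^bsub>vec R d\<^esub> u \<oplus>\<^bsub>vec R d\<^esub> w"]) auto
qed

text \<open>Only the value of \<open>q\<close> is followed, so nothing has to be made exact. A
  partner of a syzygy has its value in \<open>a + n^k\<close>, and a factor in \<open>n\<close>
  moves it to \<open>n a + n^k\<close>; in the base case this factor is \<open>y i\<close>.\<close>

lemma transfer_to_Q:
  assumes v: "v \<in> msyz" and k: "1 \<le> k"
    and q: "q \<in> carrier (vec Q d)" "\<And>i. i < d \<Longrightarrow> rel k (v i) (q i)"
  shows "dot Q d q y \<in> ideal_prod Q n a <+>\<^bsub>Q\<^esub> ideal_pow Q n k"
  using v q
proof (induction arbitrary: q)
  case zero
  let ?I = "ideal_prod Q n a <+>\<^bsub>Q\<^esub> ideal_pow Q n k"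
  have na: "ideal (ideal_prod Q n a) Q" by (rule Q.ideal_prod_is_ideal[OF Q.m_ideal a_ideal])
  have I: "ideal ?I Q" by (rule Q.add_ideals[OF na npow])
  show ?case
  proof (rule Q.dot_mem_ideal[OF I])
    fix i assume i: "i < d"
    then have "q i \<in> a <+>\<^bsub>Q\<^esub> ideal_pow Q n k" using rel_zero_iff zero ideal_zero[OF mpow] by fastforce
    then obtain b e where b: "b \<in> a" "e \<in> ideal_pow Q n k" "q i = b \<oplus>\<^bsub>Q\<^esub> e" by (auto simp: Q.mem_set_add)
    have c: "b \<in> carrier Q" "e \<in> carrier Q" "y i \<in> carrier Q" "y i \<in> n"
      using b ideal_carrier[OF a_ideal] ideal_carrier[OF npow] Q.x_carrier Q.x_in_m i by auto
    have "q i \<otimes>\<^bsub>Q\<^esub> y i = y i \<otimes>\<^bsub>Q\<^esub> b \<oplus>\<^bsub>Q\<^esub> y i \<otimes>\<^bsub>Q\<^esub> e"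
      unfolding b(3) using c by (simp add: Q.r_distr Q.m_comm[of _ "y i"])
    moreover have "y i \<otimes>\<^bsub>Q\<^esub> b \<in> ideal_prod Q n a" using b c by (intro ideal_prod.prod)
    moreover have "y i \<otimes>\<^bsub>Q\<^esub> e \<in> ideal_pow Q n k" using b c ideal_lmult[OF npow] by blast
    ultimately show "q i \<otimes>\<^bsub>Q\<^esub> y i \<in> ?I" unfolding Q.mem_set_add by blast
  qed
next
  case (step s z v)
  let ?I = "ideal_prod Q n a <+>\<^bsub>Q\<^esub> ideal_pow Q n k"
  have na: "ideal (ideal_prod Q n a) Q" by (rule Q.ideal_prod_is_ideal[OF Q.m_ideal a_ideal])
  have I: "ideal ?I Q" by (rule Q.add_ideals[OF na npow])
  have sR: "s \<in> carrier R" using step ideal_carrier[OF m_ideal] by blast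
  then obtain \<sigma> where \<sigma>: "rel k s \<sigma>" using rel_left by blast
  then have \<sigma>n: "\<sigma> \<in> n" "\<sigma> \<in> carrier Q" using rel_m_iff[OF \<sigma> k] step rel_carrier by auto
  have "\<forall>i. \<exists>t. i < d \<longrightarrow> rel k (z i) t" using rel_left step(2) by auto
  then obtain \<zeta> where \<zeta>: "\<And>i. i < d \<Longrightarrow> rel k (z i) (\<zeta> i)" by metis
  have \<zeta>Q: "\<And>i. i < d \<Longrightarrow> \<zeta> i \<in> carrier Q" using \<zeta> rel_carrier by blast
  have "rel k (dot R d z x) (dot Q d \<zeta> y)" using \<zeta> by (intro rel_dot) auto
  then have "dot Q d \<zeta> y \<in> a <+>\<^bsub>Q\<^esub> ideal_pow Q n k"
    using rel_zero_iff step(2) ideal_zero[OF mpow] by fastforce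
  then obtain b e where b: "b \<in> a" "e \<in> ideal_pow Q n k" "dot Q d \<zeta> y = b \<oplus>\<^bsub>Q\<^esub> e" by (auto simp: Q.mem_set_add)
  have c: "b \<in> carrier Q" "e \<in> carrier Q" using b ideal_carrier[OF a_ideal] ideal_carrier[OF npow] by auto
  have "\<sigma> \<otimes>\<^bsub>Q\<^esub> dot Q d \<zeta> y = \<sigma> \<otimes>\<^bsub>Q\<^esub> b \<oplus>\<^bsub>Q\<^esub> \<sigma> \<otimes>\<^bsub>Q\<^esub> e" unfolding b(3) using c \<sigma>n by (simp add: Q.r_distr)
  moreover have "\<sigma> \<otimes>\<^bsub>Q\<^esub> b \<in> ideal_prod Q n a" using b \<sigma>n by (intro ideal_prod.prod)
  moreover have "\<sigma> \<otimes>\<^bsub>Q\<^esub> e \<in> ideal_pow Q n k" using b \<sigma>n ideal_lmult[OF npow] by blast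
  ultimately have 1: "\<sigma> \<otimes>\<^bsub>Q\<^esub> dot Q d \<zeta> y \<in> ?I" unfolding Q.mem_set_add by blast
  define q' where "q' = (\<lambda>i. if i < d then q i \<ominus>\<^bsub>Q\<^esub> \<sigma> \<otimes>\<^bsub>Q\<^esub> \<zeta> i else \<zero>\<^bsub>Q\<^esub>)"
  have q'V: "q' \<in> carrier (vec Q d)" using step.prems(1) \<sigma>n \<zeta>Q by (auto simp: q'_def)
  have "rel k (v i) (q' i)" if i: "i < d" for i
  proof -
    have *: "rel k ((s \<odot>\<^bsub>vec R d\<^esub> z \<oplus>\<^bsub>vec R d\<^esub> v) i \<ominus> s \<otimes> z i) (q' i)"
      unfolding q'_def using rel_minus[OF step.prems(2)[OF i] rel_mult[OF \<sigma> \<zeta>[OF i]]] i by simp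
    have zi: "z i \<in> carrier R" using step(2) i by auto
    interpret V: module R "vec R d" by (rule vec_module)
    have vi: "v i \<in> carrier R" using V.submodule_carrier[OF msyz_submodule step.hyps(3)] i by auto
    have "s \<otimes> z i \<oplus> v i \<ominus> s \<otimes> z i = v i"
      using zi vi sR by (simp add: a_minus_def a_ac r_neg r_neg2)
    then show ?thesis using * by simp
  qed
  then have 2: "dot Q d q' y \<in> ?I" by (intro step.IH[OF q'V])
  have "dot Q d q y = dot Q d (\<lambda>i. \<sigma> \<otimes>\<^bsub>Q\<^esub> \<zeta> i \<oplus>\<^bsub>Q\<^esub> q' i) y"
    using \<sigma>n \<zeta>Q step.prems(1)
    by (intro dot_cong) (auto simp: q'_def a_minus_def Q.a_ac Q.r_neg2 Q.r_neg)
  also have "\<dots> = \<sigma> \<otimes>\<^bsub>Q\<^esub> dot Q d \<zeta> y \<oplus>\<^bsub>Q\<^esub> dot Q d q' y"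
    using \<sigma>n \<zeta>Q q'V Q.x_carrier by (simp add: Q.dot_add Q.dot_smult)
  finally show ?case using ideal_add[OF I 1 2] by simp
qed

lemma split_if_cubic_relations_trivial:
  assumes cubic: "a \<inter> ideal_pow Q n 3 \<subseteq> ideal_prod Q n a"
  shows "quadratic_syzygies_split R m d x"
  unfolding quadratic_syzygies_split_def
proof (intro ballI impI, elim conjE)
  fix r assume r: "r \<in> carrier (vec R d)" "\<forall>i<d. r i \<in> ideal_pow R m 2" "dot R d r x = \<zero>"
  show "r \<in> msyz"
  proof (rule krull_intersection_vec[OF msyz_submodule r(1)])
    fix N
    \<comment> \<open>The lift has precision \<open>?k + 1\<close>, because cancelling the error
      \<open>e\<close> of its value costs one degree; and \<open>?k \<ge> 2\<close> keeps the
      corrected entries in \<open>n^2\<close>.\<close>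
    let ?k = "Suc (Suc N)"
    have "\<forall>i. \<exists>q. i < d \<longrightarrow> rel (Suc ?k) (r i) q" using rel_left r(1) by auto
    then obtain q0 where q0: "\<And>i. i < d \<Longrightarrow> rel (Suc ?k) (r i) (q0 i)" by metis
    define q where "q = (\<lambda>i. if i < d then q0 i else \<zero>\<^bsub>Q\<^esub>)"
    have q: "\<And>i. i < d \<Longrightarrow> rel (Suc ?k) (r i) (q i)" "q \<in> carrier (vec Q d)"
      using q0 rel_carrier by (auto simp: q_def)
    have q2: "q i \<in> ideal_pow Q n 2" if "i < d" for i
      using rel_low_pow_iff[OF q(1)[OF that], of 2] r(2) that by simp
    have "rel (Suc ?k) (dot R d r x) (dot Q d q y)" using q by (intro rel_dot) auto
    then have "dot Q d q y \<in> a <+>\<^bsub>Q\<^esub> ideal_pow Q n (Suc ?k)"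
      using rel_zero_iff[of "Suc ?k" "dot R d r x"] r(3) ideal_zero[OF mpow] by auto
    then obtain \<alpha> e where \<alpha>: "\<alpha> \<in> a" "e \<in> ideal_pow Q n (Suc ?k)" "dot Q d q y = \<alpha> \<oplus>\<^bsub>Q\<^esub> e"
      by (auto simp: Q.mem_set_add)
    obtain \<epsilon> where \<epsilon>: "\<epsilon> \<in> carrier (vec Q d)" "\<And>i. \<epsilon> i \<in> ideal_pow Q n ?k" "e = dot Q d \<epsilon> y"
      using npow_Suc_dot[OF \<alpha>(2)] by blast
    define q' where "q' = (\<lambda>i. q i \<ominus>\<^bsub>Q\<^esub> \<epsilon> i)"
    have qQ: "q i \<in> carrier Q" "\<epsilon> i \<in> carrier Q" for i using Q.vec_carrier q(2) \<epsilon>(1) by blast+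
    have q'V: "q' \<in> carrier (vec Q d)" using q(2) \<epsilon>(1) by (auto simp: q'_def a_minus_def)
    have "\<epsilon> i \<in> ideal_pow Q n 2" for i
      using \<epsilon>(2)[of i] Q.ideal_pow_antimono[OF Q.m_ideal, of 2 ?k] by auto
    then have q'2: "q' i \<in> ideal_prod Q n n" if "i < d" for i
      using q2[OF that] ideal_minus[OF npow] unfolding npow_2[symmetric] q'_def by blast
    have \<alpha>Q: "\<alpha> \<in> carrier Q" using \<alpha> ideal_carrier[OF a_ideal] by blast
    have eQ: "e \<in> carrier Q" using \<alpha> ideal_carrier[OF npow] by blast
    have "dot Q d q' y = dot Q d q y \<ominus>\<^bsub>Q\<^esub> e"
      unfolding q'_def \<epsilon>(3) using qQ Q.x_carrier by (intro Q.dot_diff)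
    also have "\<dots> = \<alpha>" unfolding \<alpha>(3) using \<alpha>Q eQ by (simp add: a_minus_def Q.a_assoc Q.r_neg)
    finally have dq': "dot Q d q' y = \<alpha>" .
    have "dot Q d q' y \<in> ideal_prod Q (ideal_pow Q n 2) n"
      using q'2 Q.x_in_m unfolding npow_2
      by (intro Q.dot_mem_ideal_prod Q.ideal_prod_is_ideal Q.m_ideal) auto
    then have "\<alpha> \<in> ideal_pow Q n 3" unfolding dq' by (simp add: numeral_3_eq_3 numeral_2_eq_2 ideal_pow_Suc)
    then have "dot Q d q' y \<in> ideal_prod Q n a" using \<alpha>(1) cubic dq' by blast
    then have sy: "q' \<in> ideal_smult Q (vec Q d) n (Q.syzygies a)"
      using q'V q'2 a_ideal a_sub npow_2 by (intro Q.quadratic_syzygies) auto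
    have "rel ?k (r i) (q' i)" if "i < d" for i
      unfolding q'_def using rel_antimono[OF q(1)[OF that], of ?k] \<epsilon>(2) by (intro rel_shift_right) auto
    then have "\<exists>w\<in>msyz. \<forall>i<d. r i \<ominus> w i \<in> ideal_pow R m ?k" using r(1) by (intro transfer_to_R[OF sy]) auto
    moreover have "ideal_pow R m ?k \<subseteq> ideal_pow R m N" by (rule ideal_pow_antimono[OF m_ideal]) simp
    ultimately show "\<exists>w\<in>msyz. \<forall>i<d. r i \<ominus> w i \<in> ideal_pow R m N" by blast
  qed
qed

lemma cubic_relations_trivial_if_split:
  assumes split: "quadratic_syzygies_split R m d x"
  shows "a \<inter> ideal_pow Q n 3 \<subseteq> ideal_prod Q n a"
proof
  fix f assume "f \<in> a \<inter> ideal_pow Q n 3"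
  then have f: "f \<in> a" "f \<in> ideal_pow Q n (Suc 2)" by (auto simp: numeral_3_eq_3 numeral_2_eq_2)
  have na: "ideal (ideal_prod Q n a) Q" by (rule Q.ideal_prod_is_ideal[OF Q.m_ideal a_ideal])
  have fQ: "f \<in> carrier Q" using f ideal_carrier[OF a_ideal] by blast
  obtain q where q: "q \<in> carrier (vec Q d)" "\<And>i. q i \<in> ideal_pow Q n 2" "f = dot Q d q y"
    using npow_Suc_dot[OF f(2)] by blast
  show "f \<in> ideal_prod Q n a"
  proof (rule Q.krull_intersection_ideal[OF na fQ])
    fix N
    \<comment> \<open>The same precision for the passage to \<open>R\<close>: the correction
      \<open>\<mu>\<close> has entries in the power \<open>?k\<close>, hence in \<open>m^2\<close>,
      so that the exact syzygy \<open>v\<close> stays quadratic.\<close>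
    let ?k = "Suc (Suc N)"
    have "\<forall>i. \<exists>r. i < d \<longrightarrow> rel (Suc ?k) r (q i)" using rel_right q(1) by auto
    then obtain r0 where r0: "\<And>i. i < d \<Longrightarrow> rel (Suc ?k) (r0 i) (q i)" by metis
    define r where "r = (\<lambda>i. if i < d then r0 i else \<zero>)"
    have r: "\<And>i. i < d \<Longrightarrow> rel (Suc ?k) (r i) (q i)" "r \<in> carrier (vec R d)"
      using r0 rel_carrier by (auto simp: r_def)
    have r2: "r i \<in> ideal_pow R m 2" if "i < d" for i
      using rel_low_pow_iff[OF r(1)[OF that], of 2] q(2) by simp
    have "rel (Suc ?k) (dot R d r x) f" unfolding q(3) using r by (intro rel_dot) auto
    then have "dot R d r x \<in> ideal_pow R m (Suc ?k)"
      using rel_zero_iff f(1) Q.set_add_left[OF a_ideal npow] by blast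
    then obtain \<mu> where \<mu>: "\<mu> \<in> carrier (vec R d)" "\<And>i. \<mu> i \<in> ideal_pow R m ?k" "dot R d r x = dot R d \<mu> x"
      using mpow_Suc_dot by metis
    have rR: "r i \<in> carrier R" "\<mu> i \<in> carrier R" for i using vec_carrier r(2) \<mu>(1) by blast+
    define v where "v = (\<lambda>i. r i \<ominus> \<mu> i)"
    have "v \<in> carrier (vec R d)" using r(2) \<mu>(1) by (auto simp: v_def a_minus_def)
    moreover have "\<mu> i \<in> ideal_pow R m 2" for i
      using \<mu>(2)[of i] ideal_pow_antimono[OF m_ideal, of 2 ?k] by auto
    then have "\<forall>i<d. v i \<in> ideal_pow R m 2" unfolding v_def using r2 ideal_minus[OF mpow] by blast
    moreover have "dot R d v x = dot R d r x \<ominus> dot R d \<mu> x"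
      unfolding v_def using rR x_carrier by (intro dot_diff)
    then have "dot R d v x = \<zero>"
      using rR x_carrier \<mu>(3) by (simp add: a_minus_def r_neg)
    ultimately have "v \<in> msyz" using split unfolding quadratic_syzygies_split_def by blast
    moreover have "rel ?k (v i) (q i)" if "i < d" for i
      unfolding v_def a_minus_def
      using rel_antimono[OF r(1)[OF that], of ?k] \<mu>(2) ideal_uminus[OF mpow] by (intro rel_shift) auto
    ultimately have "f \<in> ideal_prod Q n a <+>\<^bsub>Q\<^esub> ideal_pow Q n ?k"
      unfolding q(3) using q(1) by (intro transfer_to_Q) auto
    moreover have "ideal_pow Q n ?k \<subseteq> ideal_pow Q n N" by (rule Q.ideal_pow_antimono[OF Q.m_ideal]) simp
    ultimately show "f \<in> ideal_prod Q n a <+>\<^bsub>Q\<^esub> ideal_pow Q n N" by (auto simp: Q.mem_set_add)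
  qed
qed

end

section \<open>The comparison given by a Cohen presentation\<close>

definition eq_mod :: "('a, 'r) ring_scheme \<Rightarrow> 'a set \<Rightarrow> 'a \<Rightarrow> 'a \<Rightarrow> bool" where
  "eq_mod R I x y \<longleftrightarrow> x \<in> carrier R \<and> y \<in> carrier R \<and> x \<ominus>\<^bsub>R\<^esub> y \<in> I"

context cring
begin

context
  fixes I assumes I: "ideal I R"
begin

lemma eq_mod_refl: "x \<in> carrier R \<Longrightarrow> eq_mod R I x x"
  using ideal_zero[OF I] by (simp add: eq_mod_def a_minus_def r_neg)

lemma eq_mod_sym: "eq_mod R I x y \<Longrightarrow> eq_mod R I y x"
  using ideal_uminus[OF I, of "x \<ominus> y"] unfolding eq_mod_def
  by (auto simp: a_minus_def minus_add minus_minus a_comm)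

lemma eq_mod_trans:
  assumes "eq_mod R I x y" "eq_mod R I y z" shows "eq_mod R I x z"
proof -
  have c: "x \<in> carrier R" "y \<in> carrier R" "z \<in> carrier R" using assms by (auto simp: eq_mod_def)
  have "x \<ominus> z = (x \<ominus> y) \<oplus> (y \<ominus> z)" using c by algebra
  then show ?thesis using assms ideal_add[OF I] unfolding eq_mod_def by simp
qed

lemma eq_mod_add:
  assumes "eq_mod R I x y" "eq_mod R I x' y'" shows "eq_mod R I (x \<oplus> x') (y \<oplus> y')"
proof -
  have c: "x \<in> carrier R" "y \<in> carrier R" "x' \<in> carrier R" "y' \<in> carrier R"
    using assms by (auto simp: eq_mod_def)
  have "x \<oplus> x' \<ominus> (y \<oplus> y') = (x \<ominus> y) \<oplus> (x' \<ominus> y')" using c by algebra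
  then show ?thesis using assms ideal_add[OF I] unfolding eq_mod_def by simp
qed

lemma eq_mod_mult:
  assumes "eq_mod R I x y" "eq_mod R I x' y'" shows "eq_mod R I (x \<otimes> x') (y \<otimes> y')"
proof -
  have c: "x \<in> carrier R" "y \<in> carrier R" "x' \<in> carrier R" "y' \<in> carrier R"
    using assms by (auto simp: eq_mod_def)
  have "x \<otimes> x' \<ominus> y \<otimes> y' = x \<otimes> (x' \<ominus> y') \<oplus> y' \<otimes> (x \<ominus> y)" using c by algebra
  then show ?thesis using assms ideal_add[OF I] ideal_lmult[OF I] unfolding eq_mod_def by simp
qed

lemma eq_mod_uminus:
  assumes "eq_mod R I x y" shows "eq_mod R I (\<ominus> x) (\<ominus> y)"
proof -
  have c: "x \<in> carrier R" "y \<in> carrier R" using assms by (auto simp: eq_mod_def)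
  have "\<ominus> x \<ominus> \<ominus> y = \<ominus> (x \<ominus> y)" using c by algebra
  then show ?thesis using assms ideal_uminus[OF I] unfolding eq_mod_def by simp
qed

lemma eq_mod_mem_iff:
  assumes "eq_mod R I x y" shows "x \<in> I \<longleftrightarrow> y \<in> I"
proof -
  have c: "x \<in> carrier R" "y \<in> carrier R" "x \<ominus> y \<in> I" using assms by (auto simp: eq_mod_def)
  have "x = (x \<ominus> y) \<oplus> y" "y = x \<ominus> (x \<ominus> y)" using c(1,2) by algebra+
  then show ?thesis using c(3) ideal_add[OF I] ideal_minus[OF I] by metis
qed

lemma eq_mod_zero_iff: "x \<in> carrier R \<Longrightarrow> eq_mod R I x \<zero> \<longleftrightarrow> x \<in> I"
  by (simp add: eq_mod_def a_minus_def)

lemma eq_mod_shift: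
  assumes "eq_mod R I x y" "s \<in> I" shows "eq_mod R I (x \<oplus> s) y"
proof -
  have "s \<in> carrier R" using assms ideal_carrier[OF I] by blast
  then have "eq_mod R I s \<zero>" using assms eq_mod_zero_iff by simp
  then have "eq_mod R I (x \<oplus> s) (y \<oplus> \<zero>)" using assms by (intro eq_mod_add)
  then show ?thesis using assms by (auto simp: eq_mod_def)
qed

lemma eq_mod_dot:
  assumes "\<And>i. i < k \<Longrightarrow> eq_mod R I (c i) (c' i)" "\<And>i. i < k \<Longrightarrow> eq_mod R I (g i) (g' i)"
  shows "eq_mod R I (dot R k c g) (dot R k c' g')"
  using assms by (induction k) (auto intro!: eq_mod_add eq_mod_mult eq_mod_refl)

lemma coset_eq_iff:
  "x \<in> carrier R \<Longrightarrow> y \<in> carrier R \<Longrightarrow> I +> x = I +> y \<longleftrightarrow> eq_mod R I x y"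
  using quotient_eq_iff_same_a_r_cos[OF I] by (auto simp: eq_mod_def)

lemma Quot_carrier: "carrier (R Quot I) = {I +> x | x. x \<in> carrier R}"
  by (auto simp: FactRing_def A_RCOSETS_def')

lemma Quot_add: "x \<in> carrier R \<Longrightarrow> y \<in> carrier R \<Longrightarrow> (I +> x) \<oplus>\<^bsub>R Quot I\<^esub> (I +> y) = I +> (x \<oplus> y)"
  using ideal.a_rcos_sum[OF I] by (simp add: FactRing_def)

lemma Quot_mult: "x \<in> carrier R \<Longrightarrow> y \<in> carrier R \<Longrightarrow> (I +> x) \<otimes>\<^bsub>R Quot I\<^esub> (I +> y) = I +> (x \<otimes> y)"
  using ideal.rcoset_mult_add[OF I] by (simp add: FactRing_def)

lemma Quot_one: "\<one>\<^bsub>R Quot I\<^esub> = I +> \<one>"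
  by (simp add: FactRing_def)

end

lemma set_add_coset:
  assumes I: "ideal I R" and J: "ideal J R" "J \<subseteq> I" and x: "x \<in> carrier R"
  shows "I <+>\<^bsub>R\<^esub> (J +> x) = I +> x"
proof
  show "I <+>\<^bsub>R\<^esub> (J +> x) \<subseteq> I +> x"
  proof
    fix u assume "u \<in> I <+>\<^bsub>R\<^esub> (J +> x)"
    then obtain i j where ij: "i \<in> I" "j \<in> J" "u = i \<oplus> (j \<oplus> x)"
      by (auto simp: mem_set_add a_r_coset_def')
    then have "u = (i \<oplus> j) \<oplus> x" "i \<oplus> j \<in> I"
      using ideal_carrier[OF I] J x ideal_add[OF I] by (auto simp: a_assoc subset_iff)
    then show "u \<in> I +> x" by (auto simp: a_r_coset_def')
  qed
  show "I +> x \<subseteq> I <+>\<^bsub>R\<^esub> (J +> x)"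
  proof
    fix u assume "u \<in> I +> x"
    then obtain i where i: "i \<in> I" "u = i \<oplus> x" by (auto simp: a_r_coset_def')
    have "x = \<zero> \<oplus> x" using x by simp
    then have "x \<in> J +> x" using ideal_zero[OF J(1)] by (auto simp: a_r_coset_def')
    then show "u \<in> I <+>\<^bsub>R\<^esub> (J +> x)" using i by (auto simp: mem_set_add)
  qed
qed

lemma ideal_pow_add:
  assumes I: "ideal I R"
  shows "ideal_pow R I (j + k) = ideal_prod R (ideal_pow R I j) (ideal_pow R I k)"
proof (induction k)
  case 0
  then show ?case using ideal_pow_ideal[OF I] by (simp add: ideal_pow_0 ideal_prod_one)
next
  case (Suc k)
  then show ?case using ideal_pow_ideal[OF I] I by (simp add: ideal_pow_Suc ideal_prod_assoc)
qed

end

text \<open>Sequences of representatives of an element of the completion: \<open>t k\<close> stands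
  for a class modulo the \<open>k\<close>-th power. Only consecutive terms are compared here;
  \<open>cauchy_eq_mod\<close> gives the rest.\<close>

definition adic_cauchy :: "('a, 'r) ring_scheme \<Rightarrow> 'a set \<Rightarrow> (nat \<Rightarrow> 'a) \<Rightarrow> bool" where
  "adic_cauchy R m t \<longleftrightarrow> (\<forall>k. eq_mod R (ideal_pow R m k) (t (Suc k)) (t k))"

lemma (in cring) completion_carrier:
  assumes m: "ideal m R"
  shows "carrier (completion R m) = {(\<lambda>k. ideal_pow R m k +> t k) | t. adic_cauchy R m t}"
proof -
  note id = ideal_pow_ideal[OF m]
  have coh: "ideal_pow R m k <+> (ideal_pow R m (Suc k) +> r) = ideal_pow R m k +> r" if "r \<in> carrier R" for k r
    using set_add_coset[OF id id ideal_pow_Suc_subset[OF m] that] .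
  show ?thesis
  proof (intro equalityI subsetI)
    fix c assume "c \<in> carrier (completion R m)"
    then have c: "\<And>k. c k \<in> carrier (R Quot ideal_pow R m k)" "\<And>k. ideal_pow R m k <+> c (Suc k) = c k"
      by (auto simp: completion_def)
    have "\<forall>k. \<exists>r. r \<in> carrier R \<and> c k = ideal_pow R m k +> r"
      using c(1) by (auto simp: Quot_carrier[OF id])
    then obtain t where t: "\<And>k. t k \<in> carrier R" "\<And>k. c k = ideal_pow R m k +> t k" by metis
    have "ideal_pow R m k +> t (Suc k) = ideal_pow R m k +> t k" for k
      using c(2)[of k] coh[OF t(1), of k "Suc k"] unfolding t(2) by simp
    then have "adic_cauchy R m t" using t(1) coset_eq_iff[OF id] by (simp add: adic_cauchy_def)
    then show "c \<in> {(\<lambda>k. ideal_pow R m k +> t k) | t. adic_cauchy R m t}" using t(2) by auto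
  next
    fix c assume "c \<in> {(\<lambda>k. ideal_pow R m k +> t k) | t. adic_cauchy R m t}"
    then obtain t where t: "adic_cauchy R m t" "c = (\<lambda>k. ideal_pow R m k +> t k)" by blast
    have tR: "t k \<in> carrier R" for k using t(1) by (auto simp: adic_cauchy_def eq_mod_def)
    have "ideal_pow R m k <+> c (Suc k) = c k" for k
      unfolding t(2) using coh[OF tR] t(1) coset_eq_iff[OF id tR tR] by (simp add: adic_cauchy_def)
    moreover have "c k \<in> carrier (R Quot ideal_pow R m k)" for k
      unfolding t(2) Quot_carrier[OF id] using tR by blast
    ultimately show "c \<in> carrier (completion R m)" by (simp add: completion_def)
  qed
qed

text \<open>\<open>\<tau> q k\<close> represents the image of \<open>q\<close> in \<open>R/m\<^sup>k\<close>.\<close>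

locale completion_map = R?: noetherian_local R m + Q: noetherian_local Q n
  for R (structure) and m and Q :: "('q, 's) ring_scheme" and n +
  fixes a :: "'q set" and \<tau> :: "'q \<Rightarrow> nat \<Rightarrow> 'a"
  assumes a_ideal: "ideal a Q" and a_sub: "a \<subseteq> ideal_pow Q n 2"
    and tau_cauchy: "q \<in> carrier Q \<Longrightarrow> adic_cauchy R m (\<tau> q)"
    and tau_add: "p \<in> carrier Q \<Longrightarrow> q \<in> carrier Q \<Longrightarrow>
          eq_mod R (ideal_pow R m k) (\<tau> (p \<oplus>\<^bsub>Q\<^esub> q) k) (\<tau> p k \<oplus> \<tau> q k)"
    and tau_mult: "p \<in> carrier Q \<Longrightarrow> q \<in> carrier Q \<Longrightarrow>
          eq_mod R (ideal_pow R m k) (\<tau> (p \<otimes>\<^bsub>Q\<^esub> q) k) (\<tau> p k \<otimes> \<tau> q k)"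
    and tau_one: "eq_mod R (ideal_pow R m k) (\<tau> \<one>\<^bsub>Q\<^esub> k) \<one>"
    and tau_surj: "adic_cauchy R m t \<Longrightarrow>
          \<exists>q\<in>carrier Q. \<forall>k. eq_mod R (ideal_pow R m k) (\<tau> q k) (t k)"
    and tau_ker: "q \<in> carrier Q \<Longrightarrow> (\<forall>k. \<tau> q k \<in> ideal_pow R m k) \<longleftrightarrow> q \<in> a"

text \<open>\<open>\<tau> q\<close> is a choice of representatives for the element of the completion
  that corresponds to \<open>q + a\<close>. Because it is a choice, \<open>\<tau>\<close> respects
  the operations only up to congruence in each entry.\<close>

lemma completion_map_exists:
  assumes R: "noetherian_local R m" and Q: "noetherian_local Q n"
    and a: "ideal a Q" "a \<subseteq> ideal_pow Q n 2" and iso: "completion R m \<simeq> Q Quot a"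
  shows "\<exists>\<tau>. completion_map R m Q n a \<tau>"
proof -
  interpret R: noetherian_local R m by (rule R)
  interpret Q: noetherian_local Q n by (rule Q)
  let ?C = "completion R m"
  note id = R.ideal_pow_ideal[OF R.m_ideal]
  define cls where "cls t = (\<lambda>k. ideal_pow R m k +>\<^bsub>R\<^esub> t k)" for t
  have C: "carrier ?C = {cls t | t. adic_cauchy R m t}"
    unfolding cls_def by (rule R.completion_carrier[OF R.m_ideal])
  obtain h where h: "h \<in> ring_iso ?C (Q Quot a)" using iso by (auto simp: is_ring_iso_def)
  then have bij: "bij_betw h (carrier ?C) (carrier (Q Quot a))"
    and hom: "h \<in> ring_hom ?C (Q Quot a)" by (auto simp: ring_iso_def)
  have cR: "t k \<in> carrier R" if "adic_cauchy R m t" for t k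
    using that by (auto simp: adic_cauchy_def eq_mod_def)
  have cls_inj: "eq_mod R (ideal_pow R m k) (t k) (t' k)"
    if "adic_cauchy R m t" "adic_cauchy R m t'" "cls t = cls t'" for t t' k
    using that(3) R.coset_eq_iff[OF id cR[OF that(1)] cR[OF that(2)]] unfolding cls_def by metis
  have cls_eq: "cls t = cls t'"
    if "adic_cauchy R m t" "adic_cauchy R m t'" "\<And>k. eq_mod R (ideal_pow R m k) (t k) (t' k)" for t t'
  proof
    fix k show "cls t k = cls t' k"
      using that(3)[of k] R.coset_eq_iff[OF id cR[OF that(1)] cR[OF that(2)]] unfolding cls_def by blast
  qed
  have "\<forall>q. \<exists>t. q \<in> carrier Q \<longrightarrow> adic_cauchy R m t \<and> h (cls t) = a +>\<^bsub>Q\<^esub> q"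
  proof
    fix q
    have "a +>\<^bsub>Q\<^esub> q \<in> carrier (Q Quot a)" if "q \<in> carrier Q" using Q.Quot_carrier[OF a(1)] that by blast
    then show "\<exists>t. q \<in> carrier Q \<longrightarrow> adic_cauchy R m t \<and> h (cls t) = a +>\<^bsub>Q\<^esub> q"
      using bij C unfolding bij_betw_def by (smt (verit, best) image_iff mem_Collect_eq)
  qed
  then obtain \<tau> where \<tau>: "\<And>q. q \<in> carrier Q \<Longrightarrow> adic_cauchy R m (\<tau> q)"
      "\<And>q. q \<in> carrier Q \<Longrightarrow> h (cls (\<tau> q)) = a +>\<^bsub>Q\<^esub> q" by metis
  have clsC: "cls t \<in> carrier ?C" if "adic_cauchy R m t" for t using that C by blast
  have unique: "eq_mod R (ideal_pow R m k) (\<tau> q k) (t k)"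
    if "q \<in> carrier Q" "adic_cauchy R m t" "h (cls t) = a +>\<^bsub>Q\<^esub> q" for q t k
  proof -
    have "cls (\<tau> q) = cls t"
      using bij \<tau>[OF that(1)] that clsC unfolding bij_betw_def inj_on_def by metis
    then show ?thesis using cls_inj \<tau> that by blast
  qed
  have add: "adic_cauchy R m (\<lambda>k. t k \<oplus>\<^bsub>R\<^esub> t' k)" "cls (\<lambda>k. t k \<oplus>\<^bsub>R\<^esub> t' k) = cls t \<oplus>\<^bsub>?C\<^esub> cls t'"
    and mult: "adic_cauchy R m (\<lambda>k. t k \<otimes>\<^bsub>R\<^esub> t' k)" "cls (\<lambda>k. t k \<otimes>\<^bsub>R\<^esub> t' k) = cls t \<otimes>\<^bsub>?C\<^esub> cls t'"
    if t: "adic_cauchy R m t" "adic_cauchy R m t'" for t t'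
  proof -
    show "adic_cauchy R m (\<lambda>k. t k \<oplus>\<^bsub>R\<^esub> t' k)" "adic_cauchy R m (\<lambda>k. t k \<otimes>\<^bsub>R\<^esub> t' k)"
      using t unfolding adic_cauchy_def by (auto intro: R.eq_mod_add[OF id] R.eq_mod_mult[OF id])
    show "cls (\<lambda>k. t k \<oplus>\<^bsub>R\<^esub> t' k) = cls t \<oplus>\<^bsub>?C\<^esub> cls t'" "cls (\<lambda>k. t k \<otimes>\<^bsub>R\<^esub> t' k) = cls t \<otimes>\<^bsub>?C\<^esub> cls t'"
      using cR t by (simp_all add: cls_def completion_def R.Quot_add[OF id] R.Quot_mult[OF id])
  qed
  have const: "adic_cauchy R m (\<lambda>_. r)" if "r \<in> carrier R" for r
    using that R.eq_mod_refl[OF id] by (simp add: adic_cauchy_def)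
  have "completion_map_axioms R m Q n a \<tau>"
  proof (rule completion_map_axioms.intro[OF a])
    fix q assume "q \<in> carrier Q" then show "adic_cauchy R m (\<tau> q)" by (rule \<tau>)
  next
    fix p q k assume pq: "p \<in> carrier Q" "q \<in> carrier Q"
    have "h (cls (\<lambda>k. \<tau> p k \<oplus>\<^bsub>R\<^esub> \<tau> q k)) = a +>\<^bsub>Q\<^esub> (p \<oplus>\<^bsub>Q\<^esub> q)"
      using ring_hom_add[OF hom clsC clsC, of "\<tau> p" "\<tau> q"] pq \<tau> add Q.Quot_add[OF a(1)] by simp
    then show "eq_mod R (ideal_pow R m k) (\<tau> (p \<oplus>\<^bsub>Q\<^esub> q) k) (\<tau> p k \<oplus>\<^bsub>R\<^esub> \<tau> q k)"
      using pq \<tau> add(1) unique[of "p \<oplus>\<^bsub>Q\<^esub> q" "\<lambda>k. \<tau> p k \<oplus>\<^bsub>R\<^esub> \<tau> q k" k] by simp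
    have "h (cls (\<lambda>k. \<tau> p k \<otimes>\<^bsub>R\<^esub> \<tau> q k)) = a +>\<^bsub>Q\<^esub> (p \<otimes>\<^bsub>Q\<^esub> q)"
      using ring_hom_mult[OF hom clsC clsC, of "\<tau> p" "\<tau> q"] pq \<tau> mult Q.Quot_mult[OF a(1)] by simp
    then show "eq_mod R (ideal_pow R m k) (\<tau> (p \<otimes>\<^bsub>Q\<^esub> q) k) (\<tau> p k \<otimes>\<^bsub>R\<^esub> \<tau> q k)"
      using pq \<tau> mult(1) unique[of "p \<otimes>\<^bsub>Q\<^esub> q" "\<lambda>k. \<tau> p k \<otimes>\<^bsub>R\<^esub> \<tau> q k" k] by simp
  next
    fix k
    have "cls (\<lambda>_. \<one>\<^bsub>R\<^esub>) = \<one>\<^bsub>?C\<^esub>" by (simp add: cls_def completion_def R.Quot_one[OF id])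
    then have "h (cls (\<lambda>_. \<one>\<^bsub>R\<^esub>)) = a +>\<^bsub>Q\<^esub> \<one>\<^bsub>Q\<^esub>"
      using ring_hom_one[OF hom] Q.Quot_one[OF a(1)] by simp
    then show "eq_mod R (ideal_pow R m k) (\<tau> \<one>\<^bsub>Q\<^esub> k) \<one>\<^bsub>R\<^esub>"
      using unique[of "\<one>\<^bsub>Q\<^esub>" "\<lambda>_. \<one>\<^bsub>R\<^esub>" k] const by simp
  next
    fix t assume t: "adic_cauchy R m t"
    then have "h (cls t) \<in> carrier (Q Quot a)" using hom clsC ring_hom_closed by metis
    then obtain q where "q \<in> carrier Q" "h (cls t) = a +>\<^bsub>Q\<^esub> q" using Q.Quot_carrier[OF a(1)] by blast
    then show "\<exists>q\<in>carrier Q. \<forall>k. eq_mod R (ideal_pow R m k) (\<tau> q k) (t k)" using unique t by blast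
  next
    fix q assume q: "q \<in> carrier Q"
    let ?z = "\<lambda>_::nat. \<zero>\<^bsub>R\<^esub>"
    have z: "adic_cauchy R m ?z" using const by simp
    then have "h (cls ?z) \<in> carrier (Q Quot a)" using hom clsC ring_hom_closed by metis
    then obtain p where p: "p \<in> carrier Q" "h (cls ?z) = a +>\<^bsub>Q\<^esub> p" using Q.Quot_carrier[OF a(1)] by blast
    \<comment> \<open>That the zero sequence goes to zero is derived from \<open>0 + 0 = 0\<close>
      alone, without showing that the completion is a ring: \<open>p - (p + p)\<close> lies in
      \<open>a\<close>, hence \<open>p\<close> does.\<close>
    have "h (cls ?z) = h (cls ?z) \<oplus>\<^bsub>Q Quot a\<^esub> h (cls ?z)"
      using ring_hom_add[OF hom clsC[OF z] clsC[OF z]] add(2)[OF z z] by simp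
    then have "eq_mod Q a p (p \<oplus>\<^bsub>Q\<^esub> p)" using p Q.Quot_add[OF a(1)] Q.coset_eq_iff[OF a(1)] by simp
    then have "p \<ominus>\<^bsub>Q\<^esub> (p \<oplus>\<^bsub>Q\<^esub> p) \<in> a" by (simp add: eq_mod_def)
    moreover have "p \<ominus>\<^bsub>Q\<^esub> (p \<oplus>\<^bsub>Q\<^esub> p) = \<ominus>\<^bsub>Q\<^esub> p" using p(1) by (simp add: a_minus_def Q.minus_add Q.r_neg2)
    ultimately have pa: "p \<in> a" using ideal_uminus[OF a(1), of "\<ominus>\<^bsub>Q\<^esub> p"] p(1) by simp
    have pz: "eq_mod Q a p \<zero>\<^bsub>Q\<^esub>" using pa p Q.eq_mod_zero_iff[OF a(1)] by simp
    show "(\<forall>k. \<tau> q k \<in> ideal_pow R m k) \<longleftrightarrow> q \<in> a"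
    proof
      assume "\<forall>k. \<tau> q k \<in> ideal_pow R m k"
      then have "\<And>k. eq_mod R (ideal_pow R m k) (\<tau> q k) \<zero>\<^bsub>R\<^esub>"
        using R.eq_mod_zero_iff[OF id] cR[OF \<tau>(1)[OF q]] by simp
      then have "cls (\<tau> q) = cls ?z" by (rule cls_eq[OF \<tau>(1)[OF q] z])
      then have "a +>\<^bsub>Q\<^esub> q = a +>\<^bsub>Q\<^esub> p" using \<tau>(2)[OF q] p by simp
      then have "eq_mod Q a q p" using Q.coset_eq_iff[OF a(1) q p(1)] by simp
      then show "q \<in> a" using Q.eq_mod_mem_iff[OF a(1)] pa by blast
    next
      assume "q \<in> a"
      then have "eq_mod Q a q \<zero>\<^bsub>Q\<^esub>" using q Q.eq_mod_zero_iff[OF a(1)] by simp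
      then have "eq_mod Q a p q" using pz Q.eq_mod_trans[OF a(1)] Q.eq_mod_sym[OF a(1)] by blast
      then have "h (cls ?z) = a +>\<^bsub>Q\<^esub> q" using p Q.coset_eq_iff[OF a(1) p(1) q] by simp
      then show "\<forall>k. \<tau> q k \<in> ideal_pow R m k"
        using unique[OF q z] R.eq_mod_mem_iff[OF id] ideal_zero[OF id] by blast
    qed
  qed
  then show ?thesis using R Q completion_map.intro by blast
qed

section \<open>Image and kernel of the maps from \<open>Q\<close> to the quotients by powers of
  \<open>m\<close>\<close>

context completion_map
begin

lemmas mpow = ideal_pow_ideal[OF m_ideal]
lemmas npow = Q.ideal_pow_ideal[OF Q.m_ideal]

lemma npow_1: "ideal_pow Q n (Suc 0) = n"
  by (rule Q.ideal_pow_1[OF Q.m_ideal])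

lemma tau_carrier: "q \<in> carrier Q \<Longrightarrow> \<tau> q k \<in> carrier R"
  using tau_cauchy unfolding adic_cauchy_def eq_mod_def by blast

lemma cauchy_eq_mod:
  assumes "adic_cauchy R m t" "j \<le> k" shows "eq_mod R (ideal_pow R m j) (t k) (t j)"
  using assms(2)
proof (induction k rule: dec_induct)
  case base
  then show ?case using assms(1) by (intro eq_mod_refl[OF mpow]) (auto simp: adic_cauchy_def eq_mod_def)
next
  case (step k)
  have "eq_mod R (ideal_pow R m k) (t (Suc k)) (t k)" using assms(1) by (simp add: adic_cauchy_def)
  then have "eq_mod R (ideal_pow R m j) (t (Suc k)) (t k)"
    using ideal_pow_antimono[OF m_ideal step(1)] unfolding eq_mod_def by blast
  then show ?case using step eq_mod_trans[OF mpow] by blast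
qed

lemma const_cauchy: "r \<in> carrier R \<Longrightarrow> adic_cauchy R m (\<lambda>_. r)"
  using eq_mod_refl[OF mpow] by (simp add: adic_cauchy_def)

text \<open>\<open>q\<close> and \<open>r\<close> have the same image in the completion. Two lifts
  of one \<open>r\<close> differ by an element of \<open>a\<close>.\<close>

definition lifts :: "'q \<Rightarrow> 'a \<Rightarrow> bool" where
  "lifts q r \<longleftrightarrow> q \<in> carrier Q \<and> (\<forall>k. eq_mod R (ideal_pow R m k) (\<tau> q k) r)"

lemma lift_exists: "r \<in> carrier R \<Longrightarrow> \<exists>q. lifts q r"
  using tau_surj[OF const_cauchy] unfolding lifts_def by blast

lemma tau_zero: "\<tau> \<zero>\<^bsub>Q\<^esub> k \<in> ideal_pow R m k"
  using tau_ker[of "\<zero>\<^bsub>Q\<^esub>"] ideal_zero[OF a_ideal] by simp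

lemma tau_uminus:
  assumes q: "q \<in> carrier Q" shows "eq_mod R (ideal_pow R m k) (\<tau> (\<ominus>\<^bsub>Q\<^esub> q) k) (\<ominus> \<tau> q k)"
proof -
  have c: "\<tau> q k \<in> carrier R" "\<tau> (\<ominus>\<^bsub>Q\<^esub> q) k \<in> carrier R" using q tau_carrier by auto
  have "eq_mod R (ideal_pow R m k) (\<tau> \<zero>\<^bsub>Q\<^esub> k) (\<tau> (\<ominus>\<^bsub>Q\<^esub> q) k \<oplus> \<tau> q k)"
    using tau_add[of "\<ominus>\<^bsub>Q\<^esub> q" q k] q by (simp add: Q.l_neg)
  then have "\<tau> (\<ominus>\<^bsub>Q\<^esub> q) k \<oplus> \<tau> q k \<in> ideal_pow R m k"
    using tau_zero eq_mod_mem_iff[OF mpow] by blast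
  moreover have "\<tau> (\<ominus>\<^bsub>Q\<^esub> q) k \<ominus> \<ominus> \<tau> q k = \<tau> (\<ominus>\<^bsub>Q\<^esub> q) k \<oplus> \<tau> q k"
    using c by (simp add: a_minus_def)
  ultimately show ?thesis using c by (simp add: eq_mod_def)
qed

lemma tau_minus:
  assumes "p \<in> carrier Q" "q \<in> carrier Q"
  shows "eq_mod R (ideal_pow R m k) (\<tau> (p \<ominus>\<^bsub>Q\<^esub> q) k) (\<tau> p k \<ominus> \<tau> q k)"
  unfolding a_minus_def
  using eq_mod_trans[OF mpow tau_add[of p "\<ominus>\<^bsub>Q\<^esub> q" k]
      eq_mod_add[OF mpow eq_mod_refl[OF mpow tau_carrier] tau_uminus]] assms by simp

lemma tau_dot:
  assumes "\<And>i. i < s \<Longrightarrow> c i \<in> carrier Q" "\<And>i. i < s \<Longrightarrow> g i \<in> carrier Q"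
  shows "eq_mod R (ideal_pow R m k) (\<tau> (dot Q s c g) k) (dot R s (\<lambda>i. \<tau> (c i) k) (\<lambda>i. \<tau> (g i) k))"
  using assms
proof (induction s)
  case 0
  then show ?case using tau_zero eq_mod_zero_iff[OF mpow tau_carrier] by simp
next
  case (Suc s)
  have "eq_mod R (ideal_pow R m k) (\<tau> (dot Q (Suc s) c g) k) (\<tau> (dot Q s c g) k \<oplus> \<tau> (c s \<otimes>\<^bsub>Q\<^esub> g s) k)"
    using Suc.prems by (simp add: tau_add)
  moreover have "eq_mod R (ideal_pow R m k) (\<tau> (dot Q s c g) k \<oplus> \<tau> (c s \<otimes>\<^bsub>Q\<^esub> g s) k)
     (dot R (Suc s) (\<lambda>i. \<tau> (c i) k) (\<lambda>i. \<tau> (g i) k))"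
    using Suc by (simp add: eq_mod_add[OF mpow] tau_mult)
  ultimately show ?case by (rule eq_mod_trans[OF mpow])
qed

lemma same_image_mod_a:
  assumes pq: "p \<in> carrier Q" "q \<in> carrier Q"
    and "\<And>k. eq_mod R (ideal_pow R m k) (\<tau> p k) (\<tau> q k)"
  shows "p \<ominus>\<^bsub>Q\<^esub> q \<in> a"
proof -
  have "\<tau> (p \<ominus>\<^bsub>Q\<^esub> q) k \<in> ideal_pow R m k" for k
    using eq_mod_mem_iff[OF mpow tau_minus[OF pq]] assms(3)[of k] by (auto simp: eq_mod_def)
  then have "\<forall>k. \<tau> (p \<ominus>\<^bsub>Q\<^esub> q) k \<in> ideal_pow R m k" by blast
  then show ?thesis using tau_ker[of "p \<ominus>\<^bsub>Q\<^esub> q"] pq by blast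
qed

text \<open>The elements of \<open>Q\<close> that map into \<open>m\<close> form an ideal
  \<open>?N\<close>. It is maximal, since an element outside has an inverse modulo
  \<open>?N\<close>, obtained by lifting an inverse from \<open>R\<close>; so it is the only maximal
  ideal \<open>n\<close>.\<close>

lemma tau_m_iff:
  assumes q: "q \<in> carrier Q" shows "\<tau> q 1 \<in> m \<longleftrightarrow> q \<in> n"
proof -
  have m1: "ideal_pow R m 1 = m" using ideal_pow_1[OF m_ideal] by simp
  note add = tau_add[of _ _ 1, unfolded m1] and mult = tau_mult[of _ _ 1, unfolded m1]
    and one = tau_one[of 1, unfolded m1]
  note mem = eq_mod_mem_iff[OF m_ideal]
  let ?N = "{q \<in> carrier Q. \<tau> q 1 \<in> m}"
  have one_notin: "\<one>\<^bsub>Q\<^esub> \<notin> ?N" using mem[OF one] primeideal_one_notin[OF m_prime] by simp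
  have N: "ideal ?N Q"
  proof (rule Q.ideal_criterion)
    show "\<zero>\<^bsub>Q\<^esub> \<in> ?N" using tau_zero[of 1] m1 by simp
    fix p q assume "p \<in> ?N" "q \<in> ?N"
    then show "p \<oplus>\<^bsub>Q\<^esub> q \<in> ?N" using mem[OF add] ideal_add[OF m_ideal] by simp
  next
    fix p q assume "p \<in> ?N" "q \<in> carrier Q"
    then show "q \<otimes>\<^bsub>Q\<^esub> p \<in> ?N" using mem[OF mult] ideal_lmult[OF m_ideal] tau_carrier by simp
  qed auto
  have "maximalideal ?N Q"
  proof (rule maximalidealI[OF N])
    show "carrier Q \<noteq> ?N" using one_notin Q.one_closed by blast
    fix J assume J: "ideal J Q" "?N \<subseteq> J" "J \<subseteq> carrier Q"
    show "J = ?N \<or> J = carrier Q"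
    proof (cases "J = ?N")
      case False
      then obtain p where p: "p \<in> J" "p \<notin> ?N" using J by blast
      have pQ: "p \<in> carrier Q" using p J by blast
      then have "\<tau> p 1 \<notin> m" using p by blast
      then obtain s where s: "s \<in> carrier R" "s \<otimes> \<tau> p 1 = \<one>"
        using unit_outside_m tau_carrier[OF pQ] by blast
      obtain q where q: "lifts q s" using lift_exists s by blast
      then have qQ: "q \<in> carrier Q" and qs: "eq_mod R m (\<tau> q 1) s"
        using m1 unfolding lifts_def by metis+
      have "eq_mod R m (\<tau> (q \<otimes>\<^bsub>Q\<^esub> p) 1) \<one>"
        using eq_mod_trans[OF m_ideal mult[OF qQ pQ] eq_mod_mult[OF m_ideal qs eq_mod_refl[OF m_ideal tau_carrier[OF pQ]]]] s by simp
      then have "eq_mod R m (\<tau> \<one>\<^bsub>Q\<^esub> 1 \<ominus> \<tau> (q \<otimes>\<^bsub>Q\<^esub> p) 1) (\<one> \<ominus> \<one>)"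
        unfolding a_minus_def by (intro eq_mod_add[OF m_ideal] eq_mod_uminus[OF m_ideal] one)
      then have "eq_mod R m (\<tau> (\<one>\<^bsub>Q\<^esub> \<ominus>\<^bsub>Q\<^esub> q \<otimes>\<^bsub>Q\<^esub> p) 1) (\<one> \<ominus> \<one>)"
        using eq_mod_trans[OF m_ideal tau_minus[of "\<one>\<^bsub>Q\<^esub>" "q \<otimes>\<^bsub>Q\<^esub> p" 1, unfolded m1]] qQ pQ by simp
      moreover have "\<one> \<ominus> \<one> = \<zero>" by (simp add: a_minus_def r_neg)
      ultimately have "eq_mod R m (\<tau> (\<one>\<^bsub>Q\<^esub> \<ominus>\<^bsub>Q\<^esub> q \<otimes>\<^bsub>Q\<^esub> p) 1) \<zero>" by simp
      then have "\<one>\<^bsub>Q\<^esub> \<ominus>\<^bsub>Q\<^esub> q \<otimes>\<^bsub>Q\<^esub> p \<in> ?N"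
        using mem ideal_zero[OF m_ideal] qQ pQ by simp
      then have "\<one>\<^bsub>Q\<^esub> \<ominus>\<^bsub>Q\<^esub> q \<otimes>\<^bsub>Q\<^esub> p \<oplus>\<^bsub>Q\<^esub> q \<otimes>\<^bsub>Q\<^esub> p \<in> J"
        using J p qQ ideal_add[OF J(1)] ideal_lmult[OF J(1)] by blast
      moreover have "\<one>\<^bsub>Q\<^esub> \<ominus>\<^bsub>Q\<^esub> q \<otimes>\<^bsub>Q\<^esub> p \<oplus>\<^bsub>Q\<^esub> q \<otimes>\<^bsub>Q\<^esub> p = \<one>\<^bsub>Q\<^esub>"
        using qQ pQ by (simp add: a_minus_def Q.a_assoc Q.l_neg)
      ultimately show ?thesis using ideal.one_imp_carrier[OF J(1)] by simp
    qed simp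
  qed
  then have "?N = n" by (rule Q.unique)
  then show ?thesis using q by blast
qed

lemma tau_npow:
  assumes "q \<in> ideal_pow Q n k" shows "\<tau> q k \<in> ideal_pow R m k"
proof -
  have "q \<in> carrier Q \<and> \<tau> q k \<in> ideal_pow R m k"
    using assms
  proof (induction k arbitrary: q)
    case 0
    then show ?case using tau_carrier by (simp add: ideal_pow_0)
  next
    case (Suc k)
    from Suc.prems show ?case unfolding ideal_pow_Suc[of Q]
    proof (induction rule: ideal_prod.induct)
      case (prod p q)
      have c: "p \<in> carrier Q" "q \<in> carrier Q"
        using prod ideal_carrier[OF npow] ideal_carrier[OF Q.m_ideal] by auto
      have "\<tau> p k \<in> ideal_pow R m k" using Suc.IH prod by blast
      then have 1: "\<tau> p (Suc k) \<in> ideal_pow R m k"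
        using eq_mod_mem_iff[OF mpow cauchy_eq_mod[OF tau_cauchy[OF c(1)], of k "Suc k"]] by simp
      have "\<tau> q 1 \<in> m" using tau_m_iff c prod by blast
      then have 2: "\<tau> q (Suc k) \<in> m"
        using eq_mod_mem_iff[OF mpow cauchy_eq_mod[OF tau_cauchy[OF c(2)], of 1 "Suc k"]] ideal_pow_1[OF m_ideal] by simp
      have "\<tau> p (Suc k) \<otimes> \<tau> q (Suc k) \<in> ideal_pow R m (Suc k)"
        unfolding ideal_pow_Suc using 1 2 by (rule ideal_prod.prod)
      then show ?case using eq_mod_mem_iff[OF mpow tau_mult[OF c]] c by simp
    next
      case (sum p q)
      then show ?case using eq_mod_mem_iff[OF mpow tau_add] ideal_add[OF mpow] by simp
    qed
  qed
  then show ?thesis ..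
qed

text \<open>For a product in \<open>m^(k+1)\<close> take the product of lifts: the first factor lies
  in \<open>a + n^k\<close> by induction, the second in \<open>n\<close>. An arbitrary lift differs
  from this one by an element of \<open>a\<close>.\<close>

lemma lift_mpow:
  assumes "r \<in> ideal_pow R m k" "lifts q r" shows "q \<in> a <+>\<^bsub>Q\<^esub> ideal_pow Q n k"
proof -
  have ank: "ideal (a <+>\<^bsub>Q\<^esub> ideal_pow Q n k) Q" for k using a_ideal npow by (intro Q.add_ideals)
  have unique: "q \<in> a <+>\<^bsub>Q\<^esub> ideal_pow Q n k"
    if "lifts q r" "lifts p r" "p \<in> a <+>\<^bsub>Q\<^esub> ideal_pow Q n k" for p q r k
  proof -
    have c: "p \<in> carrier Q" "q \<in> carrier Q" using that by (auto simp: lifts_def)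
    have "q \<ominus>\<^bsub>Q\<^esub> p \<in> a"
      using that eq_mod_trans[OF mpow] eq_mod_sym[OF mpow] unfolding lifts_def
      by (intro same_image_mod_a) blast+
    then have "q \<ominus>\<^bsub>Q\<^esub> p \<oplus>\<^bsub>Q\<^esub> p \<in> a <+>\<^bsub>Q\<^esub> ideal_pow Q n k"
      using that Q.set_add_left[OF a_ideal npow] ideal_add[OF ank] by blast
    then show ?thesis using c by (simp add: a_minus_def Q.a_assoc Q.l_neg)
  qed
  show ?thesis
    using assms
  proof (induction k arbitrary: r q)
    case 0
    have "q \<in> carrier Q" using 0 by (simp add: lifts_def)
    then show ?case using Q.set_add_right[OF a_ideal npow[of 0]] by (auto simp: ideal_pow_0)
  next
    case (Suc k)
    have "r \<in> carrier R \<and> (\<exists>p. lifts p r \<and> p \<in> a <+>\<^bsub>Q\<^esub> ideal_pow Q n (Suc k))"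
      using Suc.prems(1) unfolding ideal_pow_Suc[of R]
    proof (induction rule: ideal_prod.induct)
      case (prod u v)
      have c: "u \<in> carrier R" "v \<in> carrier R" using prod ideal_carrier[OF mpow] ideal_carrier[OF m_ideal] by auto
      then obtain p q where pq: "lifts p u" "lifts q v" using lift_exists by blast
      have pqQ: "p \<in> carrier Q" "q \<in> carrier Q" using pq by (auto simp: lifts_def)
      have "lifts (p \<otimes>\<^bsub>Q\<^esub> q) (u \<otimes> v)"
        using pq pqQ eq_mod_trans[OF mpow tau_mult eq_mod_mult[OF mpow]] unfolding lifts_def by simp
      moreover have "p \<in> a <+>\<^bsub>Q\<^esub> ideal_pow Q n k" using Suc.IH prod pq by blast
      then obtain b e where be: "b \<in> a" "e \<in> ideal_pow Q n k" "p = b \<oplus>\<^bsub>Q\<^esub> e" by (auto simp: Q.mem_set_add)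
      have beQ: "b \<in> carrier Q" "e \<in> carrier Q" using be ideal_carrier[OF npow] ideal_carrier[OF a_ideal] by auto
      have "eq_mod R (ideal_pow R m 1) (\<tau> q 1) v" using pq unfolding lifts_def by blast
      then have "\<tau> q 1 \<in> m" using prod(2) eq_mod_mem_iff[OF mpow] ideal_pow_1[OF m_ideal] by fastforce
      then have "q \<in> n" using tau_m_iff pqQ by blast
      then have "e \<otimes>\<^bsub>Q\<^esub> q \<in> ideal_pow Q n (Suc k)" unfolding ideal_pow_Suc[of Q] using be by (intro ideal_prod.prod)
      moreover have "b \<otimes>\<^bsub>Q\<^esub> q \<in> a" using be pqQ ideal_rmult[OF a_ideal] by blast
      moreover have "p \<otimes>\<^bsub>Q\<^esub> q = b \<otimes>\<^bsub>Q\<^esub> q \<oplus>\<^bsub>Q\<^esub> e \<otimes>\<^bsub>Q\<^esub> q" unfolding be(3) using beQ pqQ by (simp add: Q.l_distr)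
      ultimately have "lifts (p \<otimes>\<^bsub>Q\<^esub> q) (u \<otimes> v)" "p \<otimes>\<^bsub>Q\<^esub> q \<in> a <+>\<^bsub>Q\<^esub> ideal_pow Q n (Suc k)"
        unfolding Q.mem_set_add by blast+
      then show ?case using c by blast
    next
      case (sum u v)
      then obtain p q where pq: "lifts p u" "p \<in> a <+>\<^bsub>Q\<^esub> ideal_pow Q n (Suc k)"
         "lifts q v" "q \<in> a <+>\<^bsub>Q\<^esub> ideal_pow Q n (Suc k)" by blast
      have pqQ: "p \<in> carrier Q" "q \<in> carrier Q" using pq by (auto simp: lifts_def)
      have "lifts (p \<oplus>\<^bsub>Q\<^esub> q) (u \<oplus> v)"
        using pq pqQ eq_mod_trans[OF mpow tau_add eq_mod_add[OF mpow]] unfolding lifts_def by simp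
      moreover have "p \<oplus>\<^bsub>Q\<^esub> q \<in> a <+>\<^bsub>Q\<^esub> ideal_pow Q n (Suc k)" using pq ideal_add[OF ank] by blast
      ultimately show ?case using sum by blast
    qed
    then show ?case using unique Suc.prems(2) by blast
  qed
qed

text \<open>An element of the kernel of \<open>Q \<rightarrow> R/m\<^sup>k\<close> is a convergent linear combination of
  generators of \<open>m\<^sup>k\<close>, whose coefficients are lifted to \<open>Q\<close> by completeness.\<close>

lemma tau_kernel:
  assumes q: "q \<in> carrier Q" and qk: "\<tau> q k \<in> ideal_pow R m k"
  shows "q \<in> a <+>\<^bsub>Q\<^esub> ideal_pow Q n k"
proof -
  obtain A where A: "A \<subseteq> carrier R" "finite A" "ideal_pow R m k = Idl A"
    using finetely_gen[OF mpow] by blast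
  define s where "s = card A"
  obtain g where "bij_betw g {0..<s} A" using ex_bij_betw_nat_finite[OF A(2)] s_def by blast
  then have g: "A = g ` {..<s}" unfolding bij_betw_def by (simp add: atLeast0LessThan)
  have gR: "g i \<in> carrier R" if "i < s" for i using A g that by auto
  have gen: "ideal_pow R m k = lincombs R s g"
    using genideal_lincombs[of s g, OF gR] A g by simp
  have gm: "g i \<in> ideal_pow R m k" if "i < s" for i unfolding gen using gR that by (rule mem_lincombs)
  let ?t = "\<lambda>j. \<tau> q (k + j)"
  have tR: "?t j \<in> carrier R" for j using tau_carrier[OF q] .
  \<comment> \<open>Consecutive terms differ by an element of \<open>m^(j+k) = m^j m^k\<close>,
    hence by a combination of the generators \<open>g\<close> of \<open>m^k\<close> with
    coefficients in \<open>m^j\<close>.\<close>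
  have "\<forall>j. \<exists>b. (\<forall>i<s. b i \<in> ideal_pow R m j) \<and> ?t (Suc j) \<ominus> ?t j = dot R s b g"
  proof
    fix j
    have "?t (Suc j) \<ominus> ?t j \<in> ideal_pow R m (j + k)"
      using tau_cauchy[OF q] by (simp add: adic_cauchy_def eq_mod_def add.commute)
    then have "?t (Suc j) \<ominus> ?t j \<in> ideal_prod R (ideal_pow R m j) (lincombs R s g)"
      using ideal_pow_add[OF m_ideal] gen by simp
    then show "\<exists>b. (\<forall>i<s. b i \<in> ideal_pow R m j) \<and> ?t (Suc j) \<ominus> ?t j = dot R s b g"
      using ideal_prod_lincombs[of "ideal_pow R m j" s g, OF mpow gR] by metis
  qed
  then obtain b where b: "\<And>j i. i < s \<Longrightarrow> b j i \<in> ideal_pow R m j" "\<And>j. ?t (Suc j) \<ominus> ?t j = dot R s (b j) g" by metis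
  obtain b0 where b0: "\<forall>i<s. b0 i \<in> carrier R" "?t 0 = dot R s b0 g"
    using qk gen by (auto simp: lincombs_def)
  \<comment> \<open>Partial sums of the coefficients. In each coordinate they form a Cauchy
    sequence, which is the image of an element \<open>e i\<close> of \<open>Q\<close>.\<close>
  define c where "c j = rec_nat b0 (\<lambda>j c i. c i \<oplus> b j i) j" for j
  have c0: "c 0 = b0" and cS: "\<And>j. c (Suc j) = (\<lambda>i. c j i \<oplus> b j i)" by (simp_all add: c_def)
  have bR: "b j i \<in> carrier R" if "i < s" for i j using b(1)[OF that] ideal_carrier[OF mpow] by blast
  have cR: "c j i \<in> carrier R" if "i < s" for i j
    using that by (induction j) (auto simp: c0 cS b0 bR)
  have tc: "?t j = dot R s (c j) g" for j
  proof (induction j)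
    case 0 then show ?case using b0 c0 by simp
  next
    case (Suc j)
    have "?t (Suc j) = ?t j \<oplus> (?t (Suc j) \<ominus> ?t j)" using tR[of j] tR[of "Suc j"] by algebra
    also have "\<dots> = dot R s (c j) g \<oplus> dot R s (b j) g" unfolding b(2) unfolding Suc ..
    also have "\<dots> = dot R s (c (Suc j)) g" unfolding cS using cR bR gR by (simp add: dot_add)
    finally show ?case .
  qed
  have cauchy: "adic_cauchy R m (\<lambda>j. c j i)" if i: "i < s" for i
    unfolding adic_cauchy_def
  proof
    fix j
    show "eq_mod R (ideal_pow R m j) (c (Suc j) i) (c j i)"
      unfolding cS using cR[OF i] b(1)[OF i] by (intro eq_mod_shift[OF mpow] eq_mod_refl[OF mpow])
  qed
  have "\<forall>i. \<exists>p. i < s \<longrightarrow> p \<in> carrier Q \<and> (\<forall>j. eq_mod R (ideal_pow R m j) (\<tau> p j) (c j i))"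
    using tau_surj[OF cauchy] by blast
  then obtain e where e: "\<And>i. i < s \<Longrightarrow> e i \<in> carrier Q"
      "\<And>i j. i < s \<Longrightarrow> eq_mod R (ideal_pow R m j) (\<tau> (e i) j) (c j i)" by metis
  have "\<forall>i. \<exists>\<gamma>. i < s \<longrightarrow> lifts \<gamma> (g i)" using lift_exists gR by blast
  then obtain \<gamma> where \<gamma>: "\<And>i. i < s \<Longrightarrow> lifts (\<gamma> i) (g i)" by metis
  have \<gamma>Q: "\<gamma> i \<in> carrier Q" if "i < s" for i using \<gamma>[OF that] by (simp add: lifts_def)
  have ank: "ideal (a <+>\<^bsub>Q\<^esub> ideal_pow Q n k) Q" using a_ideal npow by (intro Q.add_ideals)
  let ?p = "dot Q s e \<gamma>"
  have pQ: "?p \<in> carrier Q" using e \<gamma>Q by simp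
  have p: "?p \<in> a <+>\<^bsub>Q\<^esub> ideal_pow Q n k"
    using lift_mpow[OF gm \<gamma>] e by (intro Q.dot_mem_ideal[OF ank] ideal_lmult[OF ank])
  have "q \<ominus>\<^bsub>Q\<^esub> ?p \<in> a"
  proof (rule same_image_mod_a[OF q pQ])
    fix j
    have "eq_mod R (ideal_pow R m j) (\<tau> ?p j) (dot R s (\<lambda>i. \<tau> (e i) j) (\<lambda>i. \<tau> (\<gamma> i) j))"
      using e \<gamma>Q by (intro tau_dot)
    moreover have "eq_mod R (ideal_pow R m j) (dot R s (\<lambda>i. \<tau> (e i) j) (\<lambda>i. \<tau> (\<gamma> i) j)) (dot R s (c j) g)"
      using e \<gamma> by (intro eq_mod_dot[OF mpow]) (auto simp: lifts_def)
    ultimately have "eq_mod R (ideal_pow R m j) (\<tau> ?p j) (?t j)" unfolding tc by (rule eq_mod_trans[OF mpow])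
    moreover have "eq_mod R (ideal_pow R m j) (?t j) (\<tau> q j)" by (rule cauchy_eq_mod[OF tau_cauchy[OF q]]) simp
    ultimately show "eq_mod R (ideal_pow R m j) (\<tau> q j) (\<tau> ?p j)"
      using eq_mod_trans[OF mpow] eq_mod_sym[OF mpow] by blast
  qed
  then have "q \<ominus>\<^bsub>Q\<^esub> ?p \<oplus>\<^bsub>Q\<^esub> ?p \<in> a <+>\<^bsub>Q\<^esub> ideal_pow Q n k"
    using p Q.set_add_left[OF a_ideal npow] ideal_add[OF ank] by blast
  then show ?thesis using q pQ by (simp add: a_minus_def Q.a_assoc Q.l_neg)
qed

lemma tau_kernel_iff:
  assumes q: "q \<in> carrier Q"
  shows "\<tau> q k \<in> ideal_pow R m k \<longleftrightarrow> q \<in> a <+>\<^bsub>Q\<^esub> ideal_pow Q n k"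
proof
  assume "q \<in> a <+>\<^bsub>Q\<^esub> ideal_pow Q n k"
  then obtain b e where be: "b \<in> a" "e \<in> ideal_pow Q n k" "q = b \<oplus>\<^bsub>Q\<^esub> e" by (auto simp: Q.mem_set_add)
  have beQ: "b \<in> carrier Q" "e \<in> carrier Q" using be ideal_carrier[OF npow] ideal_carrier[OF a_ideal] by auto
  have "\<tau> b k \<in> ideal_pow R m k" "\<tau> e k \<in> ideal_pow R m k"
    using tau_ker[OF beQ(1)] be tau_npow by auto
  then show "\<tau> q k \<in> ideal_pow R m k"
    unfolding be(3) using eq_mod_mem_iff[OF mpow tau_add[OF beQ]] ideal_add[OF mpow] by blast
qed (rule tau_kernel[OF q])

text \<open>Modulo \<open>m^2\<close> the images of the given parameters \<open>y0\<close> have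
  representatives \<open>x\<close> in \<open>R\<close>. Lifts \<open>y\<close> of these agree with
  \<open>y0\<close> modulo \<open>a + n^2 = n^2\<close>, so they still generate \<open>n\<close>,
  and they are as many as the dimension requires.\<close>

lemma comparison_exists:
  assumes reg: "regular_system Q n d y0"
  shows "\<exists>y x rel. comparison R m Q n d y a x rel"
proof -
  interpret S: regular_system Q n d y0 by (rule reg)
  define x where "x i = \<tau> (y0 i) 2" for i
  have xR: "x i \<in> carrier R" if "i < d" for i unfolding x_def using tau_carrier S.x_carrier that by blast
  have "\<forall>i. \<exists>q. i < d \<longrightarrow> lifts q (x i)" using lift_exists xR by blast
  then obtain y where y: "\<And>i. i < d \<Longrightarrow> lifts (y i) (x i)" by metis
  have yQ: "y i \<in> carrier Q" if "i < d" for i using y that by (simp add: lifts_def)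
  have close: "y0 i \<ominus>\<^bsub>Q\<^esub> y i \<in> ideal_pow Q n 2" if i: "i < d" for i
  proof -
    have "eq_mod R (ideal_pow R m 2) (\<tau> (y i) 2) (x i)" using y[OF i] by (simp add: lifts_def)
    then have "\<tau> (y0 i) 2 \<ominus> \<tau> (y i) 2 \<in> ideal_pow R m 2"
      using eq_mod_sym[OF mpow] unfolding x_def eq_mod_def by blast
    then have "\<tau> (y0 i \<ominus>\<^bsub>Q\<^esub> y i) 2 \<in> ideal_pow R m 2"
      using eq_mod_mem_iff[OF mpow tau_minus] S.x_carrier yQ i by blast
    then have "y0 i \<ominus>\<^bsub>Q\<^esub> y i \<in> a <+>\<^bsub>Q\<^esub> ideal_pow Q n 2" using tau_kernel S.x_carrier yQ i by simp
    then show ?thesis using a_sub ideal_add[OF npow] by (auto simp: Q.mem_set_add)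
  qed
  have n2: "ideal_pow Q n 2 = ideal_prod Q n n" by (rule Q.ideal_pow_2[OF Q.m_ideal])
  have L: "ideal (lincombs Q d y) Q" using yQ by (rule Q.lincombs_ideal)
  have yn: "y i \<in> n" if i: "i < d" for i
  proof -
    have "ideal_pow Q n 2 \<subseteq> n" using Q.ideal_pow_antimono[OF Q.m_ideal, of 1 2] npow_1 by simp
    then have "y0 i \<ominus>\<^bsub>Q\<^esub> (y0 i \<ominus>\<^bsub>Q\<^esub> y i) \<in> n"
      using close i S.x_in_m ideal_minus[OF Q.m_ideal] by blast
    moreover have "y0 i \<ominus>\<^bsub>Q\<^esub> (y0 i \<ominus>\<^bsub>Q\<^esub> y i) = y i"
      using yQ[OF i] S.x_carrier[OF i] by (simp add: a_minus_def Q.minus_add Q.r_neg2)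
    ultimately show ?thesis by simp
  qed
  have M: "ideal (lincombs Q d y <+>\<^bsub>Q\<^esub> ideal_prod Q n n) Q"
    using L npow[of 2] n2 by (intro Q.add_ideals) auto
  have "y0 i \<in> lincombs Q d y <+>\<^bsub>Q\<^esub> ideal_prod Q n n" if i: "i < d" for i
  proof -
    have "y0 i = y i \<oplus>\<^bsub>Q\<^esub> (y0 i \<ominus>\<^bsub>Q\<^esub> y i)" using yQ[OF i] S.x_carrier[OF i] by (simp add: a_minus_def Q.a_ac Q.r_neg2 Q.r_neg)
    moreover have "y i \<in> lincombs Q d y" using yQ i by (rule Q.mem_lincombs)
    ultimately show ?thesis using close[OF i] n2 unfolding Q.mem_set_add by blast
  qed
  then have "n \<subseteq> lincombs Q d y <+>\<^bsub>Q\<^esub> ideal_prod Q n n"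
    using Q.lincombs_minimal[OF M, of d y0] S.m_gen by metis
  then have "n \<subseteq> lincombs Q d y" by (rule Q.nakayama[OF Q.m_ideal L])
  then have gen: "n = lincombs Q d y" using Q.lincombs_minimal[of n d y, OF Q.m_ideal yn] by blast
  have "regular_system_axioms Q n d y" using yQ gen S.dim by (rule regular_system_axioms.intro)
  then have reg': "regular_system Q n d y" using Q.noetherian_local_axioms regular_system.intro by blast
  define rel where "rel k r q \<longleftrightarrow> q \<in> carrier Q \<and> eq_mod R (ideal_pow R m k) r (\<tau> q k)" for k r q
  have "comparison_axioms R m Q n d y a x rel"
  proof (rule comparison_axioms.intro[OF a_ideal a_sub])
    fix k r q assume "rel k r q" then show "r \<in> carrier R \<and> q \<in> carrier Q" by (simp add: rel_def eq_mod_def)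
  next
    fix r k assume "r \<in> carrier R"
    then obtain q where "lifts q r" using lift_exists by blast
    then show "\<exists>q. rel k r q" unfolding rel_def lifts_def using eq_mod_sym[OF mpow] by blast
  next
    fix q k assume "q \<in> carrier Q"
    then show "\<exists>r. rel k r q" unfolding rel_def using eq_mod_refl[OF mpow tau_carrier] by blast
  next
    fix k r q r' q' assume "rel k r q" "rel k r' q'"
    then show "rel k (r \<oplus> r') (q \<oplus>\<^bsub>Q\<^esub> q')" "rel k (r \<otimes> r') (q \<otimes>\<^bsub>Q\<^esub> q')" unfolding rel_def
      using eq_mod_trans[OF mpow eq_mod_add[OF mpow] eq_mod_sym[OF mpow tau_add]]
        eq_mod_trans[OF mpow eq_mod_mult[OF mpow] eq_mod_sym[OF mpow tau_mult]] by auto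
  next
    fix k r q assume "rel k r q"
    then show "rel k (\<ominus> r) (\<ominus>\<^bsub>Q\<^esub> q)" unfolding rel_def
      using eq_mod_trans[OF mpow eq_mod_uminus[OF mpow] eq_mod_sym[OF mpow tau_uminus]] by auto
  next
    fix k r q s assume "rel k r q" "s \<in> ideal_pow R m k"
    then show "rel k (r \<oplus> s) q" unfolding rel_def using eq_mod_shift[OF mpow] by blast
  next
    fix k r q and j :: nat assume rel: "rel k r q" "j \<le> k"
    then have "eq_mod R (ideal_pow R m j) r (\<tau> q k)"
      using ideal_pow_antimono[OF m_ideal rel(2)] unfolding rel_def eq_mod_def by blast
    then show "rel j r q" using rel cauchy_eq_mod[OF tau_cauchy rel(2)] eq_mod_trans[OF mpow] unfolding rel_def by blast
  next
    fix k r q assume "rel k r q"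
    then show "r \<in> ideal_pow R m k \<longleftrightarrow> q \<in> a <+>\<^bsub>Q\<^esub> ideal_pow Q n k"
      unfolding rel_def using eq_mod_mem_iff[OF mpow] tau_kernel_iff by blast
  next
    fix i k assume "i < d"
    then show "rel k (x i) (y i)" using y eq_mod_sym[OF mpow] unfolding rel_def lifts_def by blast
  qed
  then have "comparison R m Q n d y a x rel"
    using R.noetherian_local_axioms reg' comparison.intro by blast
  then show ?thesis by blast
qed

end

section \<open>From the Krull dimension to a regular system of parameters\<close>

lemma noetherian_localI: "noetherian_local_ring R m \<Longrightarrow> noetherian_local R m"
  unfolding noetherian_local_ring_def
  by (intro noetherian_local.intro noetherian_cring.intro noetherian_local_axioms.intro) auto

lemma regular_system_exists:
  assumes "regular_local_ring Q n"
  shows "\<exists>d y. regular_system Q n d y"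
proof -
  have "noetherian_local Q n"
    using assms unfolding regular_local_ring_def by (intro noetherian_localI) blast
  then interpret noetherian_local Q n .
  obtain S where S: "finite S" "S \<subseteq> carrier Q" "genideal Q S = n" "enat (card S) = krull_dim Q"
    using assms by (auto simp: regular_local_ring_def)
  let ?d = "card S"
  obtain y where "bij_betw y {0..<?d} S" using ex_bij_betw_nat_finite[OF S(1)] by blast
  then have y: "S = y ` {..<?d}" unfolding bij_betw_def by (simp add: atLeast0LessThan)
  have yQ: "y i \<in> carrier Q" if "i < ?d" for i using y S(2) that by blast
  have gen: "n = lincombs Q ?d y" using genideal_lincombs[of ?d y, OF yQ] y S(3) by simp
  have "\<exists>p. prime_chain Q ?d p n"
  proof (cases "?d = 0")
    case True
    then show ?thesis using prime_chain.refl[OF m_prime] by auto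
  next
    case False
    let ?L = "{enat l | l. \<exists>p :: nat \<Rightarrow> _ set. (\<forall>i\<le>l. primeideal (p i) Q) \<and> (\<forall>i<l. p i \<subset> p (Suc i))}"
    \<comment> \<open>The dimension is a supremum; as it exceeds \<open>?d - 1\<close>, some chain
      has length at least \<open>?d\<close>.\<close>
    have "\<exists>e\<in>?L. enat (?d - 1) < e"
    proof (rule ccontr)
      assume "\<not> (\<exists>e\<in>?L. enat (?d - 1) < e)"
      then have "\<And>e. e \<in> ?L \<Longrightarrow> e \<le> enat (?d - 1)" by (meson not_less)
      then have "Sup ?L \<le> enat (?d - 1)" by (rule Sup_least)
      then have "enat ?d \<le> enat (?d - 1)" using S(4) by (simp add: krull_dim_def)
      then show False using False by simp
    qed
    then obtain l p where "enat (?d - 1) < enat l"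
      "\<forall>i\<le>l. primeideal (p i) Q" "\<forall>i<l. p i \<subset> p (Suc i)" by blast
    then have l: "?d \<le> l" "\<And>i. i \<le> l \<Longrightarrow> primeideal (p i) Q" "\<And>i. i < l \<Longrightarrow> p i \<subset> p (Suc i)"
      by auto
    have chain: "prime_chain Q j (p 0) (p j)" if "j \<le> l" for j
      using that
    proof (induction j)
      case (Suc j)
      then show ?case using l(2)[of "Suc j"] l(3)[of j] by (intro prime_chain.step) auto
    qed (simp add: prime_chain.refl l(2))
    \<comment> \<open>Of a possibly longer chain only the lowest \<open>d'\<close> links are kept
      and the next prime is replaced by \<open>n\<close>: the result has length exactly
      \<open>?d\<close> and ends in \<open>n\<close>.\<close>
    obtain d' where d': "?d = Suc d'" using False not0_implies_Suc by blast
    have "prime_chain Q d' (p 0) (p d')" using chain l d' by simp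
    moreover have "p d' \<subset> n" using l(2)[of ?d] l(3)[of d'] l(1) prime_subset_m d' by fastforce
    ultimately have "prime_chain Q (Suc d') (p 0) n" using m_prime by (rule prime_chain.step)
    then show ?thesis using d' by auto
  qed
  then obtain p where p: "prime_chain Q ?d p n" by blast
  then have "{\<zero>\<^bsub>Q\<^esub>} \<subseteq> p"
    using prime_chain_prime[OF p] primeideal.axioms(1) ideal_zero[of p Q] by blast
  then have "dim_ge {\<zero>\<^bsub>Q\<^esub>} ?d" using p by (auto simp: dim_ge_def)
  then have "regular_system_axioms Q n ?d y" using yQ gen by (intro regular_system_axioms.intro)
  then show ?thesis using noetherian_local_axioms regular_system.intro by blast
qed

section \<open>Tensor products with residue rings\<close>

lemma quot_module_simps [simp]:
  "carrier (quot_module R I) = carrier (R Quot I)"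
  "\<zero>\<^bsub>quot_module R I\<^esub> = \<zero>\<^bsub>R Quot I\<^esub>"
  "x \<oplus>\<^bsub>quot_module R I\<^esub> y = x \<oplus>\<^bsub>R Quot I\<^esub> y"
  "r \<odot>\<^bsub>quot_module R I\<^esub> x = (I +>\<^bsub>R\<^esub> r) \<otimes>\<^bsub>R Quot I\<^esub> x"
  by (simp_all add: quot_module_def)

lemma module_hom_simps:
  assumes "f \<in> module_hom R M N"
  shows module_hom_closed: "x \<in> carrier M \<Longrightarrow> f x \<in> carrier N"
    and module_hom_add: "x \<in> carrier M \<Longrightarrow> y \<in> carrier M \<Longrightarrow> f (x \<oplus>\<^bsub>M\<^esub> y) = f x \<oplus>\<^bsub>N\<^esub> f y"
    and module_hom_smult: "r \<in> carrier R \<Longrightarrow> x \<in> carrier M \<Longrightarrow> f (r \<odot>\<^bsub>M\<^esub> x) = r \<odot>\<^bsub>N\<^esub> f x"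
  using assms by (auto simp: module_hom_def)

lemma module_hom_zero:
  assumes M: "module R M" and N: "module R N" and f: "f \<in> module_hom R M N"
  shows "f \<zero>\<^bsub>M\<^esub> = \<zero>\<^bsub>N\<^esub>"
proof -
  interpret M: module R M by (rule M)
  interpret N: module R N by (rule N)
  have "f (\<zero>\<^bsub>R\<^esub> \<odot>\<^bsub>M\<^esub> \<zero>\<^bsub>M\<^esub>) = \<zero>\<^bsub>R\<^esub> \<odot>\<^bsub>N\<^esub> f \<zero>\<^bsub>M\<^esub>" by (intro module_hom_smult[OF f]) auto
  then show ?thesis using module_hom_closed[OF f, of "\<zero>\<^bsub>M\<^esub>"] by simp
qed

lemma module_hom_minus:
  assumes M: "module R M" and N: "module R N" and f: "f \<in> module_hom R M N"
    and x: "x \<in> carrier M" "y \<in> carrier M"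
  shows "f (x \<ominus>\<^bsub>M\<^esub> y) = f x \<ominus>\<^bsub>N\<^esub> f y"
proof -
  interpret M: module R M by (rule M)
  interpret N: module R N by (rule N)
  have "\<ominus>\<^bsub>M\<^esub> y = (\<ominus>\<^bsub>R\<^esub> \<one>\<^bsub>R\<^esub>) \<odot>\<^bsub>M\<^esub> y" using x by (simp add: M.smult_l_minus)
  then have "f (\<ominus>\<^bsub>M\<^esub> y) = (\<ominus>\<^bsub>R\<^esub> \<one>\<^bsub>R\<^esub>) \<odot>\<^bsub>N\<^esub> f y" using x by (simp add: module_hom_smult[OF f])
  then have "f (\<ominus>\<^bsub>M\<^esub> y) = \<ominus>\<^bsub>N\<^esub> f y" using module_hom_closed[OF f x(2)] by (simp add: N.smult_l_minus)
  then show ?thesis using x by (simp add: a_minus_def module_hom_add[OF f])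
qed

lemma module_hom_ideal_smult:
  assumes M: "module R M" and N: "module R N" and f: "f \<in> module_hom R M N"
    and "I \<subseteq> carrier R" "W \<subseteq> carrier M" "\<And>w. w \<in> W \<Longrightarrow> f w \<in> V" and v: "v \<in> ideal_smult R M I W"
  shows "f v \<in> ideal_smult R N I V"
  using v
proof induction
  case zero
  then show ?case using module_hom_zero[OF M N f] ideal_smult.zero by metis
next
  case (step r w v)
  interpret M: module R M by (rule M)
  have "w \<in> carrier M" "r \<in> carrier R" "v \<in> carrier M" using step assms M.ideal_smult_carrier by blast+
  then have "f (r \<odot>\<^bsub>M\<^esub> w \<oplus>\<^bsub>M\<^esub> v) = r \<odot>\<^bsub>N\<^esub> f w \<oplus>\<^bsub>N\<^esub> f v"
    using module_hom_add[OF f] module_hom_smult[OF f] by simp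
  then show ?case using step assms by (auto intro: ideal_smult.step)
qed

text \<open>The generators in \<open>tensor_relations\<close>, named apart from the subgroup they
  generate, so that maps can be checked on one kind of generator at a time.\<close>

definition tensor_relators ::
  "('a, 'r) ring_scheme \<Rightarrow> ('a, 'b, 'm) module_scheme \<Rightarrow> ('a, 'c, 'n) module_scheme
    \<Rightarrow> ('b \<times> 'c \<Rightarrow>\<^sub>0 int) set" where
  "tensor_relators R M N =
      ({frag_of (x \<oplus>\<^bsub>M\<^esub> x', y) - frag_of (x, y) - frag_of (x', y) | x x' y.
          x \<in> carrier M \<and> x' \<in> carrier M \<and> y \<in> carrier N}
     \<union> {frag_of (x, y \<oplus>\<^bsub>N\<^esub> y') - frag_of (x, y) - frag_of (x, y') | x y y'.
          x \<in> carrier M \<and> y \<in> carrier N \<and> y' \<in> carrier N}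
     \<union> {frag_of (r \<odot>\<^bsub>M\<^esub> x, y) - frag_of (x, r \<odot>\<^bsub>N\<^esub> y) | r x y.
          r \<in> carrier R \<and> x \<in> carrier M \<and> y \<in> carrier N})"

lemma tensor_relations_eq:
  "tensor_relations R M N = generate (free_Abelian_group (carrier M \<times> carrier N)) (tensor_relators R M N)"
  by (simp add: tensor_relations_def tensor_relators_def)

lemma tensor_relatorsI:
  "x \<in> carrier M \<Longrightarrow> x' \<in> carrier M \<Longrightarrow> y \<in> carrier N \<Longrightarrow>
     frag_of (x \<oplus>\<^bsub>M\<^esub> x', y) - frag_of (x, y) - frag_of (x', y) \<in> tensor_relators R M N"
  "x \<in> carrier M \<Longrightarrow> y \<in> carrier N \<Longrightarrow> y' \<in> carrier N \<Longrightarrow>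
     frag_of (x, y \<oplus>\<^bsub>N\<^esub> y') - frag_of (x, y) - frag_of (x, y') \<in> tensor_relators R M N"
  "r \<in> carrier R \<Longrightarrow> x \<in> carrier M \<Longrightarrow> y \<in> carrier N \<Longrightarrow>
     frag_of (r \<odot>\<^bsub>M\<^esub> x, y) - frag_of (x, r \<odot>\<^bsub>N\<^esub> y) \<in> tensor_relators R M N"
  unfolding tensor_relators_def by blast+

lemma tensor_relatorsE:
  assumes "t \<in> tensor_relators R M N"
  obtains x x' y where "t = frag_of (x \<oplus>\<^bsub>M\<^esub> x', y) - frag_of (x, y) - frag_of (x', y)"
      "x \<in> carrier M" "x' \<in> carrier M" "y \<in> carrier N"
    | x y y' where "t = frag_of (x, y \<oplus>\<^bsub>N\<^esub> y') - frag_of (x, y) - frag_of (x, y')"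
      "x \<in> carrier M" "y \<in> carrier N" "y' \<in> carrier N"
    | r x y where "t = frag_of (r \<odot>\<^bsub>M\<^esub> x, y) - frag_of (x, r \<odot>\<^bsub>N\<^esub> y)"
      "r \<in> carrier R" "x \<in> carrier M" "y \<in> carrier N"
  using assms unfolding tensor_relators_def by blast

lemma free_coset: "r_coset (free_Abelian_group S) T z = {t + z | t. t \<in> T}"
  by (auto simp: r_coset_def)

lemma free_set_mult: "set_mult (free_Abelian_group S) T U = {t + u | t u. t \<in> T \<and> u \<in> U}"
  by (auto simp: set_mult_def)

section \<open>The identification of \<open>M \<otimes> R/I\<close> with \<open>M/IM\<close>\<close>

locale residue_tensor = module R M for R (structure) and M (structure) +
  fixes I assumes I: "ideal I R"
begin

abbreviation N where "N \<equiv> quot_module R I"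
abbreviation FA where "FA \<equiv> free_Abelian_group (carrier M \<times> carrier N)"
abbreviation T where "T \<equiv> tensor_relations R M N"
abbreviation unit where "unit \<equiv> I +>\<^bsub>R\<^esub> \<one>\<^bsub>R\<^esub>"
abbreviation IM where "IM \<equiv> ideal_smult R M I (carrier M)"

lemma N_carrier: "carrier N = {I +>\<^bsub>R\<^esub> r | r. r \<in> carrier R}"
  unfolding quot_module_simps by (rule R.Quot_carrier[OF I])

lemma unit_N: "unit \<in> carrier N"
  unfolding N_carrier by blast

lemma N_add: "r \<in> carrier R \<Longrightarrow> s \<in> carrier R \<Longrightarrow> (I +>\<^bsub>R\<^esub> r) \<oplus>\<^bsub>N\<^esub> (I +>\<^bsub>R\<^esub> s) = I +>\<^bsub>R\<^esub> (r \<oplus>\<^bsub>R\<^esub> s)"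
  unfolding quot_module_simps by (rule R.Quot_add[OF I])

lemma N_smult: "r \<in> carrier R \<Longrightarrow> s \<in> carrier R \<Longrightarrow> r \<odot>\<^bsub>N\<^esub> (I +>\<^bsub>R\<^esub> s) = I +>\<^bsub>R\<^esub> (r \<otimes>\<^bsub>R\<^esub> s)"
  unfolding quot_module_simps by (rule R.Quot_mult[OF I])

lemma N_closed:
  assumes "C \<in> carrier N"
  shows "C' \<in> carrier N \<Longrightarrow> C \<oplus>\<^bsub>N\<^esub> C' \<in> carrier N" "r \<in> carrier R \<Longrightarrow> r \<odot>\<^bsub>N\<^esub> C \<in> carrier N"
proof -
  obtain s where s: "C = I +>\<^bsub>R\<^esub> s" "s \<in> carrier R" using assms unfolding N_carrier by blast
  show "C \<oplus>\<^bsub>N\<^esub> C' \<in> carrier N" if C': "C' \<in> carrier N"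
  proof -
    obtain s' where s': "C' = I +>\<^bsub>R\<^esub> s'" "s' \<in> carrier R" using C' unfolding N_carrier by blast
    have "C \<oplus>\<^bsub>N\<^esub> C' = I +>\<^bsub>R\<^esub> (s \<oplus>\<^bsub>R\<^esub> s')" unfolding s s' by (rule N_add[OF s(2) s'(2)])
    then show ?thesis unfolding N_carrier using s s' by blast
  qed
  show "r \<odot>\<^bsub>N\<^esub> C \<in> carrier N" if "r \<in> carrier R"
  proof -
    have "r \<odot>\<^bsub>N\<^esub> C = I +>\<^bsub>R\<^esub> (r \<otimes>\<^bsub>R\<^esub> s)" unfolding s by (rule N_smult[OF that s(2)])
    then show ?thesis unfolding N_carrier using s that by blast
  qed
qed

lemma relators_carrier: "tensor_relators R M N \<subseteq> carrier FA"
proof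
  fix t assume "t \<in> tensor_relators R M N"
  moreover have "u - v \<in> carrier FA" if "u \<in> carrier FA" "v \<in> carrier FA" for u v
    using that by (simp only: carrier_free_Abelian_group_iff) (meson Un_least keys_diff order.trans)
  moreover have "frag_of (x, C) \<in> carrier FA" if "x \<in> carrier M" "C \<in> carrier N" for x C
    using that by simp
  ultimately show "t \<in> carrier FA"
    by (elim tensor_relatorsE) (simp_all only: M.a_closed smult_closed N_closed)
qed

lemma T_subgroup: "subgroup T FA"
  unfolding tensor_relations_eq by (intro group.generate_is_subgroup relators_carrier) simp

lemma T_carrier: "t \<in> T \<Longrightarrow> t \<in> carrier FA"
  using subgroup.subset[OF T_subgroup] by blast

lemma T_zero: "0 \<in> T"
  using subgroup.one_closed[OF T_subgroup] by simp

lemma T_add: "s \<in> T \<Longrightarrow> t \<in> T \<Longrightarrow> s + t \<in> T"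
  using subgroup.m_closed[OF T_subgroup] by simp

lemma T_uminus: "t \<in> T \<Longrightarrow> - t \<in> T"
  using subgroup.m_inv_closed[OF T_subgroup, of t] T_carrier[of t] by simp

lemma T_diff: "s \<in> T \<Longrightarrow> t \<in> T \<Longrightarrow> s - t \<in> T"
  using T_add[of s "- t"] T_uminus by simp

lemma T_relator: "t \<in> tensor_relators R M N \<Longrightarrow> t \<in> T"
  unfolding tensor_relations_eq by (rule generate.incl)

lemma coset_eq_iff: "T #>\<^bsub>FA\<^esub> z = T #>\<^bsub>FA\<^esub> z' \<longleftrightarrow> z - z' \<in> T"
proof
  assume "T #>\<^bsub>FA\<^esub> z = T #>\<^bsub>FA\<^esub> z'"
  moreover have "z = 0 + z" by simp
  then have "z \<in> T #>\<^bsub>FA\<^esub> z" unfolding free_coset using T_zero by blast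
  ultimately obtain t where "t \<in> T" "z = t + z'" unfolding free_coset by blast
  then show "z - z' \<in> T" by simp
next
  assume d: "z - z' \<in> T"
  have "t + z = (t + (z - z')) + z'" "t + z' = (t - (z - z')) + z" for t by simp_all
  then show "T #>\<^bsub>FA\<^esub> z = T #>\<^bsub>FA\<^esub> z'" unfolding free_coset using T_add[OF _ d] T_diff[OF _ d] by blast
qed

text \<open>The class of \<open>x \<otimes> 1\<close>. It will be shown to give a surjection from
  \<open>M\<close> to the tensor product, with kernel \<open>I M\<close>.\<close>

definition cls where "cls x = T #>\<^bsub>FA\<^esub> frag_of (x, unit)"

lemma frag_add_T:
  assumes "x \<in> carrier M" "y \<in> carrier M"
  shows "frag_of (x \<oplus>\<^bsub>M\<^esub> y, unit) - frag_of (x, unit) - frag_of (y, unit) \<in> T"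
  using assms unit_N by (intro T_relator tensor_relatorsI)

lemma frag_minus_T:
  assumes "x \<in> carrier M" "y \<in> carrier M"
  shows "frag_of (x \<ominus>\<^bsub>M\<^esub> y, unit) - (frag_of (x, unit) - frag_of (y, unit)) \<in> T"
proof -
  have "x \<ominus>\<^bsub>M\<^esub> y \<oplus>\<^bsub>M\<^esub> y = x" using assms by (simp add: a_minus_def M.a_assoc M.l_neg)
  then have "frag_of (x, unit) - frag_of (x \<ominus>\<^bsub>M\<^esub> y, unit) - frag_of (y, unit) \<in> T"
    using frag_add_T[of "x \<ominus>\<^bsub>M\<^esub> y" y] assms by simp
  from T_uminus[OF this] show ?thesis by (simp add: algebra_simps)
qed

lemma frag_zero_T: "frag_of (\<zero>\<^bsub>M\<^esub>, unit) \<in> T"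
  using T_uminus[OF frag_add_T[of "\<zero>\<^bsub>M\<^esub>" "\<zero>\<^bsub>M\<^esub>"]] by simp

lemma frag_smult_T:
  assumes "r \<in> carrier R" "x \<in> carrier M"
  shows "frag_of (r \<odot>\<^bsub>M\<^esub> x, unit) - frag_of (x, I +>\<^bsub>R\<^esub> r) \<in> T"
proof -
  have "r \<odot>\<^bsub>N\<^esub> unit = I +>\<^bsub>R\<^esub> r" using N_smult[OF assms(1) R.one_closed] assms by (simp del: quot_module_simps)
  then show ?thesis using T_relator[OF tensor_relatorsI(3)[OF assms unit_N]] by metis
qed

text \<open>Since \<open>x \<otimes> (r + I) = (r x) \<otimes> 1\<close>, a sum of tensors collapses
  to a single \<open>x \<otimes> 1\<close>.\<close>

lemma represent_T:
  assumes "z \<in> carrier FA" shows "\<exists>x\<in>carrier M. z - frag_of (x, unit) \<in> T"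
proof -
  have "Poly_Mapping.keys z \<subseteq> carrier M \<times> carrier N" using assms by (simp del: quot_module_simps)
  then show ?thesis
  proof (rule free_Abelian_group_induct)
    show "\<exists>x\<in>carrier M. 0 - frag_of (x, unit) \<in> T" using T_uminus[OF frag_zero_T] by (intro bexI[of _ "\<zero>\<^bsub>M\<^esub>"]) auto
  next
    fix u v
    assume "\<exists>x\<in>carrier M. u - frag_of (x, unit) \<in> T" "\<exists>x\<in>carrier M. v - frag_of (x, unit) \<in> T"
    then obtain x y where *: "x \<in> carrier M" "u - frag_of (x, unit) \<in> T" "y \<in> carrier M" "v - frag_of (y, unit) \<in> T"
      by blast
    have "u - v - frag_of (x \<ominus>\<^bsub>M\<^esub> y, unit) = (u - frag_of (x, unit)) - (v - frag_of (y, unit))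
       - (frag_of (x \<ominus>\<^bsub>M\<^esub> y, unit) - (frag_of (x, unit) - frag_of (y, unit)))" by simp
    then have "u - v - frag_of (x \<ominus>\<^bsub>M\<^esub> y, unit) \<in> T" using * frag_minus_T by (simp only: T_diff)
    then show "\<exists>x\<in>carrier M. u - v - frag_of (x, unit) \<in> T" using * by blast
  next
    fix p assume "p \<in> carrier M \<times> carrier N"
    then obtain x r where p: "p = (x, I +>\<^bsub>R\<^esub> r)" "x \<in> carrier M" "r \<in> carrier R" unfolding N_carrier by blast
    then have "frag_of p - frag_of (r \<odot>\<^bsub>M\<^esub> x, unit) \<in> T" using T_uminus[OF frag_smult_T[of r x]] by simp
    then show "\<exists>x\<in>carrier M. frag_of p - frag_of (x, unit) \<in> T" using p by blast
  qed
qed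

lemma tensor_group_carrier: "carrier (tensor_group R M N) = cls ` carrier M"
proof -
  have "carrier (tensor_group R M N) = (\<lambda>z. T #>\<^bsub>FA\<^esub> z) ` carrier FA"
    unfolding tensor_group_def by (rule carrier_FactGroup)
  also have "\<dots> = cls ` carrier M"
  proof (intro equalityI subsetI)
    fix c assume "c \<in> (\<lambda>z. T #>\<^bsub>FA\<^esub> z) ` carrier FA"
    then obtain z where z: "z \<in> carrier FA" "c = T #>\<^bsub>FA\<^esub> z" by blast
    then obtain x where "x \<in> carrier M" "z - frag_of (x, unit) \<in> T" using represent_T by blast
    then have "x \<in> carrier M" "c = cls x" using coset_eq_iff z unfolding cls_def by blast+
    then show "c \<in> cls ` carrier M" by blast
  next
    fix c assume "c \<in> cls ` carrier M"
    then obtain x where x: "x \<in> carrier M" "c = cls x" by blast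
    then have "frag_of (x, unit) \<in> carrier FA" using unit_N by simp
    then show "c \<in> (\<lambda>z. T #>\<^bsub>FA\<^esub> z) ` carrier FA" using x unfolding cls_def by blast
  qed
  finally show ?thesis .
qed

text \<open>For \<open>r\<close> in \<open>I\<close> one has
  \<open>(r w) \<otimes> 1 = w \<otimes> r = w \<otimes> 0 = 0\<close>.\<close>

lemma ideal_smult_T:
  assumes "u \<in> IM" shows "frag_of (u, unit) \<in> T"
  using assms
proof induction
  case zero then show ?case by (rule frag_zero_T)
next
  case (step r w v)
  have IR: "I \<subseteq> carrier R" using ideal_carrier[OF I] by blast
  have c: "r \<in> carrier R" "w \<in> carrier M" "v \<in> carrier M" using step IR ideal_smult_carrier[OF IR] by blast+
  have z: "I +>\<^bsub>R\<^esub> r = I +>\<^bsub>R\<^esub> \<zero>\<^bsub>R\<^esub>"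
    using R.coset_eq_iff[OF I c(1) R.zero_closed] R.eq_mod_zero_iff[OF I c(1)] step by simp
  have zN: "I +>\<^bsub>R\<^esub> \<zero>\<^bsub>R\<^esub> \<in> carrier N" unfolding N_carrier by blast
  have "(I +>\<^bsub>R\<^esub> \<zero>\<^bsub>R\<^esub>) \<oplus>\<^bsub>N\<^esub> (I +>\<^bsub>R\<^esub> \<zero>\<^bsub>R\<^esub>) = I +>\<^bsub>R\<^esub> \<zero>\<^bsub>R\<^esub>"
    using N_add[OF R.zero_closed R.zero_closed] by (simp del: quot_module_simps)
  then have "frag_of (w, I +>\<^bsub>R\<^esub> \<zero>\<^bsub>R\<^esub>) - frag_of (w, I +>\<^bsub>R\<^esub> \<zero>\<^bsub>R\<^esub>) - frag_of (w, I +>\<^bsub>R\<^esub> \<zero>\<^bsub>R\<^esub>) \<in> T"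
    using T_relator[OF tensor_relatorsI(2)[OF c(2) zN zN]] by metis
  then have "frag_of (w, I +>\<^bsub>R\<^esub> \<zero>\<^bsub>R\<^esub>) \<in> T" using T_uminus by fastforce
  then have "frag_of (r \<odot>\<^bsub>M\<^esub> w, unit) \<in> T"
    using T_add[OF frag_smult_T[OF c(1,2)]] unfolding z by fastforce
  then have "frag_of (r \<odot>\<^bsub>M\<^esub> w \<oplus>\<^bsub>M\<^esub> v, unit) - frag_of (r \<odot>\<^bsub>M\<^esub> w, unit) - frag_of (v, unit)
      + (frag_of (r \<odot>\<^bsub>M\<^esub> w, unit) + frag_of (v, unit)) \<in> T"
    using c step.IH by (intro T_add frag_add_T) auto
  then show ?case by simp
qed

text \<open>Injectivity needs a map out of the tensor product. The map from \<open>(z, C)\<close> to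
  \<open>rep C\<close> times \<open>z\<close>, with a chosen representative of the coset, is not
  bilinear, but its extension to the free abelian group sends the relations into \<open>I M\<close>.
  This avoids constructing the module \<open>M/IM\<close>.\<close>

lemma T_frag_ideal_smult:
  assumes x: "x \<in> carrier M" "y \<in> carrier M" and t: "frag_of (x, unit) - frag_of (y, unit) \<in> T"
  shows "x \<ominus>\<^bsub>M\<^esub> y \<in> IM"
proof -
  have IR: "I \<subseteq> carrier R" using ideal_carrier[OF I] by blast
  have S: "submodule IM R M" by (rule ideal_smult_submodule[OF I]) simp
  note Ss = submodule_simps[OF S]
  define rep where "rep C = (SOME r. r \<in> carrier R \<and> C = I +>\<^bsub>R\<^esub> r)" for C
  have rep: "rep C \<in> carrier R" "C = I +>\<^bsub>R\<^esub> rep C" if "C \<in> carrier N" for C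
    using someI_ex[of "\<lambda>r. r \<in> carrier R \<and> C = I +>\<^bsub>R\<^esub> r"] that unfolding N_carrier rep_def by blast+
  have repI: "rep C \<ominus>\<^bsub>R\<^esub> r \<in> I" if "C = I +>\<^bsub>R\<^esub> r" "r \<in> carrier R" for C r
  proof -
    have C: "C \<in> carrier N" unfolding N_carrier using that by blast
    have "I +>\<^bsub>R\<^esub> rep C = I +>\<^bsub>R\<^esub> r" using rep(2)[OF C] that(1) by metis
    then show ?thesis using R.coset_eq_iff[OF I rep(1)[OF C] that(2)] by (simp add: eq_mod_def)
  qed
  define f where "f p = rep (snd p) \<odot>\<^bsub>M\<^esub> fst p" for p
  have "f ` (carrier M \<times> carrier N) \<subseteq> carrier (add_monoid M)"
    using rep by (auto simp: f_def simp del: quot_module_simps)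
  then obtain h where h: "h \<in> hom FA (add_monoid M)" "\<And>p. p \<in> carrier M \<times> carrier N \<Longrightarrow> h (frag_of p) = f p"
    by (rule comm_group.free_Abelian_group_universal[OF M.a_comm_group]) blast
  have hc: "h u \<in> carrier M" if "u \<in> carrier FA" for u using hom_in_carrier[OF h(1) that] by simp
  have hadd: "h (u + v) = h u \<oplus>\<^bsub>M\<^esub> h v" if "u \<in> carrier FA" "v \<in> carrier FA" for u v
    using hom_mult[OF h(1) that] by simp
  have hdiff: "h (u - v) = h u \<ominus>\<^bsub>M\<^esub> h v" "u - v \<in> carrier FA" if "u \<in> carrier FA" "v \<in> carrier FA" for u v
  proof -
    show d: "u - v \<in> carrier FA"
      using that by (simp only: carrier_free_Abelian_group_iff) (meson Un_least keys_diff order.trans)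
    have "h u = h (u - v) \<oplus>\<^bsub>M\<^esub> h v" using hadd[OF d that(2)] by simp
    then show "h (u - v) = h u \<ominus>\<^bsub>M\<^esub> h v" using hc d that by (simp add: a_minus_def M.a_assoc M.r_neg)
  qed
  have hf: "h (frag_of (z, C)) = rep C \<odot>\<^bsub>M\<^esub> z" "frag_of (z, C) \<in> carrier FA" if "z \<in> carrier M" "C \<in> carrier N" for z C
    using h(2)[of "(z, C)"] that by (auto simp: f_def simp del: quot_module_simps)
  have mem: "c \<odot>\<^bsub>M\<^esub> z \<in> IM" if "c \<in> I" "z \<in> carrier M" for c z
    using ideal_smult_mem[OF that IR] by simp
  have relator: "h t \<in> IM" if "t \<in> tensor_relators R M N" for t
    using that
  proof (cases rule: tensor_relatorsE)
    case (1 z z' C)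
    have "h t = rep C \<odot>\<^bsub>M\<^esub> (z \<oplus>\<^bsub>M\<^esub> z') \<ominus>\<^bsub>M\<^esub> rep C \<odot>\<^bsub>M\<^esub> z \<ominus>\<^bsub>M\<^esub> rep C \<odot>\<^bsub>M\<^esub> z'"
      using 1 by (simp add: hdiff hf del: quot_module_simps carrier_free_Abelian_group_iff)
    also have "\<dots> = \<zero>\<^bsub>M\<^esub>" using 1 rep[OF 1(4)]
      by (simp add: smult_r_distr a_minus_def M.a_ac M.r_neg M.r_neg2)
    finally show ?thesis using Ss(2) by simp
  next
    case (2 z C C')
    obtain r where r: "C \<oplus>\<^bsub>N\<^esub> C' = I +>\<^bsub>R\<^esub> r" "r = rep C \<oplus>\<^bsub>R\<^esub> rep C'" "r \<in> carrier R"
      using N_add[OF rep(1)[OF 2(3)] rep(1)[OF 2(4)]] rep 2 by (metis R.a_closed)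
    have CC: "C \<oplus>\<^bsub>N\<^esub> C' \<in> carrier N" using N_closed 2 by blast
    have c: "rep C \<in> carrier R" "rep C' \<in> carrier R" "rep (C \<oplus>\<^bsub>N\<^esub> C') \<in> carrier R"
      using rep(1) 2 CC by blast+
    have "h t = rep (C \<oplus>\<^bsub>N\<^esub> C') \<odot>\<^bsub>M\<^esub> z \<ominus>\<^bsub>M\<^esub> rep C \<odot>\<^bsub>M\<^esub> z \<ominus>\<^bsub>M\<^esub> rep C' \<odot>\<^bsub>M\<^esub> z"
      using 2 CC by (simp add: hdiff hf del: quot_module_simps carrier_free_Abelian_group_iff)
    also have "\<dots> = (rep (C \<oplus>\<^bsub>N\<^esub> C') \<ominus>\<^bsub>R\<^esub> r) \<odot>\<^bsub>M\<^esub> z"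
      unfolding r(2) using c 2(2)
      by (simp add: a_minus_def smult_l_distr smult_l_minus R.minus_add M.minus_add M.a_assoc del: quot_module_simps)
    finally show ?thesis using mem[OF repI[OF r(1,3)] 2(2)] by simp
  next
    case (3 s z C)
    have r: "s \<odot>\<^bsub>N\<^esub> C = I +>\<^bsub>R\<^esub> (s \<otimes>\<^bsub>R\<^esub> rep C)" "s \<otimes>\<^bsub>R\<^esub> rep C \<in> carrier R"
      using N_smult[OF 3(2) rep(1)[OF 3(4)]] rep[OF 3(4)] 3 by (metis, simp)
    have CC: "s \<odot>\<^bsub>N\<^esub> C \<in> carrier N" using N_closed 3 by blast
    have c: "rep C \<in> carrier R" "rep (s \<odot>\<^bsub>N\<^esub> C) \<in> carrier R" using rep(1) 3 CC by blast+
    have "h t = rep C \<odot>\<^bsub>M\<^esub> (s \<odot>\<^bsub>M\<^esub> z) \<ominus>\<^bsub>M\<^esub> rep (s \<odot>\<^bsub>N\<^esub> C) \<odot>\<^bsub>M\<^esub> z"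
      using 3 CC by (simp add: hdiff hf del: quot_module_simps carrier_free_Abelian_group_iff)
    also have "\<dots> = (\<ominus>\<^bsub>R\<^esub> (rep (s \<odot>\<^bsub>N\<^esub> C) \<ominus>\<^bsub>R\<^esub> s \<otimes>\<^bsub>R\<^esub> rep C)) \<odot>\<^bsub>M\<^esub> z"
      using c 3(2,3)
      by (simp add: a_minus_def smult_l_distr smult_l_minus R.minus_add M.minus_add smult_assoc1[symmetric]
          R.m_comm[of "rep C"] M.a_comm del: quot_module_simps)
    finally show ?thesis using mem[OF ideal_uminus[OF I repI[OF r]] 3(3)] by simp
  qed
  have "t \<in> carrier FA \<and> h t \<in> IM" if "t \<in> T" for t
    using that unfolding tensor_relations_eq
  proof (induction rule: generate.induct)
    case one
    have "0 \<in> carrier FA" using T_carrier[OF T_zero] .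
    moreover have "h 0 = h 0 \<oplus>\<^bsub>M\<^esub> h 0" using hadd[of 0 0] calculation by simp
    then have "h 0 = \<zero>\<^bsub>M\<^esub>" using hc[OF calculation] by (metis M.add.r_cancel_one')
    ultimately show ?case using Ss(2) by (simp del: quot_module_simps)
  next
    case (incl t)
    then show ?case using relator relators_carrier by blast
  next
    case (inv t)
    then have t: "t \<in> carrier FA" "h t \<in> IM" using relator relators_carrier by blast+
    have z: "0 \<in> carrier FA" using T_carrier[OF T_zero] .
    have "inv\<^bsub>FA\<^esub> t = 0 - t" using t by (simp del: quot_module_simps)
    moreover have "h 0 \<in> IM"
    proof -
      have "h 0 = h 0 \<oplus>\<^bsub>M\<^esub> h 0" using hadd[of 0 0] z by simp
      then show ?thesis using hc[OF z] Ss(2) by (metis M.add.r_cancel_one')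
    qed
    ultimately show ?case using hdiff[OF z t(1)] Ss(4) t by simp
  next
    case (eng u v)
    then have "u + v \<in> carrier FA"
      by (simp only: carrier_free_Abelian_group_iff) (meson Un_least keys_add order.trans)
    then show ?case using eng hadd Ss(3) by (simp del: quot_module_simps carrier_free_Abelian_group_iff)
  qed
  then have "h (frag_of (x, unit) - frag_of (y, unit)) \<in> IM" using t by blast
  moreover have "h (frag_of (x, unit) - frag_of (y, unit)) = rep unit \<odot>\<^bsub>M\<^esub> x \<ominus>\<^bsub>M\<^esub> rep unit \<odot>\<^bsub>M\<^esub> y"
    using hdiff(1)[OF hf(2)[OF x(1) unit_N] hf(2)[OF x(2) unit_N]] hf(1)[OF x(1) unit_N] hf(1)[OF x(2) unit_N] by simp
  moreover have ru: "rep unit \<in> carrier R" using rep unit_N by blast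
  ultimately have 1: "rep unit \<odot>\<^bsub>M\<^esub> (x \<ominus>\<^bsub>M\<^esub> y) \<in> IM"
    using x by (simp add: a_minus_def smult_r_distr smult_r_minus)
  \<comment> \<open>The chosen representative of the unit coset is only congruent to 1 modulo
    \<open>I\<close>; the difference contributes an element of \<open>I M\<close>.\<close>
  have 2: "(rep unit \<ominus>\<^bsub>R\<^esub> \<one>\<^bsub>R\<^esub>) \<odot>\<^bsub>M\<^esub> (x \<ominus>\<^bsub>M\<^esub> y) \<in> IM" using x repI[of unit "\<one>\<^bsub>R\<^esub>"] by (intro mem) auto
  have "rep unit \<odot>\<^bsub>M\<^esub> (x \<ominus>\<^bsub>M\<^esub> y) \<ominus>\<^bsub>M\<^esub> (rep unit \<ominus>\<^bsub>R\<^esub> \<one>\<^bsub>R\<^esub>) \<odot>\<^bsub>M\<^esub> (x \<ominus>\<^bsub>M\<^esub> y)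
     = (rep unit \<ominus>\<^bsub>R\<^esub> (rep unit \<ominus>\<^bsub>R\<^esub> \<one>\<^bsub>R\<^esub>)) \<odot>\<^bsub>M\<^esub> (x \<ominus>\<^bsub>M\<^esub> y)"
    using ru x by (simp add: a_minus_def smult_l_distr smult_l_minus)
  also have "rep unit \<ominus>\<^bsub>R\<^esub> (rep unit \<ominus>\<^bsub>R\<^esub> \<one>\<^bsub>R\<^esub>) = \<one>\<^bsub>R\<^esub>"
    using ru by (simp add: a_minus_def R.minus_add R.r_neg2)
  finally show ?thesis using Ss(4)[OF 1 2] x by simp
qed

lemma cls_eq_iff:
  assumes "x \<in> carrier M" "y \<in> carrier M"
  shows "cls x = cls y \<longleftrightarrow> x \<ominus>\<^bsub>M\<^esub> y \<in> IM"
proof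
  assume "cls x = cls y"
  then show "x \<ominus>\<^bsub>M\<^esub> y \<in> IM" unfolding cls_def coset_eq_iff using T_frag_ideal_smult assms by blast
next
  assume "x \<ominus>\<^bsub>M\<^esub> y \<in> IM"
  then have "frag_of (x \<ominus>\<^bsub>M\<^esub> y, unit) - (frag_of (x \<ominus>\<^bsub>M\<^esub> y, unit) - (frag_of (x, unit) - frag_of (y, unit))) \<in> T"
    using assms by (intro T_diff ideal_smult_T frag_minus_T)
  then show "cls x = cls y" unfolding cls_def coset_eq_iff by simp
qed

lemma cls_zero: "cls \<zero>\<^bsub>M\<^esub> = T"
proof -
  have "T #>\<^bsub>FA\<^esub> 0 = T" by (simp add: free_coset)
  moreover have "cls \<zero>\<^bsub>M\<^esub> = T #>\<^bsub>FA\<^esub> 0" unfolding cls_def coset_eq_iff using frag_zero_T by simp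
  ultimately show ?thesis by simp
qed

lemma cls_eq_one_iff:
  assumes "x \<in> carrier M"
  shows "cls x = \<one>\<^bsub>tensor_group R M N\<^esub> \<longleftrightarrow> x \<in> IM"
proof -
  have "\<ominus>\<^bsub>M\<^esub> \<zero>\<^bsub>M\<^esub> = \<zero>\<^bsub>M\<^esub>" using M.l_neg[OF M.zero_closed] by simp
  then have "x \<ominus>\<^bsub>M\<^esub> \<zero>\<^bsub>M\<^esub> = x" using M.r_zero[OF assms] unfolding a_minus_def by metis
  then show ?thesis
    using cls_eq_iff[OF assms M.zero_closed] unfolding cls_zero by (simp add: tensor_group_def)
qed

lemma cls_add:
  assumes "x \<in> carrier M" "y \<in> carrier M"
  shows "cls x \<otimes>\<^bsub>tensor_group R M N\<^esub> cls y = cls (x \<oplus>\<^bsub>M\<^esub> y)"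
proof -
  have "cls x \<otimes>\<^bsub>tensor_group R M N\<^esub> cls y = T #>\<^bsub>FA\<^esub> (frag_of (x, unit) + frag_of (y, unit))"
  proof -
    have "\<exists>s u. t + (a + b) = (s + a) + (u + b) \<and> s \<in> T \<and> u \<in> T" if "t \<in> T" for t a b :: "'c \<times> 'a set \<Rightarrow>\<^sub>0 int"
      using that T_zero by (intro exI[of _ t] exI[of _ 0]) (simp add: add.assoc)
    moreover have "\<exists>t. (s + a) + (u + b) = t + (a + b) \<and> t \<in> T" if "s \<in> T" "u \<in> T" for s u a b :: "'c \<times> 'a set \<Rightarrow>\<^sub>0 int"
      using T_add[OF that] by (intro exI[of _ "s + u"]) (simp add: algebra_simps)
    ultimately show ?thesis
      unfolding tensor_group_def mult_FactGroup cls_def free_coset free_set_mult by blast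
  qed
  also have "\<dots> = cls (x \<oplus>\<^bsub>M\<^esub> y)"
    unfolding cls_def coset_eq_iff using T_uminus[OF frag_add_T[OF assms]] by (simp add: algebra_simps)
  finally show ?thesis .
qed

end

text \<open>The map of free abelian groups carries relators to relators. Hence multiplying the image
  of a coset by the relation subgroup gives a single coset, that of
  \<open>f x \<otimes> g 1 = f x \<otimes> 1\<close>.\<close>

lemma tensor_map_cls:
  assumes M: "residue_tensor R M I" and M': "residue_tensor R M' I'"
    and f: "f \<in> module_hom R M M'" and g: "g \<in> module_hom R (quot_module R I) (quot_module R I')"
    and gone: "g (I +>\<^bsub>R\<^esub> \<one>\<^bsub>R\<^esub>) = I' +>\<^bsub>R\<^esub> \<one>\<^bsub>R\<^esub>"
  shows "tensor_map R M' (quot_module R I') f g (residue_tensor.cls R M I x) = residue_tensor.cls R M' I' (f x)"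
proof -
  interpret A: residue_tensor R M I by (rule M)
  interpret B: residue_tensor R M' I' by (rule M')
  let ?\<phi> = "frag_extend (\<lambda>(x, y). frag_of (f x, g y))"
  have relator: "?\<phi> t \<in> B.T" if "t \<in> tensor_relators R M A.N" for t
    using that
  proof (cases rule: tensor_relatorsE)
    case (1 x x' y)
    then have "?\<phi> t = frag_of (f x \<oplus>\<^bsub>M'\<^esub> f x', g y) - frag_of (f x, g y) - frag_of (f x', g y)"
      by (simp add: frag_extend_diff module_hom_add[OF f])
    then show ?thesis
      using 1 module_hom_closed[OF f] module_hom_closed[OF g] B.T_relator[OF tensor_relatorsI(1)] by metis
  next
    case (2 x y y')
    have "g (y \<oplus>\<^bsub>A.N\<^esub> y') = g y \<oplus>\<^bsub>B.N\<^esub> g y'" using module_hom_add[OF g] 2 by blast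
    then have "?\<phi> t = frag_of (f x, g y \<oplus>\<^bsub>B.N\<^esub> g y') - frag_of (f x, g y) - frag_of (f x, g y')"
      using 2 by (simp add: frag_extend_diff)
    then show ?thesis
      using 2 module_hom_closed[OF f] module_hom_closed[OF g] B.T_relator[OF tensor_relatorsI(2)] by metis
  next
    case (3 r x y)
    have "g (r \<odot>\<^bsub>A.N\<^esub> y) = r \<odot>\<^bsub>B.N\<^esub> g y" using module_hom_smult[OF g] 3 by blast
    then have "?\<phi> t = frag_of (r \<odot>\<^bsub>M'\<^esub> f x, g y) - frag_of (f x, r \<odot>\<^bsub>B.N\<^esub> g y)"
      using 3 by (simp add: frag_extend_diff module_hom_smult[OF f])
    then show ?thesis
      using 3 module_hom_closed[OF f] module_hom_closed[OF g] B.T_relator[OF tensor_relatorsI(3)] by metis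
  qed
  have "?\<phi> t \<in> B.T" if "t \<in> A.T" for t
    using that unfolding tensor_relations_eq[of R M]
  proof (induction rule: generate.induct)
    case one
    then show ?case using B.T_zero by simp
  next
    case (incl t)
    then show ?case by (rule relator)
  next
    case (inv t)
    then have "t \<in> carrier A.FA" using A.relators_carrier by blast
    then have "inv\<^bsub>A.FA\<^esub> t = - t" by simp
    then show ?case using relator[OF inv] B.T_uminus by (simp add: frag_extend_minus)
  next
    case (eng u v)
    then show ?case using B.T_add by (simp add: frag_extend_add)
  qed
  note \<phi>T = this
  let ?z = "frag_of (x, A.unit)"
  have z: "?\<phi> ?z = frag_of (f x, B.unit)" using gone by simp
  have "tensor_map R M' B.N f g (A.cls x) = {t + ?\<phi> (s + ?z) | t s. t \<in> B.T \<and> s \<in> A.T}"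
    unfolding tensor_map_def A.cls_def free_coset free_set_mult by blast
  also have "\<dots> = {(t + ?\<phi> s) + ?\<phi> ?z | t s. t \<in> B.T \<and> s \<in> A.T}"
    by (simp add: frag_extend_add add.assoc)
  also have "\<dots> = {t + ?\<phi> ?z | t. t \<in> B.T}"
  proof (intro equalityI subsetI)
    fix u assume "u \<in> {(t + ?\<phi> s) + ?\<phi> ?z | t s. t \<in> B.T \<and> s \<in> A.T}"
    then obtain t s where "u = (t + ?\<phi> s) + ?\<phi> ?z" "t \<in> B.T" "s \<in> A.T" by blast
    then show "u \<in> {t + ?\<phi> ?z | t. t \<in> B.T}" using B.T_add \<phi>T by blast
  next
    fix u assume "u \<in> {t + ?\<phi> ?z | t. t \<in> B.T}"
    then obtain t where "u = (t + ?\<phi> 0) + ?\<phi> ?z" "t \<in> B.T" by auto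
    then show "u \<in> {(t + ?\<phi> s) + ?\<phi> ?z | t s. t \<in> B.T \<and> s \<in> A.T}" using A.T_zero by blast
  qed
  also have "\<dots> = B.cls (f x)" unfolding z B.cls_def free_coset ..
  finally show ?thesis .
qed

section \<open>Syzygies in a free resolution\<close>

text \<open>The sum that occurs in \<open>free_module\<close>, with the basis replaced by an
  arbitrary family \<open>g\<close>.\<close>

definition free_lincomb ::
  "('a, 'r) ring_scheme \<Rightarrow> ('a, 'b, 'm) module_scheme \<Rightarrow> ('i \<Rightarrow> 'a) \<Rightarrow> ('i \<Rightarrow> 'b) \<Rightarrow> 'b" where
  "free_lincomb R M c g = finsum M (\<lambda>b. c b \<odot>\<^bsub>M\<^esub> g b) {b. c b \<noteq> \<zero>\<^bsub>R\<^esub>}"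

context module
begin

lemma free_lincomb_superset:
  assumes "finite A" "{b. c b \<noteq> \<zero>\<^bsub>R\<^esub>} \<subseteq> A" "range c \<subseteq> carrier R" "g ` A \<subseteq> carrier M"
  shows "free_lincomb R M c g = finsum M (\<lambda>b. c b \<odot>\<^bsub>M\<^esub> g b) A"
  unfolding free_lincomb_def
  using assms by (intro M.add.finprod_mono_neutral_cong_left) (auto simp: subset_iff image_subset_iff)

lemma free_lincomb_closed:
  assumes "range c \<subseteq> carrier R" "g ` {b. c b \<noteq> \<zero>\<^bsub>R\<^esub>} \<subseteq> carrier M"
  shows "free_lincomb R M c g \<in> carrier M"
  unfolding free_lincomb_def using assms by (intro M.finsum_closed) (auto simp: subset_iff image_subset_iff)

lemma free_lincomb_add:
  assumes c: "range c \<subseteq> carrier R" "finite {b. c b \<noteq> \<zero>\<^bsub>R\<^esub>}" "{b. c b \<noteq> \<zero>\<^bsub>R\<^esub>} \<subseteq> B"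
    and c': "range c' \<subseteq> carrier R" "finite {b. c' b \<noteq> \<zero>\<^bsub>R\<^esub>}" "{b. c' b \<noteq> \<zero>\<^bsub>R\<^esub>} \<subseteq> B"
    and g: "g ` B \<subseteq> carrier M"
  shows "free_lincomb R M (\<lambda>b. c b \<oplus>\<^bsub>R\<^esub> c' b) g = free_lincomb R M c g \<oplus>\<^bsub>M\<^esub> free_lincomb R M c' g"
proof -
  let ?A = "{b. c b \<noteq> \<zero>\<^bsub>R\<^esub>} \<union> {b. c' b \<noteq> \<zero>\<^bsub>R\<^esub>}"
  have fin: "finite ?A" using c c' by simp
  have gA: "g ` ?A \<subseteq> carrier M" using g c(3) c'(3) by blast
  have cR: "c b \<in> carrier R" "c' b \<in> carrier R" for b using c c' by auto
  have "free_lincomb R M (\<lambda>b. c b \<oplus>\<^bsub>R\<^esub> c' b) g = finsum M (\<lambda>b. (c b \<oplus>\<^bsub>R\<^esub> c' b) \<odot>\<^bsub>M\<^esub> g b) ?A"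
    using cR by (intro free_lincomb_superset fin gA) auto
  also have "\<dots> = finsum M (\<lambda>b. c b \<odot>\<^bsub>M\<^esub> g b \<oplus>\<^bsub>M\<^esub> c' b \<odot>\<^bsub>M\<^esub> g b) ?A"
    using gA cR by (intro M.finsum_cong') (auto simp: smult_l_distr image_subset_iff)
  also have "\<dots> = finsum M (\<lambda>b. c b \<odot>\<^bsub>M\<^esub> g b) ?A \<oplus>\<^bsub>M\<^esub> finsum M (\<lambda>b. c' b \<odot>\<^bsub>M\<^esub> g b) ?A"
    using gA cR by (intro M.finsum_addf) (auto simp: image_subset_iff)
  also have "\<dots> = free_lincomb R M c g \<oplus>\<^bsub>M\<^esub> free_lincomb R M c' g"
    using c c' by (simp add: free_lincomb_superset[OF fin _ _ gA])
  finally show ?thesis .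
qed

lemma free_lincomb_smult:
  assumes c: "range c \<subseteq> carrier R" "finite {b. c b \<noteq> \<zero>\<^bsub>R\<^esub>}" "{b. c b \<noteq> \<zero>\<^bsub>R\<^esub>} \<subseteq> B"
    and g: "g ` B \<subseteq> carrier M" and r: "r \<in> carrier R"
  shows "free_lincomb R M (\<lambda>b. r \<otimes>\<^bsub>R\<^esub> c b) g = r \<odot>\<^bsub>M\<^esub> free_lincomb R M c g"
proof -
  let ?A = "{b. c b \<noteq> \<zero>\<^bsub>R\<^esub>}"
  have gA: "g ` ?A \<subseteq> carrier M" using g c(3) by blast
  have cR: "c b \<in> carrier R" for b using c by auto
  have "free_lincomb R M (\<lambda>b. r \<otimes>\<^bsub>R\<^esub> c b) g = finsum M (\<lambda>b. (r \<otimes>\<^bsub>R\<^esub> c b) \<odot>\<^bsub>M\<^esub> g b) ?A"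
    using cR r c gA by (intro free_lincomb_superset) auto
  also have "\<dots> = finsum M (\<lambda>b. r \<odot>\<^bsub>M\<^esub> (c b \<odot>\<^bsub>M\<^esub> g b)) ?A"
    using gA cR r by (intro M.finsum_cong') (auto simp: smult_assoc1 image_subset_iff)
  also have "\<dots> = r \<odot>\<^bsub>M\<^esub> free_lincomb R M c g"
    unfolding free_lincomb_def using gA cR r c by (intro finsum_smult_ldistr[symmetric]) (auto simp: image_subset_iff)
  finally show ?thesis .
qed

end

lemma free_lincomb_hom:
  assumes M: "module R M" and N: "module R N" and f: "f \<in> module_hom R M N"
    and c: "range c \<subseteq> carrier R" "finite {b. c b \<noteq> \<zero>\<^bsub>R\<^esub>}" and g: "g ` {b. c b \<noteq> \<zero>\<^bsub>R\<^esub>} \<subseteq> carrier M"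
  shows "f (free_lincomb R M c g) = free_lincomb R N c (\<lambda>b. f (g b))"
proof -
  interpret M: module R M by (rule M)
  interpret N: module R N by (rule N)
  have cR: "c b \<in> carrier R" for b using c by auto
  have "f (finsum M (\<lambda>b. c b \<odot>\<^bsub>M\<^esub> g b) A) = finsum N (\<lambda>b. c b \<odot>\<^bsub>N\<^esub> f (g b)) A"
    if "finite A" "g ` A \<subseteq> carrier M" for A
    using that
  proof (induction A)
    case empty
    then show ?case using module_hom_zero[OF M N f] by simp
  next
    case (insert b A)
    then have gb: "g b \<in> carrier M" "\<And>a. a \<in> A \<Longrightarrow> g a \<in> carrier M" by auto
    have "finsum M (\<lambda>b. c b \<odot>\<^bsub>M\<^esub> g b) A \<in> carrier M" using gb cR by (intro M.finsum_closed) auto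
    then show ?case
      using insert gb cR module_hom_closed[OF f]
      by (simp add: M.finsum_insert N.finsum_insert Pi_def module_hom_add[OF f] module_hom_smult[OF f])
  qed
  then show ?thesis unfolding free_lincomb_def using c g by blast
qed

text \<open>Free modules are projective: preimages are chosen on the basis and extended by means of
  coordinates. The coordinates \<open>C v\<close> depend linearly on \<open>v\<close> because they
  are unique.\<close>

lemma free_module_lift:
  fixes R :: "('a, 'r) ring_scheme" and F :: "('a, 'b, 'm) module_scheme"
  assumes F: "free_module R F" and L: "module R L" and N: "module R N"
    and f: "f \<in> module_hom R F N" and g: "g \<in> module_hom R L N"
    and sub: "\<And>v. v \<in> carrier F \<Longrightarrow> f v \<in> g ` carrier L"
  shows "\<exists>h\<in>module_hom R F L. \<forall>v\<in>carrier F. g (h v) = f v"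
proof -
  interpret F: module R F using F by (simp add: free_module_def)
  interpret L: module R L by (rule L)
  interpret N: module R N by (rule N)
  define good where "good B c \<longleftrightarrow> range c \<subseteq> carrier R \<and> finite {b. c b \<noteq> \<zero>\<^bsub>R\<^esub>} \<and> {b. c b \<noteq> \<zero>\<^bsub>R\<^esub>} \<subseteq> B"
    for B and c :: "'b \<Rightarrow> 'a"
  obtain B where B: "B \<subseteq> carrier F"
      "\<And>v. v \<in> carrier F \<Longrightarrow> \<exists>!c. good B c \<and> v = free_lincomb R F c (\<lambda>b. b)"
    using F unfolding free_module_def good_def free_lincomb_def by (elim conjE exE) (simp add: conj_assoc)
  have "\<forall>v. \<exists>c. v \<in> carrier F \<longrightarrow> good B c \<and> v = free_lincomb R F c (\<lambda>b. b)" using B(2) by blast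
  then obtain C where C: "\<And>v. v \<in> carrier F \<Longrightarrow> good B (C v)"
      "\<And>v. v \<in> carrier F \<Longrightarrow> v = free_lincomb R F (C v) (\<lambda>b. b)" by metis
  have uniq: "C v = c" if "v \<in> carrier F" "good B c" "v = free_lincomb R F c (\<lambda>b. b)" for v c
    by (rule ex1E[OF B(2)[OF that(1)]]) (use C that in metis)
  have "\<forall>b. \<exists>l. b \<in> B \<longrightarrow> l \<in> carrier L \<and> g l = f b" using sub B(1) by (metis image_iff subsetD)
  then obtain l where l: "\<And>b. b \<in> B \<Longrightarrow> l b \<in> carrier L" "\<And>b. b \<in> B \<Longrightarrow> g (l b) = f b" by metis
  have lB: "l ` B \<subseteq> carrier L" and iB: "(\<lambda>b. b) ` B \<subseteq> carrier F" using l B by auto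
  define h where "h v = free_lincomb R L (C v) l" for v
  have CR: "C v b \<in> carrier R" if "v \<in> carrier F" for v b using C(1)[OF that] unfolding good_def by auto
  have "h \<in> module_hom R F L"
    unfolding module_hom_def
  proof (intro CollectI conjI ballI Pi_I)
    fix v assume v: "v \<in> carrier F"
    show "h v \<in> carrier L"
      unfolding h_def using C(1)[OF v] lB unfolding good_def by (intro L.free_lincomb_closed) blast+
  next
    fix v w assume vw: "v \<in> carrier F" "w \<in> carrier F"
    have G: "good B (C v)" "good B (C w)" using C vw by auto
    have "good B (\<lambda>b. C v b \<oplus>\<^bsub>R\<^esub> C w b)"
      unfolding good_def
    proof (intro conjI)
      show "range (\<lambda>b. C v b \<oplus>\<^bsub>R\<^esub> C w b) \<subseteq> carrier R" using CR vw by auto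
      have s: "{b. C v b \<oplus>\<^bsub>R\<^esub> C w b \<noteq> \<zero>\<^bsub>R\<^esub>} \<subseteq> {b. C v b \<noteq> \<zero>\<^bsub>R\<^esub>} \<union> {b. C w b \<noteq> \<zero>\<^bsub>R\<^esub>}" by auto
      show "finite {b. C v b \<oplus>\<^bsub>R\<^esub> C w b \<noteq> \<zero>\<^bsub>R\<^esub>}" using G finite_subset[OF s] unfolding good_def by simp
      show "{b. C v b \<oplus>\<^bsub>R\<^esub> C w b \<noteq> \<zero>\<^bsub>R\<^esub>} \<subseteq> B" using G s unfolding good_def by blast
    qed
    moreover have "v \<oplus>\<^bsub>F\<^esub> w = free_lincomb R F (\<lambda>b. C v b \<oplus>\<^bsub>R\<^esub> C w b) (\<lambda>b. b)"
      using F.free_lincomb_add[of "C v" B "C w" "\<lambda>b. b"] G iB C(2)[OF vw(1)] C(2)[OF vw(2)]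
      unfolding good_def by metis
    ultimately have "C (v \<oplus>\<^bsub>F\<^esub> w) = (\<lambda>b. C v b \<oplus>\<^bsub>R\<^esub> C w b)" by (rule uniq[OF F.M.a_closed[OF vw]])
    note Ceq = this
    show "h (v \<oplus>\<^bsub>F\<^esub> w) = h v \<oplus>\<^bsub>L\<^esub> h w"
      unfolding h_def Ceq using G lB unfolding good_def by (intro L.free_lincomb_add[where B=B]) blast+
  next
    fix r v assume rv: "r \<in> carrier R" "v \<in> carrier F"
    have G: "good B (C v)" using C rv by auto
    have "good B (\<lambda>b. r \<otimes>\<^bsub>R\<^esub> C v b)"
      unfolding good_def
    proof (intro conjI)
      show "range (\<lambda>b. r \<otimes>\<^bsub>R\<^esub> C v b) \<subseteq> carrier R" using CR rv by auto
      have s: "{b. r \<otimes>\<^bsub>R\<^esub> C v b \<noteq> \<zero>\<^bsub>R\<^esub>} \<subseteq> {b. C v b \<noteq> \<zero>\<^bsub>R\<^esub>}" using rv by auto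
      show "finite {b. r \<otimes>\<^bsub>R\<^esub> C v b \<noteq> \<zero>\<^bsub>R\<^esub>}" using G finite_subset[OF s] unfolding good_def by simp
      show "{b. r \<otimes>\<^bsub>R\<^esub> C v b \<noteq> \<zero>\<^bsub>R\<^esub>} \<subseteq> B" using G s unfolding good_def by blast
    qed
    moreover have "r \<odot>\<^bsub>F\<^esub> v = free_lincomb R F (\<lambda>b. r \<otimes>\<^bsub>R\<^esub> C v b) (\<lambda>b. b)"
      using F.free_lincomb_smult[of "C v" B "\<lambda>b. b" r] G iB C(2)[OF rv(2)] rv unfolding good_def by metis
    ultimately have "C (r \<odot>\<^bsub>F\<^esub> v) = (\<lambda>b. r \<otimes>\<^bsub>R\<^esub> C v b)" by (rule uniq[OF F.smult_closed[OF rv]])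
    note Ceq = this
    show "h (r \<odot>\<^bsub>F\<^esub> v) = r \<odot>\<^bsub>L\<^esub> h v"
      unfolding h_def Ceq using G lB rv unfolding good_def by (intro L.free_lincomb_smult[where B=B]) blast+
  qed
  moreover have "g (h v) = f v" if v: "v \<in> carrier F" for v
  proof -
    have G: "range (C v) \<subseteq> carrier R" "finite {b. C v b \<noteq> \<zero>\<^bsub>R\<^esub>}" "{b. C v b \<noteq> \<zero>\<^bsub>R\<^esub>} \<subseteq> B"
      using C(1)[OF v] unfolding good_def by auto
    have "g (h v) = free_lincomb R N (C v) (\<lambda>b. g (l b))"
      unfolding h_def using G lB by (intro free_lincomb_hom[OF L N g]) blast+
    also have "\<dots> = free_lincomb R N (C v) f"
      unfolding free_lincomb_def using G l(2) CR[OF v] module_hom_closed[OF f] B(1)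
      by (intro N.finsum_cong') auto
    also have "\<dots> = f (free_lincomb R F (C v) (\<lambda>b. b))"
      using G B(1) by (intro free_lincomb_hom[OF F.module_axioms N f, symmetric]) auto
    also have "\<dots> = f v" using C(2)[OF v] by simp
    finally show ?thesis .
  qed
  ultimately show ?thesis by blast
qed

section \<open>Operations on homomorphisms, and homomorphisms out of \<open>R^k\<close>\<close>

lemma module_hom_compose:
  "f \<in> module_hom R L M \<Longrightarrow> g \<in> module_hom R M N \<Longrightarrow> (\<lambda>v. g (f v)) \<in> module_hom R L N"
  by (auto simp: module_hom_def Pi_def)

lemma module_hom_id: "(\<lambda>v. v) \<in> module_hom R M M"
  by (auto simp: module_hom_def)

lemma module_hom_diff:
  assumes M: "module R M" and N: "module R N" and f: "f \<in> module_hom R M N" and g: "g \<in> module_hom R M N"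
  shows "(\<lambda>v. f v \<ominus>\<^bsub>N\<^esub> g v) \<in> module_hom R M N"
proof -
  interpret M: module R M by (rule M)
  interpret N: module R N by (rule N)
  note c = module_hom_closed[OF f] module_hom_closed[OF g]
  show ?thesis unfolding module_hom_def
    using c by (auto simp: module_hom_add[OF f] module_hom_add[OF g] module_hom_smult[OF f] module_hom_smult[OF g]
        a_minus_def N.minus_add N.a_ac N.smult_r_distr N.smult_r_minus)
qed

lemma module_hom_scale:
  assumes M: "module R M" and f: "f \<in> module_hom R L M" and c: "c \<in> carrier R"
  shows "(\<lambda>v. c \<odot>\<^bsub>M\<^esub> f v) \<in> module_hom R L M"
proof -
  interpret M: module R M by (rule M)
  show ?thesis unfolding module_hom_def
    using c module_hom_closed[OF f]
    by (auto simp: module_hom_add[OF f] module_hom_smult[OF f] M.smult_r_distr M.smult_assoc1[symmetric] M.R.m_comm)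
qed

definition ring_module :: "('a, 'r) ring_scheme \<Rightarrow> ('a, 'a) module" where
  "ring_module R = \<lparr> carrier = carrier R, monoid.mult = monoid.mult R, monoid.one = monoid.one R,
     ring.zero = ring.zero R, ring.add = ring.add R, smult = monoid.mult R \<rparr>"

lemma ring_module_simps [simp]:
  "carrier (ring_module R) = carrier R" "\<zero>\<^bsub>ring_module R\<^esub> = \<zero>\<^bsub>R\<^esub>"
  "x \<oplus>\<^bsub>ring_module R\<^esub> y = x \<oplus>\<^bsub>R\<^esub> y" "r \<odot>\<^bsub>ring_module R\<^esub> x = r \<otimes>\<^bsub>R\<^esub> x"
  by (simp_all add: ring_module_def)

lemma (in cring) ring_module_module: "module R (ring_module R)"
proof (rule moduleI[OF is_cring])
  show "abelian_group (ring_module R)"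
    by (rule abelian_groupI) (auto simp: a_ac intro!: bexI[of _ "\<ominus> _"] l_neg)
qed (auto simp: l_distr r_distr m_assoc)

primrec module_dot :: "('a, 'b, 'm) module_scheme \<Rightarrow> nat \<Rightarrow> (nat \<Rightarrow> 'a) \<Rightarrow> (nat \<Rightarrow> 'b) \<Rightarrow> 'b" where
  "module_dot M 0 v g = \<zero>\<^bsub>M\<^esub>"
| "module_dot M (Suc k) v g = module_dot M k v g \<oplus>\<^bsub>M\<^esub> v k \<odot>\<^bsub>M\<^esub> g k"

context module
begin

lemma module_dot_closed:
  "(\<And>i. i < k \<Longrightarrow> v i \<in> carrier R) \<Longrightarrow> (\<And>i. i < k \<Longrightarrow> g i \<in> carrier M) \<Longrightarrow> module_dot M k v g \<in> carrier M"
  by (induction k) auto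

lemma module_dot_hom:
  assumes g: "\<And>i. i < k \<Longrightarrow> g i \<in> carrier M"
  shows "(\<lambda>v. module_dot M k v g) \<in> module_hom R (vec R k) M"
proof -
  have add: "module_dot M j (\<lambda>i. v i \<oplus>\<^bsub>R\<^esub> w i) g = module_dot M j v g \<oplus>\<^bsub>M\<^esub> module_dot M j w g"
    if "\<And>i. v i \<in> carrier R" "\<And>i. w i \<in> carrier R" "j \<le> k" for v w j
    using that(3)
  proof (induction j)
    case (Suc j)
    have "module_dot M j v g \<in> carrier M" "module_dot M j w g \<in> carrier M"
      using that g Suc.prems by (auto intro!: module_dot_closed)
    then show ?case using Suc that g[of j] by (simp add: smult_l_distr M.a_ac)
  qed simp
  have smult: "module_dot M j (\<lambda>i. r \<otimes>\<^bsub>R\<^esub> v i) g = r \<odot>\<^bsub>M\<^esub> module_dot M j v g"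
    if "\<And>i. v i \<in> carrier R" "r \<in> carrier R" "j \<le> k" for v r j
    using that(3)
  proof (induction j)
    case (Suc j)
    have "module_dot M j v g \<in> carrier M"
      using that g Suc.prems by (auto intro!: module_dot_closed)
    then show ?case using Suc that g[of j] by (simp add: smult_r_distr smult_assoc1)
  qed (use that in simp)
  show ?thesis unfolding module_hom_def
  proof (intro CollectI conjI ballI Pi_I)
    fix v assume v: "v \<in> carrier (vec R k)"
    note vR = R.vec_carrier[OF v]
    show "module_dot M k v g \<in> carrier M" using vR g by (intro module_dot_closed) auto
    show "module_dot M k (r \<odot>\<^bsub>vec R k\<^esub> v) g = r \<odot>\<^bsub>M\<^esub> module_dot M k v g" if "r \<in> carrier R" for r
      using smult[OF vR that, of k] by simp
    show "module_dot M k (v \<oplus>\<^bsub>vec R k\<^esub> w) g = module_dot M k v g \<oplus>\<^bsub>M\<^esub> module_dot M k w g"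
      if w: "w \<in> carrier (vec R k)" for w
      using add[OF vR R.vec_carrier[OF w], of k] by simp
  qed
qed

end

lemma module_dot_ring_module: "module_dot (ring_module R) k v g = dot R k v g"
  by (induction k) auto

lemma module_dot_image:
  assumes M: "module R M" and N: "module R N" and f: "f \<in> module_hom R M N"
    and "\<And>i. i < k \<Longrightarrow> v i \<in> carrier R" "\<And>i. i < k \<Longrightarrow> g i \<in> carrier M"
  shows "f (module_dot M k v g) = module_dot N k v (\<lambda>i. f (g i))"
  using assms(4,5)
proof (induction k)
  case 0
  then show ?case using module_hom_zero[OF M N f] by simp
next
  case (Suc k)
  interpret M: module R M by (rule M)
  have "module_dot M k v g \<in> carrier M" using Suc.prems by (auto intro!: M.module_dot_closed)
  then show ?case using Suc by (simp add: module_hom_add[OF f] module_hom_smult[OF f])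
qed

lemma (in module) module_dot_scaled:
  assumes "\<And>i. i < k \<Longrightarrow> v i \<in> carrier R" "\<And>i. i < k \<Longrightarrow> x i \<in> carrier R" "u \<in> carrier M"
  shows "module_dot M k v (\<lambda>i. x i \<odot>\<^bsub>M\<^esub> u) = dot R k v x \<odot>\<^bsub>M\<^esub> u"
  using assms by (induction k) (auto simp: smult_l_distr smult_assoc1)

lemma free_resolution_simps:
  assumes "free_resolution R F d e N"
  shows resolution_module: "module R (F i)" and resolution_free: "free_module R (F i)"
    and resolution_aug: "e \<in> module_hom R (F 0) N" and resolution_diff: "d i \<in> module_hom R (F (Suc i)) (F i)"
    and resolution_surj: "e ` carrier (F 0) = carrier N"
    and resolution_exact_0: "d 0 ` carrier (F (Suc 0)) = {v \<in> carrier (F 0). e v = \<zero>\<^bsub>N\<^esub>}"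
    and resolution_exact: "d (Suc i) ` carrier (F (Suc (Suc i))) = {v \<in> carrier (F (Suc i)). d i v = \<zero>\<^bsub>F i\<^esub>}"
    and resolution_N: "module R N"
  using assms unfolding free_resolution_def free_module_def One_nat_def by blast+

definition resolution_split ::
  "('a, 'r) ring_scheme \<Rightarrow> 'a set \<Rightarrow> (nat \<Rightarrow> ('a, 'b, 'm) module_scheme) \<Rightarrow> (nat \<Rightarrow> 'b \<Rightarrow> 'b) \<Rightarrow> bool" where
  "resolution_split R m F d \<longleftrightarrow>
     (\<forall>z\<in>ideal_smult R (F 1) (ideal_pow R m 2) (carrier (F 1)). d 0 z = \<zero>\<^bsub>F 0\<^esub> \<longrightarrow>
        z \<in> ideal_smult R (F 1) m {z \<in> carrier (F 1). d 0 z = \<zero>\<^bsub>F 0\<^esub>})"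

text \<open>Both directions compare \<open>F\<close> with the complex \<open>R\<^sup>k \<rightarrow> R\<close> given by generators
  \<open>x\<close> of \<open>m\<close>; the chain maps are \<open>\<phi>\<close> and \<open>\<psi>\<close>, and \<open>s\<close> is a homotopy.\<close>

lemma resolution_split_iff:
  assumes loc: "noetherian_local R m" and res: "free_resolution R F d e (quot_module R m)"
    and x: "\<And>i. i < k \<Longrightarrow> x i \<in> carrier R" and gen: "m = lincombs R k x"
  shows "resolution_split R m F d \<longleftrightarrow> quadratic_syzygies_split R m k x"
proof -
  interpret R: noetherian_local R m by (rule loc)
  note F = resolution_module[OF res] and free = resolution_free[OF res] and N = resolution_N[OF res]
    and eh = resolution_aug[OF res] and dh = resolution_diff[OF res]
  interpret F0: module R "F 0" by (rule F)
  interpret F1: module R "F (Suc 0)" by (rule F)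
  interpret V: module R "vec R k" by (rule R.vec_module)
  interpret A: module R "ring_module R" by (rule R.ring_module_module)
  let ?N = "quot_module R m"
  have id: "ideal m R" by (rule R.m_ideal)
  have id2: "ideal (ideal_pow R m 2) R" by (rule R.ideal_pow_ideal[OF id])
  have mR: "m \<subseteq> carrier R" and m2R: "ideal_pow R m 2 \<subseteq> carrier R"
    using ideal_carrier[OF id] ideal_carrier[OF id2] by auto
  have m2m: "ideal_pow R m 2 \<subseteq> m" using R.ideal_pow_antimono[OF id, of 1 2] R.ideal_pow_1[OF id] by simp
  have cos0: "m +>\<^bsub>R\<^esub> r = \<zero>\<^bsub>?N\<^esub> \<longleftrightarrow> r \<in> m" if "r \<in> carrier R" for r
  proof -
    have "\<zero>\<^bsub>?N\<^esub> = m" by (simp add: FactRing_def)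
    moreover have "m +>\<^bsub>R\<^esub> \<zero>\<^bsub>R\<^esub> = m" using R.a_rcos_zero[OF id ideal_zero[OF id]] .
    ultimately show ?thesis using R.coset_eq_iff[OF id that R.zero_closed] R.eq_mod_zero_iff[OF id that] by simp
  qed
  have smN: "r \<odot>\<^bsub>?N\<^esub> (m +>\<^bsub>R\<^esub> s) = m +>\<^bsub>R\<^esub> (r \<otimes>\<^bsub>R\<^esub> s)" if "r \<in> carrier R" "s \<in> carrier R" for r s
    unfolding quot_module_simps by (rule R.Quot_mult[OF id that])
  have addN: "(m +>\<^bsub>R\<^esub> r) \<oplus>\<^bsub>?N\<^esub> (m +>\<^bsub>R\<^esub> s) = m +>\<^bsub>R\<^esub> (r \<oplus>\<^bsub>R\<^esub> s)" if "r \<in> carrier R" "s \<in> carrier R" for r s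
    unfolding quot_module_simps by (rule R.Quot_add[OF id that])
  have Nc: "carrier ?N = {m +>\<^bsub>R\<^esub> r | r. r \<in> carrier R}"
    unfolding quot_module_simps by (rule R.Quot_carrier[OF id])
  have \<pi>: "(\<lambda>r. m +>\<^bsub>R\<^esub> r) \<in> module_hom R (ring_module R) ?N"
    unfolding module_hom_def
  proof (intro CollectI conjI ballI Pi_I)
    fix r assume "r \<in> carrier (ring_module R)"
    then show "m +>\<^bsub>R\<^esub> r \<in> carrier ?N" unfolding Nc by auto
  qed (simp_all only: ring_module_simps addN smN)
  have "e v \<in> (\<lambda>r. m +>\<^bsub>R\<^esub> r) ` carrier (ring_module R)" if "v \<in> carrier (F 0)" for v
    using module_hom_closed[OF eh that] unfolding Nc by auto
  \<comment> \<open>The chain map in degree 0: the augmentation \<open>e\<close>, lifted through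
    \<open>R \<rightarrow> R/m\<close>.\<close>
  then obtain \<phi>0 where \<phi>0: "\<phi>0 \<in> module_hom R (F 0) (ring_module R)"
      "\<And>v. v \<in> carrier (F 0) \<Longrightarrow> m +>\<^bsub>R\<^esub> \<phi>0 v = e v"
    using free_module_lift[OF free R.ring_module_module N eh \<pi>] by blast
  have \<phi>0R: "\<phi>0 v \<in> carrier R" if "v \<in> carrier (F 0)" for v using module_hom_closed[OF \<phi>0(1) that] by simp
  have "m +>\<^bsub>R\<^esub> \<one>\<^bsub>R\<^esub> \<in> e ` carrier (F 0)" unfolding resolution_surj[OF res] Nc by blast
  \<comment> \<open>\<open>u\<close> takes the role of 1 in \<open>F 0\<close>. Since
    \<open>x i\<close> kills the residue field, \<open>x i\<close> times \<open>u\<close> is the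
    image of some \<open>g i\<close> in \<open>F 1\<close>, and these elements define
    \<open>\<psi>\<close>.\<close>
  then obtain u where u: "u \<in> carrier (F 0)" "e u = m +>\<^bsub>R\<^esub> \<one>\<^bsub>R\<^esub>" by auto
  have em: "\<phi>0 v \<in> m" if "v \<in> carrier (F 0)" "e v = \<zero>\<^bsub>?N\<^esub>" for v
    using cos0[OF \<phi>0R[OF that(1)]] \<phi>0(2)[OF that(1)] that(2) by simp
  have ex0: "v \<in> d 0 ` carrier (F (Suc 0)) \<longleftrightarrow> v \<in> carrier (F 0) \<and> e v = \<zero>\<^bsub>?N\<^esub>" for v
    unfolding resolution_exact_0[OF res] by blast
  have "x i \<odot>\<^bsub>F 0\<^esub> u \<in> d 0 ` carrier (F (Suc 0))" if i: "i < k" for i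
  proof -
    have "e (x i \<odot>\<^bsub>F 0\<^esub> u) = x i \<odot>\<^bsub>?N\<^esub> (m +>\<^bsub>R\<^esub> \<one>\<^bsub>R\<^esub>)"
      using module_hom_smult[OF eh x[OF i] u(1)] u(2) by metis
    also have "\<dots> = m +>\<^bsub>R\<^esub> x i" using smN[OF x[OF i] R.one_closed] x[OF i] by (simp only: R.r_one)
    also have "\<dots> = \<zero>\<^bsub>?N\<^esub>"
      using cos0[OF x[OF i]] R.mem_lincombs[of k x i, OF x i] gen by blast
    finally show ?thesis unfolding ex0 using x[OF i] u by blast
  qed
  then have "\<forall>i. \<exists>g. i < k \<longrightarrow> g \<in> carrier (F (Suc 0)) \<and> d 0 g = x i \<odot>\<^bsub>F 0\<^esub> u" by (metis imageE)
  then obtain g where g: "\<And>i. i < k \<Longrightarrow> g i \<in> carrier (F (Suc 0))" "\<And>i. i < k \<Longrightarrow> d 0 (g i) = x i \<odot>\<^bsub>F 0\<^esub> u"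
    by metis
  define \<psi> where "\<psi> v = module_dot (F (Suc 0)) k v g" for v
  have \<psi>: "\<psi> \<in> module_hom R (vec R k) (F (Suc 0))" unfolding \<psi>_def using g by (intro F1.module_dot_hom)
  have d\<psi>: "d 0 (\<psi> v) = dot R k v x \<odot>\<^bsub>F 0\<^esub> u" if v: "v \<in> carrier (vec R k)" for v
  proof -
    have vR: "v i \<in> carrier R" for i using R.vec_carrier[OF v] .
    have "d 0 (\<psi> v) = module_dot (F 0) k v (\<lambda>i. d 0 (g i))"
      unfolding \<psi>_def using vR g by (intro module_dot_image[OF F F dh])
    also have "\<dots> = module_dot (F 0) k v (\<lambda>i. x i \<odot>\<^bsub>F 0\<^esub> u)"
      using g(2) by (induction k) auto
    also have "\<dots> = dot R k v x \<odot>\<^bsub>F 0\<^esub> u" using vR x u by (intro F0.module_dot_scaled)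
    finally show ?thesis .
  qed
  define \<xi> where "\<xi> v = dot R k v x" for v
  have \<xi>: "\<xi> \<in> module_hom R (vec R k) (ring_module R)"
    using A.module_dot_hom[of k x] x unfolding \<xi>_def module_dot_ring_module by simp
  have "\<phi>0 (d 0 v) \<in> \<xi> ` carrier (vec R k)" if v: "v \<in> carrier (F (Suc 0))" for v
  proof -
    have "d 0 v \<in> d 0 ` carrier (F (Suc 0))" using v by blast
    then have "\<phi>0 (d 0 v) \<in> lincombs R k x" using em gen unfolding ex0 by blast
    then obtain c where c: "\<forall>i<k. c i \<in> carrier R" "\<phi>0 (d 0 v) = dot R k c x" by (auto simp: lincombs_def)
    have "\<phi>0 (d 0 v) = \<xi> (\<lambda>i. if i < k then c i else \<zero>\<^bsub>R\<^esub>)"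
      unfolding c(2) \<xi>_def by (rule dot_cong) auto
    then show ?thesis using c by (intro image_eqI) auto
  qed
  then obtain \<phi> where \<phi>: "\<phi> \<in> module_hom R (F (Suc 0)) (vec R k)"
      "\<And>v. v \<in> carrier (F (Suc 0)) \<Longrightarrow> dot R k (\<phi> v) x = \<phi>0 (d 0 v)"
    using free_module_lift[OF free R.vec_module R.ring_module_module module_hom_compose[OF dh \<phi>0(1)] \<xi>]
    unfolding \<xi>_def by blast
  let ?syz = "{z \<in> carrier (vec R k). dot R k z x = \<zero>\<^bsub>R\<^esub>}"
  let ?Z = "{z \<in> carrier (F (Suc 0)). d 0 z = \<zero>\<^bsub>F 0\<^esub>}"
  have \<phi>Z: "\<phi> z \<in> ?syz" if "z \<in> ?Z" for z
    using that \<phi>(2)[of z] module_hom_closed[OF \<phi>(1)] module_hom_zero[OF F R.ring_module_module \<phi>0(1)]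
    by (simp del: vec_simps)
  have \<psi>syz: "\<psi> z \<in> ?Z" if "z \<in> ?syz" for z
    using that d\<psi>[of z] module_hom_closed[OF \<psi>] u by (simp del: vec_simps)
  show ?thesis
  proof
    assume split: "resolution_split R m F d"
    show "quadratic_syzygies_split R m k x"
      unfolding quadratic_syzygies_split_def
    proof (intro ballI impI, elim conjE)
      fix r assume r: "r \<in> carrier (vec R k)" "\<forall>i<k. r i \<in> ideal_pow R m 2" "dot R k r x = \<zero>\<^bsub>R\<^esub>"
      have "r \<in> ?syz" using r by blast
      then have "\<psi> r \<in> ?Z" by (rule \<psi>syz)
      have r2: "r \<in> ideal_smult R (vec R k) (ideal_pow R m 2) (carrier (vec R k))"
        using r by (intro R.vec_mem_ideal_smult[OF id2]) auto
      have "\<psi> r \<in> ideal_smult R (F (Suc 0)) (ideal_pow R m 2) (carrier (F (Suc 0)))"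
        using module_hom_ideal_smult[OF R.vec_module F \<psi> m2R _ _ r2] module_hom_closed[OF \<psi>] by blast
      then have "\<psi> r \<in> ideal_smult R (F (Suc 0)) m ?Z"
        using split \<open>\<psi> r \<in> ?Z\<close> unfolding resolution_split_def by simp
      then have 1: "\<phi> (\<psi> r) \<in> ideal_smult R (vec R k) m ?syz"
        by (intro module_hom_ideal_smult[OF F R.vec_module \<phi>(1) mR _ \<phi>Z]) auto
      \<comment> \<open>The composite \<open>R \<rightarrow> F 0 \<rightarrow> R\<close> is
        multiplication by \<open>c\<close>, which is congruent to 1 modulo \<open>m\<close> and
        hence a unit. So \<open>\<phi> \<psi> - c\<close> maps \<open>R^k\<close> into the syzygies
        and \<open>m^2 R^k\<close> into \<open>m^2\<close> times the syzygies; dividing by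
        \<open>c\<close> replaces a homotopy on this side.\<close>
      define c where "c = \<phi>0 u"
      have cR: "c \<in> carrier R" using \<phi>0R u by (simp add: c_def)
      define H where "H v = \<phi> (\<psi> v) \<ominus>\<^bsub>vec R k\<^esub> c \<odot>\<^bsub>vec R k\<^esub> v" for v
      have Hh: "H \<in> module_hom R (vec R k) (vec R k)"
        unfolding H_def using cR
        by (intro module_hom_diff module_hom_scale R.vec_module module_hom_id module_hom_compose[OF \<psi> \<phi>(1)])
      have Hsyz: "H v \<in> ?syz" if v: "v \<in> carrier (vec R k)" for v
      proof -
        have \<psi>v: "\<psi> v \<in> carrier (F (Suc 0))" using module_hom_closed[OF \<psi> v] .
        have \<phi>v: "\<phi> (\<psi> v) \<in> carrier (vec R k)" using module_hom_closed[OF \<phi>(1) \<psi>v] .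
        have cv: "c \<odot>\<^bsub>vec R k\<^esub> v \<in> carrier (vec R k)" using V.smult_closed cR v by blast
        have dR: "dot R k v x \<in> carrier R" using x R.vec_carrier[OF v] by auto
        have "\<xi> (H v) = \<xi> (\<phi> (\<psi> v)) \<ominus>\<^bsub>ring_module R\<^esub> \<xi> (c \<odot>\<^bsub>vec R k\<^esub> v)"
          unfolding H_def by (rule module_hom_minus[OF R.vec_module R.ring_module_module \<xi> \<phi>v cv])
        also have "\<xi> (\<phi> (\<psi> v)) = \<phi>0 (dot R k v x \<odot>\<^bsub>F 0\<^esub> u)"
          unfolding \<xi>_def \<phi>(2)[OF \<psi>v] d\<psi>[OF v] ..
        also have "\<dots> = c \<odot>\<^bsub>ring_module R\<^esub> \<xi> v"
          using module_hom_smult[OF \<phi>0(1) dR u(1)] cR dR by (simp add: c_def \<xi>_def R.m_comm)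
        also have "\<xi> (c \<odot>\<^bsub>vec R k\<^esub> v) = c \<odot>\<^bsub>ring_module R\<^esub> \<xi> v" by (rule module_hom_smult[OF \<xi> cR v])
        also have "c \<odot>\<^bsub>ring_module R\<^esub> \<xi> v \<ominus>\<^bsub>ring_module R\<^esub> c \<odot>\<^bsub>ring_module R\<^esub> \<xi> v = \<zero>\<^bsub>ring_module R\<^esub>"
          unfolding a_minus_def using cR dR by (intro A.M.r_neg) (simp add: \<xi>_def)
        finally have "dot R k (H v) x = \<zero>\<^bsub>R\<^esub>" by (simp add: \<xi>_def)
        then show ?thesis using module_hom_closed[OF Hh v] by blast
      qed
      have "H r \<in> ideal_smult R (vec R k) (ideal_pow R m 2) ?syz"
        using module_hom_ideal_smult[OF R.vec_module R.vec_module Hh m2R _ Hsyz r2] by blast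
      then have 2: "H r \<in> ideal_smult R (vec R k) m ?syz" by (rule subsetD[OF ideal_smult_mono[OF m2m order_refl]])
      have sub: "submodule (ideal_smult R (vec R k) m ?syz) R (vec R k)"
        by (rule V.ideal_smult_submodule[OF id]) blast
      have cr: "c \<odot>\<^bsub>vec R k\<^esub> r \<in> carrier (vec R k)" using V.smult_closed cR r by blast
      have p: "\<phi> (\<psi> r) \<in> carrier (vec R k)" using V.submodule_carrier[OF sub 1] .
      have "\<phi> (\<psi> r) \<ominus>\<^bsub>vec R k\<^esub> H r = c \<odot>\<^bsub>vec R k\<^esub> r"
        unfolding H_def a_minus_def using cr p
        by (simp add: V.M.minus_add V.M.r_neg2 del: vec_simps)
      then have 3: "c \<odot>\<^bsub>vec R k\<^esub> r \<in> ideal_smult R (vec R k) m ?syz"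
        using V.submodule_minus[OF sub 1 2] by metis
      have "m +>\<^bsub>R\<^esub> c = m +>\<^bsub>R\<^esub> \<one>\<^bsub>R\<^esub>" using \<phi>0(2)[OF u(1)] u(2) by (simp add: c_def)
      then have "eq_mod R m c \<one>\<^bsub>R\<^esub>" using R.coset_eq_iff[OF id cR R.one_closed] by blast
      then have "c \<notin> m" using R.eq_mod_mem_iff[OF id] primeideal_one_notin[OF R.m_prime] by blast
      then obtain t where t: "t \<in> carrier R" "t \<otimes>\<^bsub>R\<^esub> c = \<one>\<^bsub>R\<^esub>" using R.unit_outside_m cR by blast
      have "t \<odot>\<^bsub>vec R k\<^esub> (c \<odot>\<^bsub>vec R k\<^esub> r) = r"
        using V.smult_assoc1[OF t(1) cR r(1)] V.smult_one[OF r(1)] t(2) by metis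
      then show "r \<in> ideal_smult R (vec R k) m ?syz"
        using V.submodule_smult[OF sub 3 t(1)] by metis
    qed
  next
    assume split: "quadratic_syzygies_split R m k x"
    have "(\<lambda>v. \<phi>0 v \<odot>\<^bsub>F 0\<^esub> u) \<in> module_hom R (F 0) (F 0)"
      unfolding module_hom_def using \<phi>0R u
      by (auto simp: module_hom_add[OF \<phi>0(1)] module_hom_smult[OF \<phi>0(1)] F0.smult_l_distr F0.smult_assoc1)
    then have fh: "(\<lambda>v. \<phi>0 v \<odot>\<^bsub>F 0\<^esub> u \<ominus>\<^bsub>F 0\<^esub> v) \<in> module_hom R (F 0) (F 0)"
      by (intro module_hom_diff F module_hom_id)
    have "\<phi>0 v \<odot>\<^bsub>F 0\<^esub> u \<ominus>\<^bsub>F 0\<^esub> v \<in> d 0 ` carrier (F (Suc 0))" if v: "v \<in> carrier (F 0)" for v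
    proof -
      interpret N: module R ?N by (rule N)
      have pu: "\<phi>0 v \<odot>\<^bsub>F 0\<^esub> u \<in> carrier (F 0)" using \<phi>0R u v by simp
      have "e (\<phi>0 v \<odot>\<^bsub>F 0\<^esub> u) = \<phi>0 v \<odot>\<^bsub>?N\<^esub> (m +>\<^bsub>R\<^esub> \<one>\<^bsub>R\<^esub>)"
        using module_hom_smult[OF eh \<phi>0R[OF v] u(1)] u(2) by metis
      also have "\<dots> = m +>\<^bsub>R\<^esub> \<phi>0 v" using smN[OF \<phi>0R[OF v] R.one_closed] \<phi>0R[OF v] by (simp only: R.r_one)
      also have "\<dots> = e v" by (rule \<phi>0(2)[OF v])
      finally have "e (\<phi>0 v \<odot>\<^bsub>F 0\<^esub> u \<ominus>\<^bsub>F 0\<^esub> v) = e v \<ominus>\<^bsub>?N\<^esub> e v"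
        using module_hom_minus[OF F N eh pu v] by metis
      also have "\<dots> = \<zero>\<^bsub>?N\<^esub>" unfolding a_minus_def by (rule N.M.r_neg[OF module_hom_closed[OF eh v]])
      finally show ?thesis unfolding ex0 using pu v by (blast intro: F0.minus_closed)
    qed
    \<comment> \<open>On the side of \<open>F\<close> the composite in degree 0 differs from the
      identity by elements of the kernel of \<open>e\<close>; the difference is lifted to
      \<open>F 1\<close>.\<close>
    then obtain s where s: "s \<in> module_hom R (F 0) (F (Suc 0))"
        "\<And>v. v \<in> carrier (F 0) \<Longrightarrow> d 0 (s v) = \<phi>0 v \<odot>\<^bsub>F 0\<^esub> u \<ominus>\<^bsub>F 0\<^esub> v"
      using free_module_lift[OF free F F fh dh] by blast
    \<comment> \<open>\<open>G\<close> maps all of \<open>F 1\<close> into \<open>Z\<close>, hence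
      \<open>m^2 F_1\<close> into \<open>m^2 Z\<close>; on cycles the term with \<open>s\<close>
      vanishes.\<close>
    define G where "G z = \<psi> (\<phi> z) \<ominus>\<^bsub>F (Suc 0)\<^esub> z \<ominus>\<^bsub>F (Suc 0)\<^esub> s (d 0 z)" for z
    have Gh: "G \<in> module_hom R (F (Suc 0)) (F (Suc 0))"
      unfolding G_def
      by (intro module_hom_diff F module_hom_id module_hom_compose[OF \<phi>(1) \<psi>] module_hom_compose[OF dh s(1)])
    have GZ: "G z \<in> ?Z" if z: "z \<in> carrier (F (Suc 0))" for z
    proof -
      have dz: "d 0 z \<in> carrier (F 0)" using module_hom_closed[OF dh z] .
      have c: "\<phi> z \<in> carrier (vec R k)" using module_hom_closed[OF \<phi>(1) z] .
      have c': "\<psi> (\<phi> z) \<in> carrier (F (Suc 0))" "s (d 0 z) \<in> carrier (F (Suc 0))"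
        using module_hom_closed[OF \<psi> c] module_hom_closed[OF s(1) dz] by auto
      have pu: "\<phi>0 (d 0 z) \<odot>\<^bsub>F 0\<^esub> u \<in> carrier (F 0)" using \<phi>0R[OF dz] u by simp
      have "d 0 (G z) = d 0 (\<psi> (\<phi> z)) \<ominus>\<^bsub>F 0\<^esub> d 0 z \<ominus>\<^bsub>F 0\<^esub> d 0 (s (d 0 z))"
        unfolding G_def using c' z by (simp add: module_hom_minus[OF F F dh])
      also have "\<dots> = \<phi>0 (d 0 z) \<odot>\<^bsub>F 0\<^esub> u \<ominus>\<^bsub>F 0\<^esub> d 0 z \<ominus>\<^bsub>F 0\<^esub> (\<phi>0 (d 0 z) \<odot>\<^bsub>F 0\<^esub> u \<ominus>\<^bsub>F 0\<^esub> d 0 z)"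
        unfolding d\<psi>[OF c] \<phi>(2)[OF z] s(2)[OF dz] ..
      also have "\<dots> = \<zero>\<^bsub>F 0\<^esub>"
        unfolding a_minus_def using pu dz by (intro F0.M.r_neg) auto
      finally show ?thesis using module_hom_closed[OF Gh z] by blast
    qed
    show "resolution_split R m F d"
      unfolding resolution_split_def One_nat_def
    proof (intro ballI impI)
      fix z assume z2: "z \<in> ideal_smult R (F (Suc 0)) (ideal_pow R m 2) (carrier (F (Suc 0)))"
        and dz: "d 0 z = \<zero>\<^bsub>F 0\<^esub>"
      have z: "z \<in> carrier (F (Suc 0))" using F1.ideal_smult_carrier[OF m2R _ z2] by blast
      have "\<phi> z \<in> ideal_smult R (vec R k) (ideal_pow R m 2) (carrier (vec R k))"
        using module_hom_ideal_smult[OF F R.vec_module \<phi>(1) m2R _ _ z2] module_hom_closed[OF \<phi>(1)] by blast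
      moreover have "\<forall>i<k. v i \<in> ideal_pow R m 2"
        if "v \<in> ideal_smult R (vec R k) (ideal_pow R m 2) (carrier (vec R k))" for v
        using that
        by induction (auto simp: ideal_zero[OF id2] intro!: ideal_add[OF id2] ideal_rmult[OF id2])
      ultimately have "\<forall>i<k. \<phi> z i \<in> ideal_pow R m 2" by blast
      moreover have "\<phi> z \<in> ?syz" using \<phi>Z z dz by blast
      ultimately have "\<phi> z \<in> ideal_smult R (vec R k) m ?syz"
        using split unfolding quadratic_syzygies_split_def by blast
      then have 1: "\<psi> (\<phi> z) \<in> ideal_smult R (F (Suc 0)) m ?Z"
        by (intro module_hom_ideal_smult[OF R.vec_module F \<psi> mR _ \<psi>syz]) auto
      have "G z \<in> ideal_smult R (F (Suc 0)) (ideal_pow R m 2) ?Z"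
        using module_hom_ideal_smult[OF F F Gh m2R _ GZ z2] by blast
      then have 2: "G z \<in> ideal_smult R (F (Suc 0)) m ?Z" by (rule subsetD[OF ideal_smult_mono[OF m2m order_refl]])
      have sub: "submodule (ideal_smult R (F (Suc 0)) m ?Z) R (F (Suc 0))"
        by (rule F1.ideal_smult_submodule[OF id]) blast
      have p: "\<psi> (\<phi> z) \<in> carrier (F (Suc 0))" using F1.submodule_carrier[OF sub 1] .
      have "s (d 0 z) = \<zero>\<^bsub>F (Suc 0)\<^esub>" unfolding dz by (rule module_hom_zero[OF F F s(1)])
      then have "G z = \<psi> (\<phi> z) \<ominus>\<^bsub>F (Suc 0)\<^esub> z"
        unfolding G_def using p z F1.M.l_neg[OF F1.M.zero_closed] by (simp add: a_minus_def)
      then have "\<psi> (\<phi> z) \<ominus>\<^bsub>F (Suc 0)\<^esub> G z = z"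
        using p z by (simp add: a_minus_def F1.M.minus_add F1.M.r_neg2)
      then show "z \<in> ideal_smult R (F (Suc 0)) m ?Z" using F1.submodule_minus[OF sub 1 2] by metis
    qed
  qed
qed

section \<open>The map on Tor\<close>

lemma reduction_hom:
  assumes R: "cring R" and I: "ideal I R" and J: "ideal J R" "J \<subseteq> I"
  shows "(\<lambda>C. I <+>\<^bsub>R\<^esub> C) \<in> module_hom R (quot_module R J) (quot_module R I)"
proof -
  interpret cring R by (rule R)
  note coset = set_add_coset[OF I J]
  have J_carrier: "carrier (quot_module R J) = {J +>\<^bsub>R\<^esub> r | r. r \<in> carrier R}"
    unfolding quot_module_simps by (rule Quot_carrier[OF J(1)])
  have I_carrier: "carrier (quot_module R I) = {I +>\<^bsub>R\<^esub> r | r. r \<in> carrier R}"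
    unfolding quot_module_simps by (rule Quot_carrier[OF I])
  show ?thesis unfolding module_hom_def
  proof (intro CollectI conjI ballI Pi_I)
    fix C assume "C \<in> carrier (quot_module R J)"
    then obtain s where s: "C = J +>\<^bsub>R\<^esub> s" "s \<in> carrier R" unfolding J_carrier by blast
    then show "I <+>\<^bsub>R\<^esub> C \<in> carrier (quot_module R I)" unfolding I_carrier using coset by blast
    show "I <+>\<^bsub>R\<^esub> (r \<odot>\<^bsub>quot_module R J\<^esub> C) = r \<odot>\<^bsub>quot_module R I\<^esub> (I <+>\<^bsub>R\<^esub> C)" if "r \<in> carrier R" for r
      unfolding quot_module_simps s(1) using that s(2) by (simp add: Quot_mult[OF I] Quot_mult[OF J(1)] coset)
    show "I <+>\<^bsub>R\<^esub> (C \<oplus>\<^bsub>quot_module R J\<^esub> C') = (I <+>\<^bsub>R\<^esub> C) \<oplus>\<^bsub>quot_module R I\<^esub> (I <+>\<^bsub>R\<^esub> C')"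
      if C': "C' \<in> carrier (quot_module R J)" for C'
    proof -
      obtain t where t: "C' = J +>\<^bsub>R\<^esub> t" "t \<in> carrier R" using C' unfolding J_carrier by blast
      show ?thesis
        unfolding quot_module_simps s(1) t(1) using s(2) t(2) by (simp add: Quot_add[OF I] Quot_add[OF J(1)] coset)
    qed
  qed
qed

text \<open>A class in the source is given by \<open>v\<close> in \<open>F 2\<close> with
  \<open>d v\<close> in \<open>m^2 F_1\<close>, and it goes to zero iff \<open>v\<close> is in
  \<open>d F_3 + m F_2\<close>. As \<open>F 2\<close> maps onto \<open>Z\<close> with kernel
  \<open>d F_3\<close>, this means \<open>d v\<close> in \<open>m Z\<close>; and \<open>d v\<close>
  ranges over \<open>Z \<inter> m^2 F_1\<close>.\<close>

lemma nu_zero_iff: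
  assumes loc: "noetherian_local R m" and res: "free_resolution R F d e (quot_module R m)"
  shows "(\<forall>c \<in> carrier (Tor R F d (quot_module R (ideal_pow R m 2)) 2).
            nu_1_2 R m F d c = \<one>\<^bsub>Tor R F d (quot_module R m) 2\<^esub>)
         \<longleftrightarrow> resolution_split R m F d"
proof -
  interpret R: noetherian_local R m by (rule loc)
  define J where "J = ideal_pow R m 2"
  note F = resolution_module[OF res] and dh = resolution_diff[OF res]
  have id: "ideal m R" by (rule R.m_ideal)
  have id2: "ideal J R" unfolding J_def by (rule R.ideal_pow_ideal[OF id])
  have mR: "m \<subseteq> carrier R" and m2R: "J \<subseteq> carrier R"
    using ideal_carrier[OF id] ideal_carrier[OF id2] by auto
  have m2m: "J \<subseteq> m" unfolding J_def using R.ideal_pow_antimono[OF id, of 1 2] R.ideal_pow_1[OF id] by simp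
  let ?N1 = "quot_module R m" and ?N2 = "quot_module R J"
  have T1: "residue_tensor R (F i) m" and T2: "residue_tensor R (F i) J" for i
    using F id id2 by (auto intro: residue_tensor.intro residue_tensor_axioms.intro)
  define c1 where "c1 i = residue_tensor.cls R (F i) m" for i
  define c2 where "c2 i = residue_tensor.cls R (F i) J" for i
  let ?G1 = "\<lambda>i. tensor_group R (F i) ?N1" and ?G2 = "\<lambda>i. tensor_group R (F i) ?N2"
  have car1: "carrier (?G1 i) = c1 i ` carrier (F i)" and car2: "carrier (?G2 i) = c2 i ` carrier (F i)" for i
    unfolding c1_def c2_def by (rule residue_tensor.tensor_group_carrier[OF T1] residue_tensor.tensor_group_carrier[OF T2])+
  have map1: "tensor_map R (F i) ?N1 (d i) id (c1 (Suc i) v) = c1 i (d i v)" for i v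
    unfolding c1_def by (rule tensor_map_cls[OF T1 T1 dh]) (simp_all add: module_hom_def)
  have map2: "tensor_map R (F i) ?N2 (d i) id (c2 (Suc i) v) = c2 i (d i v)" for i v
    unfolding c2_def by (rule tensor_map_cls[OF T2 T2 dh]) (simp_all add: module_hom_def)
  let ?g = "\<lambda>C. m <+>\<^bsub>R\<^esub> C"
  have map12: "tensor_map R (F i) ?N1 id ?g (c2 i v) = c1 i v" for i v
    unfolding c1_def c2_def
    using tensor_map_cls[OF T2[of i] T1[of i] _ reduction_hom[OF R.is_cring id id2 m2m], where f = id and x = v]
      R.set_add_coset[OF id id2 m2m R.one_closed] by (simp add: module_hom_def Pi_def)
  let ?B1 = "Tor_boundaries R F d ?N1 2" and ?B2 = "Tor_boundaries R F d ?N2 2"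
  let ?F1 = "F (Suc 0)" and ?F2 = "F (Suc (Suc 0))" and ?F3 = "F (Suc (Suc (Suc 0)))"
  let ?d2 = "d (Suc (Suc 0))"
  have two: "2 = Suc (Suc 0)" by simp
  have B1: "?B1 = {c1 2 (?d2 y) | y. y \<in> carrier ?F3}"
    unfolding Tor_boundaries_def two car1 image_image map1 by blast
  have B2: "?B2 = {c2 2 (?d2 y) | y. y \<in> carrier ?F3}"
    unfolding Tor_boundaries_def two car2 image_image map2 by blast
  interpret M1: module R ?F1 by (rule F)
  interpret M2: module R ?F2 by (rule F)
  interpret M3: module R ?F3 by (rule F)
  have d2c: "?d2 y \<in> carrier ?F2" if "y \<in> carrier ?F3" for y by (rule module_hom_closed[OF dh that])
  have d1c: "d (Suc 0) v \<in> carrier ?F1" if "v \<in> carrier ?F2" for v by (rule module_hom_closed[OF dh that])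
  let ?cyc = "\<lambda>v. v \<in> carrier ?F2 \<and> d (Suc 0) v \<in> ideal_smult R ?F1 J (carrier ?F1)"
  have cycles: "Tor_cycles R F d ?N2 2 = {c2 2 v | v. ?cyc v}"
  proof -
    have "Tor_cycles R F d ?N2 2 = {c \<in> carrier (?G2 (Suc (Suc 0))).
        tensor_map R ?F1 ?N2 (d (Suc 0)) id c = \<one>\<^bsub>?G2 (Suc 0)\<^esub>}"
      unfolding Tor_cycles_def two by (simp add: kernel_def)
    also have "\<dots> = {c2 2 v | v. v \<in> carrier ?F2 \<and> c2 (Suc 0) (d (Suc 0) v) = \<one>\<^bsub>?G2 (Suc 0)\<^esub>}"
      unfolding car2 two using map2[of "Suc 0"] by auto
    also have "\<dots> = {c2 2 v | v. ?cyc v}"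
      using residue_tensor.cls_eq_one_iff[OF T2, of _ "Suc 0"] d1c unfolding c2_def by blast
    finally show ?thesis .
  qed
  have add1: "c1 2 v \<otimes>\<^bsub>?G1 2\<^esub> c1 2 w = c1 2 (v \<oplus>\<^bsub>?F2\<^esub> w)"
    and add2: "c2 2 v \<otimes>\<^bsub>?G2 2\<^esub> c2 2 w = c2 2 (v \<oplus>\<^bsub>?F2\<^esub> w)"
    if "v \<in> carrier ?F2" "w \<in> carrier ?F2" for v w
    using residue_tensor.cls_add[OF T1, of v 2 w] residue_tensor.cls_add[OF T2, of v 2 w] that
    unfolding c1_def c2_def two by auto
  \<comment> \<open>\<open>bd v\<close> says that \<open>v \<otimes> 1\<close> is a boundary in
    \<open>F \<otimes> R/m\<close>.\<close>
  define bd where "bd v \<longleftrightarrow> (\<exists>y\<in>carrier ?F3. v \<ominus>\<^bsub>?F2\<^esub> ?d2 y \<in> ideal_smult R ?F2 m (carrier ?F2))" for v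
  have B1_iff: "c1 2 v \<in> ?B1 \<longleftrightarrow> bd v" if "v \<in> carrier ?F2" for v
    unfolding B1 bd_def using residue_tensor.cls_eq_iff[OF T1, of v "Suc (Suc 0)"] that d2c
    unfolding c1_def two by blast
  let ?C = "\<lambda>v. ?B2 #>\<^bsub>?G2 2\<^esub> c2 2 v"
  have carTor: "carrier (Tor R F d ?N2 2) = {?C v | v. ?cyc v}"
    unfolding Tor_def carrier_FactGroup by (auto simp: cycles r_coset_def)
  have Cv: "?C v = {c2 2 (?d2 y \<oplus>\<^bsub>?F2\<^esub> v) | y. y \<in> carrier ?F3}" if "v \<in> carrier ?F2" for v
  proof -
    have "?C v = {c2 2 (?d2 y) \<otimes>\<^bsub>?G2 2\<^esub> c2 2 v | y. y \<in> carrier ?F3}"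
      unfolding r_coset_def B2 by auto
    then show ?thesis unfolding setcompr_eq_image by (simp add: add2 d2c that)
  qed
  \<comment> \<open>Boundaries enter twice: \<open>?d2 y\<close> comes from the coset
    \<open>?C v\<close>, and \<open>?d2 z\<close> from the multiplication by boundaries in
    \<open>Tor_map\<close>.\<close>
  have nu: "nu_1_2 R m F d (?C v) = {c1 2 (?d2 z \<oplus>\<^bsub>?F2\<^esub> (?d2 y \<oplus>\<^bsub>?F2\<^esub> v)) | z y. z \<in> carrier ?F3 \<and> y \<in> carrier ?F3}"
    if v: "v \<in> carrier ?F2" for v
  proof -
    have "tensor_map R (F 2) ?N1 id ?g ` ?C v = {c1 2 (?d2 y \<oplus>\<^bsub>?F2\<^esub> v) | y. y \<in> carrier ?F3}"
      unfolding Cv[OF v] using map12[of 2] by auto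
    then have "nu_1_2 R m F d (?C v)
      = {c1 2 (?d2 z) \<otimes>\<^bsub>?G1 2\<^esub> c1 2 (?d2 y \<oplus>\<^bsub>?F2\<^esub> v) | z y. z \<in> carrier ?F3 \<and> y \<in> carrier ?F3}"
      unfolding nu_1_2_def Tor_map_def set_mult_def B1 by auto
    moreover have "c1 2 (?d2 z) \<otimes>\<^bsub>?G1 2\<^esub> c1 2 (?d2 y \<oplus>\<^bsub>?F2\<^esub> v) = c1 2 (?d2 z \<oplus>\<^bsub>?F2\<^esub> (?d2 y \<oplus>\<^bsub>?F2\<^esub> v))"
      if "z \<in> carrier ?F3" "y \<in> carrier ?F3" for z y
      using d2c that v by (intro add1) auto
    then have "{c1 2 (?d2 z) \<otimes>\<^bsub>?G1 2\<^esub> c1 2 (?d2 y \<oplus>\<^bsub>?F2\<^esub> v) | z y. z \<in> carrier ?F3 \<and> y \<in> carrier ?F3}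
      = {c1 2 (?d2 z \<oplus>\<^bsub>?F2\<^esub> (?d2 y \<oplus>\<^bsub>?F2\<^esub> v)) | z y. z \<in> carrier ?F3 \<and> y \<in> carrier ?F3}"
      by (intro Collect_cong ex_cong1) metis
    ultimately show ?thesis by simp
  qed
  have nu_iff: "nu_1_2 R m F d (?C v) = ?B1 \<longleftrightarrow> bd v" if v: "v \<in> carrier ?F2" for v
  proof
    assume eq: "nu_1_2 R m F d (?C v) = ?B1"
    have "?d2 \<zero>\<^bsub>?F3\<^esub> \<oplus>\<^bsub>?F2\<^esub> (?d2 \<zero>\<^bsub>?F3\<^esub> \<oplus>\<^bsub>?F2\<^esub> v) = v"
      using module_hom_zero[OF F F dh] v by simp
    then have "c1 2 v \<in> nu_1_2 R m F d (?C v)"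
      unfolding nu[OF v] by (metis (mono_tags, lifting) M3.M.zero_closed mem_Collect_eq)
    then show "bd v" using eq B1_iff[OF v] by simp
  next
    assume "bd v"
    then obtain y0 where y0: "y0 \<in> carrier ?F3" "v \<ominus>\<^bsub>?F2\<^esub> ?d2 y0 \<in> ideal_smult R ?F2 m (carrier ?F2)"
      unfolding bd_def by blast
    have shift: "c1 2 (w \<oplus>\<^bsub>?F2\<^esub> v) = c1 2 (w \<oplus>\<^bsub>?F2\<^esub> ?d2 y0)" if w: "w \<in> carrier ?F2" for w
    proof -
      have "c1 2 v = c1 2 (?d2 y0)"
        using residue_tensor.cls_eq_iff[OF T1 v d2c[OF y0(1)]] y0(2) unfolding c1_def two by blast
      then show ?thesis using add1[OF w v] add1[OF w d2c[OF y0(1)]] by simp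
    qed
    have nu_eq: "c1 2 (?d2 z \<oplus>\<^bsub>?F2\<^esub> (?d2 y \<oplus>\<^bsub>?F2\<^esub> v)) = c1 2 (?d2 (z \<oplus>\<^bsub>?F3\<^esub> y \<oplus>\<^bsub>?F3\<^esub> y0))"
      if zy: "z \<in> carrier ?F3" "y \<in> carrier ?F3" for z y
    proof -
      have "?d2 z \<oplus>\<^bsub>?F2\<^esub> (?d2 y \<oplus>\<^bsub>?F2\<^esub> v) = ?d2 (z \<oplus>\<^bsub>?F3\<^esub> y) \<oplus>\<^bsub>?F2\<^esub> v"
        using zy v d2c by (simp add: module_hom_add[OF dh] M2.M.a_assoc)
      then show ?thesis using shift[OF d2c[of "z \<oplus>\<^bsub>?F3\<^esub> y"]] zy y0(1) by (simp add: module_hom_add[OF dh])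
    qed
    show "nu_1_2 R m F d (?C v) = ?B1"
    proof (intro equalityI subsetI)
      fix c assume "c \<in> nu_1_2 R m F d (?C v)"
      then obtain z y where zy: "z \<in> carrier ?F3" "y \<in> carrier ?F3"
          "c = c1 2 (?d2 z \<oplus>\<^bsub>?F2\<^esub> (?d2 y \<oplus>\<^bsub>?F2\<^esub> v))" unfolding nu[OF v] by blast
      then have "c = c1 2 (?d2 (z \<oplus>\<^bsub>?F3\<^esub> y \<oplus>\<^bsub>?F3\<^esub> y0))" using nu_eq by simp
      moreover have "z \<oplus>\<^bsub>?F3\<^esub> y \<oplus>\<^bsub>?F3\<^esub> y0 \<in> carrier ?F3" using zy y0 by simp
      ultimately show "c \<in> ?B1" unfolding B1 by blast
    next
      fix c assume "c \<in> ?B1"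
      then obtain w where w: "w \<in> carrier ?F3" "c = c1 2 (?d2 w)" unfolding B1 by blast
      let ?z = "w \<ominus>\<^bsub>?F3\<^esub> y0"
      have z: "?z \<in> carrier ?F3" "?z \<oplus>\<^bsub>?F3\<^esub> \<zero>\<^bsub>?F3\<^esub> \<oplus>\<^bsub>?F3\<^esub> y0 = w"
        using w y0 by (simp_all add: a_minus_def M3.M.a_assoc M3.M.l_neg)
      then have "c = c1 2 (?d2 ?z \<oplus>\<^bsub>?F2\<^esub> (?d2 \<zero>\<^bsub>?F3\<^esub> \<oplus>\<^bsub>?F2\<^esub> v))"
        using nu_eq[OF z(1) M3.M.zero_closed] w by simp
      then show "c \<in> nu_1_2 R m F d (?C v)" unfolding nu[OF v] using z(1) M3.M.zero_closed by blast
    qed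
  qed
  have one: "\<one>\<^bsub>Tor R F d ?N1 2\<^esub> = ?B1" unfolding Tor_def by (rule one_FactGroup)
  have "(\<forall>c \<in> carrier (Tor R F d ?N2 2). nu_1_2 R m F d c = \<one>\<^bsub>Tor R F d ?N1 2\<^esub>)
      \<longleftrightarrow> (\<forall>v. ?cyc v \<longrightarrow> bd v)"
    unfolding one carTor using nu_iff by blast
  also have "\<dots> \<longleftrightarrow> resolution_split R m F d"
  proof -
    let ?Z = "{z \<in> carrier ?F1. d 0 z = \<zero>\<^bsub>F 0\<^esub>}"
    have ex1: "d (Suc 0) ` carrier ?F2 = ?Z" by (rule resolution_exact[OF res])
    have ex2: "?d2 ` carrier ?F3 = {v \<in> carrier ?F2. d (Suc 0) v = \<zero>\<^bsub>?F1\<^esub>}" by (rule resolution_exact[OF res])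
    \<comment> \<open>By exactness at \<open>F 1\<close>, the module \<open>m Z\<close> is the image
      of \<open>m F_2\<close>.\<close>
    have lift: "\<exists>w\<in>ideal_smult R ?F2 m (carrier ?F2). d (Suc 0) w = z" if "z \<in> ideal_smult R ?F1 m ?Z" for z
      using that
    proof induction
      case zero
      then show ?case using module_hom_zero[OF F F dh] ideal_smult.zero by metis
    next
      case (step r z v)
      then obtain w where w: "w \<in> ideal_smult R ?F2 m (carrier ?F2)" "d (Suc 0) w = v" by blast
      have "z \<in> d (Suc 0) ` carrier ?F2" unfolding ex1 by fact
      then obtain y where y: "y \<in> carrier ?F2" "d (Suc 0) y = z" by blast
      have c: "r \<in> carrier R" "w \<in> carrier ?F2" using step mR M2.ideal_smult_carrier[OF mR _ w(1)] by auto
      have "d (Suc 0) (r \<odot>\<^bsub>?F2\<^esub> y \<oplus>\<^bsub>?F2\<^esub> w) = r \<odot>\<^bsub>?F1\<^esub> z \<oplus>\<^bsub>?F1\<^esub> v"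
        using c y w by (simp add: module_hom_add[OF dh] module_hom_smult[OF dh])
      moreover have "r \<odot>\<^bsub>?F2\<^esub> y \<oplus>\<^bsub>?F2\<^esub> w \<in> ideal_smult R ?F2 m (carrier ?F2)"
        using step y w by (intro ideal_smult.step)
      ultimately show ?case by blast
    qed
    show ?thesis
      unfolding resolution_split_def J_def[symmetric] One_nat_def
    proof (intro iffI ballI impI allI)
      fix z assume all: "\<forall>v. ?cyc v \<longrightarrow> bd v"
        and z: "z \<in> ideal_smult R ?F1 J (carrier ?F1)" "d 0 z = \<zero>\<^bsub>F 0\<^esub>"
      have "z \<in> ?Z" using z M1.ideal_smult_carrier[OF m2R _ z(1)] by blast
      then obtain v where v: "v \<in> carrier ?F2" "z = d (Suc 0) v" unfolding ex1[symmetric] by blast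
      then have "bd v" using all z by blast
      then obtain y where y: "y \<in> carrier ?F3" "v \<ominus>\<^bsub>?F2\<^esub> ?d2 y \<in> ideal_smult R ?F2 m (carrier ?F2)"
        unfolding bd_def by blast
      have "?d2 y \<in> {v \<in> carrier ?F2. d (Suc 0) v = \<zero>\<^bsub>?F1\<^esub>}" unfolding ex2[symmetric] using y by blast
      then have dd: "d (Suc 0) (?d2 y) = \<zero>\<^bsub>?F1\<^esub>" by blast
      have "d (Suc 0) (v \<ominus>\<^bsub>?F2\<^esub> ?d2 y) = z \<ominus>\<^bsub>?F1\<^esub> \<zero>\<^bsub>?F1\<^esub>"
        using module_hom_minus[OF F F dh v(1) d2c[OF y(1)]] v(2) dd by simp
      also have "\<dots> = z"
        using \<open>z \<in> ?Z\<close> M1.M.l_neg[OF M1.M.zero_closed] by (simp add: a_minus_def)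
      finally have "d (Suc 0) (v \<ominus>\<^bsub>?F2\<^esub> ?d2 y) = z" .
      moreover have "d (Suc 0) w \<in> ?Z" if "w \<in> carrier ?F2" for w using that unfolding ex1[symmetric] by blast
      ultimately show "z \<in> ideal_smult R ?F1 m ?Z"
        using module_hom_ideal_smult[OF F F dh mR order_refl _ y(2), of ?Z] by metis
    next
      fix v assume split: "\<forall>z\<in>ideal_smult R ?F1 J (carrier ?F1). d 0 z = \<zero>\<^bsub>F 0\<^esub> \<longrightarrow>
          z \<in> ideal_smult R ?F1 m ?Z" and v: "?cyc v"
      have "d (Suc 0) v \<in> ?Z" unfolding ex1[symmetric] using v by blast
      then have "d (Suc 0) v \<in> ideal_smult R ?F1 m ?Z" using split v by blast
      then obtain w where w: "w\<in>ideal_smult R ?F2 m (carrier ?F2)" "d (Suc 0) w = d (Suc 0) v" using lift by blast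
      have wc: "w \<in> carrier ?F2" using M2.ideal_smult_carrier[OF mR _ w(1)] by blast
      have "d (Suc 0) (v \<ominus>\<^bsub>?F2\<^esub> w) = d (Suc 0) v \<ominus>\<^bsub>?F1\<^esub> d (Suc 0) v"
        using module_hom_minus[OF F F dh _ wc] v w by metis
      also have "\<dots> = \<zero>\<^bsub>?F1\<^esub>" unfolding a_minus_def using d1c v by (intro M1.M.r_neg) blast
      finally have "v \<ominus>\<^bsub>?F2\<^esub> w \<in> ?d2 ` carrier ?F3" unfolding ex2 using v wc by (blast intro: M2.minus_closed)
      then obtain y where y: "y \<in> carrier ?F3" "?d2 y = v \<ominus>\<^bsub>?F2\<^esub> w" by force
      have "v \<ominus>\<^bsub>?F2\<^esub> ?d2 y = w"
        unfolding y(2) using v wc by (simp add: a_minus_def M2.M.minus_add M2.M.r_neg2)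
      then show "bd v" unfolding bd_def using y(1) w(1) by metis
    qed
  qed
  finally show ?thesis unfolding J_def .
qed

section \<open>The value 1 of the invariant, and the combination of the equivalences\<close>

lemma Inf_enat_mem: "S \<noteq> {} \<Longrightarrow> Inf S \<in> S" for S :: "enat set"
  unfolding Inf_enat_def using LeastI_ex[of "\<lambda>x. x \<in> S"] by auto

lemma s_invariant_eq_1_iff:
  "s_invariant Q n a = 1 \<longleftrightarrow> a \<inter> ideal_pow Q n 3 \<subseteq> ideal_prod Q n a"
proof
  assume s: "s_invariant Q n a = 1"
  let ?S = "{enat i | i. 1 \<le> i \<and> a \<inter> ideal_pow Q n (i + 2) \<subseteq> ideal_prod Q n a}"
  have "?S \<noteq> {}"
  proof
    assume "?S = {}"
    then have "s_invariant Q n a = Inf {}" unfolding s_invariant_def by (rule arg_cong)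
    then show False using s by (simp add: top_enat_def)
  qed
  then have "Inf ?S \<in> ?S" by (rule Inf_enat_mem)
  then obtain i where i: "Inf ?S = enat i" "a \<inter> ideal_pow Q n (i + 2) \<subseteq> ideal_prod Q n a" by blast
  have "enat i = enat 1" using s i(1) unfolding s_invariant_def one_enat_def by metis
  then show "a \<inter> ideal_pow Q n 3 \<subseteq> ideal_prod Q n a" using i(2) by (simp add: numeral_3_eq_3)
next
  assume "a \<inter> ideal_pow Q n 3 \<subseteq> ideal_prod Q n a"
  then have "enat 1 \<in> {enat i | i. 1 \<le> i \<and> a \<inter> ideal_pow Q n (i + 2) \<subseteq> ideal_prod Q n a}"
    by (intro CollectI exI[of _ 1]) (simp add: numeral_3_eq_3)
  then have "s_invariant Q n a \<le> enat 1" unfolding s_invariant_def by (rule Inf_lower)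
  moreover have "enat 1 \<le> s_invariant Q n a" unfolding s_invariant_def by (rule Inf_greatest) auto
  ultimately show "s_invariant Q n a = 1" by (simp add: one_enat_def)
qed

theorem lemma5p4:
  fixes R :: "('a, 'r) ring_scheme" and m :: "'a set"
    and F :: "nat \<Rightarrow> ('a, 'b, 'm) module_scheme" and d :: "nat \<Rightarrow> 'b \<Rightarrow> 'b" and e :: "'b \<Rightarrow> 'a set"
    and Q :: "('q, 's) ring_scheme" and n a :: "'q set"
  assumes "noetherian_local_ring R m"
    and "m \<noteq> {\<zero>\<^bsub>R\<^esub>}"
    and "free_resolution R F d e (quot_module R m)"
    and "minimal_Cohen_presentation R m Q n a"
  shows "(\<forall>x \<in> carrier (Tor R F d (quot_module R (ideal_pow R m 2)) 2).
            nu_1_2 R m F d x = \<one>\<^bsub>Tor R F d (quot_module R m) 2\<^esub>)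
         \<longleftrightarrow> s_invariant Q n a = 1"
proof -
  have loc: "noetherian_local R m" by (rule noetherian_localI[OF assms(1)])
  have pres: "regular_local_ring Q n" "ideal a Q" "a \<subseteq> ideal_pow Q n 2" "completion R m \<simeq> Q Quot a"
    using assms(4) by (auto simp: minimal_Cohen_presentation_def)
  \<comment> \<open>\<open>k\<close> is the dimension of \<open>Q\<close>; it is also the number of
    generators \<open>x\<close> of \<open>m\<close> in the comparison.\<close>
  obtain k y0 where reg: "regular_system Q n k y0" using regular_system_exists[OF pres(1)] by blast
  have "noetherian_local Q n" using reg by (rule regular_system.axioms)
  then obtain \<tau> where "completion_map R m Q n a \<tau>"
    using completion_map_exists[OF loc _ pres(2-4)] by blast
  then obtain y x rel where "comparison R m Q n k y a x rel"
    using completion_map.comparison_exists[OF _ reg] by blast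
  then interpret C: comparison R m Q n k y a x rel .
  have "resolution_split R m F d \<longleftrightarrow> quadratic_syzygies_split R m k x"
    by (rule resolution_split_iff[OF loc assms(3) C.x_carrier C.m_gen])
  also have "\<dots> \<longleftrightarrow> a \<inter> ideal_pow Q n 3 \<subseteq> ideal_prod Q n a"
    using C.split_if_cubic_relations_trivial C.cubic_relations_trivial_if_split by blast
  finally show ?thesis
    using nu_zero_iff[OF loc assms(3)] s_invariant_eq_1_iff[of Q n a] by blast
qed

end
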